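(* Let $(G,H)$ be a Klein geometry with $G/H$ connected and let $\mathcal S$ be a subgroup of $Ext(\mathfrak g,H,\mathrm{Ad}_G|_H)$ that is a Lie subgroup of $Gl(\mathfrak g)\times\mathrm{Aut}(H)$. The $\mathcal S$-automorphism group of the Cartan geometry $(G\to G/H,\omega_G)$ of type $(\mathfrak g,H,\mathrm{Ad}_G|_H)$ is the group $$G\rtimes\big(\mathcal S\cap\{(d\sigma,\sigma|_H):\sigma\in\mathrm{Aut}(G),\ \sigma(H)\subset H\}\big).$$
   Context: A Klein geometry $(G,H)$ is a finite-dimensional real Lie group $G$ with a closed subgroup $H$; $\mathfrak g$, $\mathfrak h$ are the Lie algebras, and $\omega_G$ is the Maurer–Cartan form of $G$, viewed as a Cartan connection on the principal $H$-bundle $G\to G/H$. $Ext(\mathfrak g,H,\mathrm{Ad}_G|_H)$ is the group of pairs $(\beta,j)\in Gl(\mathfrak g)\times\mathrm{Aut}(H)$ with $\beta|_{\mathfrak h}=dj$ and $\beta\circ\mathrm{Ad}_G(h)=\mathrm{Ad}_G(j(h))\circ\beta$ for all $h\in H$. The $\mathcal S$-automorphism group of $(G\to G/H,\omega_G)$ is the group of all bijective principal bundle morphisms $\Phi:G\to G$ over some $j\in\mathrm{Aut}(H)$ (i.e. $\Phi(gh)=\Phi(g)j(h)$ for $h\in H$) such that $\Phi^*\omega_G=\beta\circ\omega_G$ for some $(\beta,j)\in\mathcal S$. *)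

theory Defs
  imports
    "HOL-Analysis.Analysis"
    "HOL-Algebra.Bij"
    "HOL-Algebra.Left_Coset"
begin

section \<open>Smooth maps between Euclidean spaces\<close>

(* Meaningful for open U. *)
primrec Ck_on :: "nat \<Rightarrow> 'a::euclidean_space set \<Rightarrow> ('a \<Rightarrow> 'b::euclidean_space) \<Rightarrow> bool" where
  "Ck_on 0 U f \<longleftrightarrow> continuous_on U f"
| "Ck_on (Suc k) U f \<longleftrightarrow>
     (\<forall>x\<in>U. f differentiable (at x)) \<and>
     (\<forall>v. Ck_on k U (\<lambda>x. frechet_derivative f (at x) v))"

(* Smoothness on an arbitrary set is local extendability to a smooth map on an open set of the
   ambient space. On open sets, and on relatively open subsets of linear subspaces, this is
   ordinary smoothness. *)
definition smooth_on :: "'a::euclidean_space set \<Rightarrow> ('a \<Rightarrow> 'b::euclidean_space) \<Rightarrow> bool" where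
  "smooth_on A f \<longleftrightarrow>
     (\<forall>x\<in>A. \<exists>U F. open U \<and> x \<in> U \<and> (\<forall>k. Ck_on k U F) \<and> (\<forall>y\<in>A \<inter> U. F y = f y))"


section \<open>Smooth manifolds\<close>

(* Charts (U, phi) take values in open subsets of a linear subspace, model M, of the Euclidean
   space 'e. A plain type 'e as model would exclude manifolds of dimension 0, since every type of
   class euclidean_space has positive dimension. *)
record ('a, 'e) manifold =
  mtop :: "'a topology"
  model :: "'e set"
  atlas :: "('a set \<times> ('a \<Rightarrow> 'e)) set"

locale smooth_manifold =
  fixes M :: "('a, 'e::euclidean_space) manifold"
  assumes Hausdorff: "Hausdorff_space (mtop M)"
    and second_countable: "second_countable (mtop M)"
    and subspace_model: "subspace (model M)"
    and chart:
      "(U, \<phi>) \<in> atlas M \<Longrightarrow>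
         openin (mtop M) U \<and>
         openin (top_of_set (model M)) (\<phi> ` U) \<and>
         homeomorphic_map (subtopology (mtop M) U) (top_of_set (\<phi> ` U)) \<phi>"
    and cover: "p \<in> topspace (mtop M) \<Longrightarrow> \<exists>(U, \<phi>)\<in>atlas M. p \<in> U"
    and compatible:
      "(U, \<phi>) \<in> atlas M \<Longrightarrow> (V, \<psi>) \<in> atlas M \<Longrightarrow>
         smooth_on (\<phi> ` (U \<inter> V)) (\<psi> \<circ> inv_into U \<phi>)"

definition euclidean_manifold :: "('e::euclidean_space, 'e) manifold" where
  "euclidean_manifold = \<lparr>mtop = euclidean, model = UNIV, atlas = {(UNIV, id)}\<rparr>"

definition prod_manifold ::
  "('a, 'e) manifold \<Rightarrow> ('b, 'f) manifold \<Rightarrow> ('a \<times> 'b, 'e \<times> 'f) manifold" where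
  "prod_manifold M N =
     \<lparr>mtop = prod_topology (mtop M) (mtop N),
      model = model M \<times> model N,
      atlas = {(U \<times> V, map_prod \<phi> \<psi>) | U \<phi> V \<psi>. (U, \<phi>) \<in> atlas M \<and> (V, \<psi>) \<in> atlas N}\<rparr>"

(* Smoothness of f on an arbitrary subset A of M, again by local extendability, now in charts. For
   A = topspace (mtop M) these are the smooth maps between manifolds; for an embedded submanifold
   A of M (such as a closed subgroup of a Lie group) these are the maps that are smooth for the
   submanifold structure of A. *)
definition smooth_map_on ::
  "('a, 'e::euclidean_space) manifold \<Rightarrow> ('b, 'f::euclidean_space) manifold \<Rightarrow>
   'a set \<Rightarrow> ('a \<Rightarrow> 'b) \<Rightarrow> bool" where
  "smooth_map_on M N A f \<longleftrightarrow>
     A \<subseteq> topspace (mtop M) \<and> f ` A \<subseteq> topspace (mtop N) \<and>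
     (\<forall>p\<in>A. \<exists>(U, \<phi>)\<in>atlas M. \<exists>(V, \<psi>)\<in>atlas N. \<exists>W.
        openin (mtop M) W \<and> p \<in> W \<and> W \<subseteq> U \<and> f ` (A \<inter> W) \<subseteq> V \<and>
        smooth_on (\<phi> ` (A \<inter> W)) (\<psi> \<circ> f \<circ> inv_into U \<phi>))"

definition chart_at :: "('a, 'e) manifold \<Rightarrow> 'a \<Rightarrow> 'a set \<times> ('a \<Rightarrow> 'e)" where
  "chart_at M p = (SOME c. c \<in> atlas M \<and> p \<in> fst c)"

(* Every tangent space is identified with the model space by means of the chosen chart at its base
   point; tangent maps are the derivatives of the coordinate expressions in the chosen charts at
   p and at f p. The space itself therefore does not depend on p. *)
definition tangent_space :: "('a, 'e) manifold \<Rightarrow> 'a \<Rightarrow> 'e set" where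
  "tangent_space M p = model M"

definition tangent_map ::
  "('a, 'e::euclidean_space) manifold \<Rightarrow> ('b, 'f::euclidean_space) manifold \<Rightarrow>
   ('a \<Rightarrow> 'b) \<Rightarrow> 'a \<Rightarrow> 'e \<Rightarrow> 'f" where
  "tangent_map M N f p v =
     (let (U, \<phi>) = chart_at M p; (V, \<psi>) = chart_at N (f p)
      in vector_derivative (\<lambda>t::real. \<psi> (f (inv_into U \<phi> (\<phi> p + t *\<^sub>R v)))) (at 0))"

definition velocity :: "('a, 'e::euclidean_space) manifold \<Rightarrow> (real \<Rightarrow> 'a) \<Rightarrow> 'e" where
  "velocity M \<gamma> = tangent_map euclidean_manifold M \<gamma> 0 1"


section \<open>Lie groups and Klein geometries\<close>

locale lie_group = group G + smooth_manifold M
  for G :: "'a monoid" (structure) and M :: "('a, 'e::euclidean_space) manifold" +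
  assumes carrier_eq: "carrier G = topspace (mtop M)"
    and smooth_mult:
      "smooth_map_on (prod_manifold M M) M (carrier G \<times> carrier G) (\<lambda>(x, y). x \<otimes> y)"
    and smooth_inv: "smooth_map_on M M (carrier G) (\<lambda>x. inv x)"

locale klein_geometry = lie_group G M
  for G :: "'a monoid" (structure) and M :: "('a, 'e::euclidean_space) manifold" +
  fixes H :: "'a set"
  assumes subgroup_H: "subgroup H G"
    and closed_H: "closedin (mtop M) H"

(* The quotient topology on the set of left cosets. *)
definition coset_topology :: "'a monoid \<Rightarrow> 'a topology \<Rightarrow> 'a set \<Rightarrow> 'a set topology" where
  "coset_topology G X H =
     topology (\<lambda>V. V \<subseteq> lcosets\<^bsub>G\<^esub> H \<and> openin X {x \<in> carrier G. x <#\<^bsub>G\<^esub> H \<in> V})"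

lemma openin_coset_topology:
  assumes "carrier G = topspace X"
  shows "openin (coset_topology G X H) V \<longleftrightarrow>
           V \<subseteq> lcosets\<^bsub>G\<^esub> H \<and> openin X {x \<in> carrier G. x <#\<^bsub>G\<^esub> H \<in> V}"
proof -
  let ?P = "\<lambda>V. {x \<in> carrier G. x <#\<^bsub>G\<^esub> H \<in> V}"
  have int: "?P (S \<inter> T) = ?P S \<inter> ?P T" for S T
    by blast
  have un: "?P (\<Union>\<K>) = \<Union> (?P ` \<K>)" for \<K>
    by blast
  have "istopology (\<lambda>V. V \<subseteq> lcosets\<^bsub>G\<^esub> H \<and> openin X (?P V))"
    unfolding istopology_def int un by (auto intro!: openin_Int openin_Union)
  then show ?thesis
    by (simp add: coset_topology_def topology_inverse')
qed

definition lie_algebra :: "'a monoid \<Rightarrow> ('a, 'e) manifold \<Rightarrow> 'e set" where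
  "lie_algebra G M = tangent_space M \<one>\<^bsub>G\<^esub>"

definition curve_through_one ::
  "'a monoid \<Rightarrow> ('a, 'e::euclidean_space) manifold \<Rightarrow> 'a set \<Rightarrow> (real \<Rightarrow> 'a) \<Rightarrow> bool" where
  "curve_through_one G M H \<gamma> \<longleftrightarrow>
     smooth_map_on euclidean_manifold M UNIV \<gamma> \<and> range \<gamma> \<subseteq> H \<and> \<gamma> 0 = \<one>\<^bsub>G\<^esub>"

definition conj_map :: "'a monoid \<Rightarrow> 'a \<Rightarrow> 'a \<Rightarrow> 'a" where
  "conj_map G g = (\<lambda>x. g \<otimes>\<^bsub>G\<^esub> x \<otimes>\<^bsub>G\<^esub> inv\<^bsub>G\<^esub> g)"

definition Ad :: "'a monoid \<Rightarrow> ('a, 'e::euclidean_space) manifold \<Rightarrow> 'a \<Rightarrow> 'e \<Rightarrow> 'e" where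
  "Ad G M g = tangent_map M M (conj_map G g) \<one>\<^bsub>G\<^esub>"

definition maurer_cartan ::
  "'a monoid \<Rightarrow> ('a, 'e::euclidean_space) manifold \<Rightarrow> 'a \<Rightarrow> 'e \<Rightarrow> 'e" where
  "maurer_cartan G M x = tangent_map M M (\<lambda>y. inv\<^bsub>G\<^esub> x \<otimes>\<^bsub>G\<^esub> y) x"

definition pullback_form ::
  "('a, 'e::euclidean_space) manifold \<Rightarrow> ('a \<Rightarrow> 'a) \<Rightarrow> ('a \<Rightarrow> 'e \<Rightarrow> 'e) \<Rightarrow> 'a \<Rightarrow> 'e \<Rightarrow> 'e" where
  "pullback_form M \<Phi> \<omega> x v = \<omega> (\<Phi> x) (tangent_map M M \<Phi> x v)"

definition Gl :: "'e::real_vector set \<Rightarrow> ('e \<Rightarrow> 'e) set" where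
  "Gl E = {\<beta> \<in> Bij E. (\<forall>x\<in>E. \<forall>y\<in>E. \<beta> (x + y) = \<beta> x + \<beta> y) \<and> (\<forall>c. \<forall>x\<in>E. \<beta> (c *\<^sub>R x) = c *\<^sub>R \<beta> x)}"

(* Lie group automorphisms of a closed subgroup H of G; H = carrier G gives Aut(G). *)
definition Lie_Aut ::
  "'a monoid \<Rightarrow> ('a, 'e::euclidean_space) manifold \<Rightarrow> 'a set \<Rightarrow> ('a \<Rightarrow> 'a) set" where
  "Lie_Aut G M H =
     {j \<in> auto (G\<lparr>carrier := H\<rparr>). smooth_map_on M M H j \<and> smooth_map_on M M H (inv_into H j)}"

definition restricted_differential ::
  "'a monoid \<Rightarrow> ('a, 'e::euclidean_space) manifold \<Rightarrow> ('a \<Rightarrow> 'a) \<Rightarrow> 'e \<Rightarrow> 'e" where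
  "restricted_differential G M \<sigma> = restrict (tangent_map M M \<sigma> \<one>\<^bsub>G\<^esub>) (lie_algebra G M)"


section \<open>Extensions and their Lie subgroups\<close>

abbreviation pair_group ::
  "'a monoid \<Rightarrow> ('a, 'e) manifold \<Rightarrow> 'a set \<Rightarrow> (('e \<Rightarrow> 'e) \<times> ('a \<Rightarrow> 'a)) monoid" where
  "pair_group G M H \<equiv> BijGroup (lie_algebra G M) \<times>\<times> BijGroup H"

(* The Lie algebra of H consists of the velocities at 0 of smooth curves c in H with c 0 = 1, and
   the differential of j sends the velocity of c to that of j o c. So the condition on curves says
   that beta restricted to the Lie algebra of H is dj. *)
definition Ext ::
  "'a monoid \<Rightarrow> ('a, 'e::euclidean_space) manifold \<Rightarrow> 'a set \<Rightarrow>
   (('e \<Rightarrow> 'e) \<times> ('a \<Rightarrow> 'a)) monoid" where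
  "Ext G M H = pair_group G M H
     \<lparr>carrier := {(\<beta>, j). \<beta> \<in> Gl (lie_algebra G M) \<and> j \<in> Lie_Aut G M H \<and>
        (\<forall>\<gamma>. curve_through_one G M H \<gamma> \<longrightarrow> \<beta> (velocity M \<gamma>) = velocity M (j \<circ> \<gamma>)) \<and>
        (\<forall>h\<in>H. \<forall>v\<in>lie_algebra G M. \<beta> (Ad G M h v) = Ad G M (j h) (\<beta> v))}\<rparr>"

(* S, with the manifold structure N, is an immersed Lie subgroup of Gl(g) x Aut(H). A map into
   Aut(H) is smooth if the corresponding map into H with the additional argument in H is smooth;
   its derivative vanishes in a direction if all its evaluations at points of H have vanishing
   derivative. *)
locale lie_subgroup_of_pairs =
  lie_group "(pair_group G M H)\<lparr>carrier := S\<rparr>" N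
  for G :: "'a monoid" and M :: "('a, 'e::euclidean_space) manifold" and H :: "'a set"
    and S :: "(('e \<Rightarrow> 'e) \<times> ('a \<Rightarrow> 'a)) set"
    and N :: "(('e \<Rightarrow> 'e) \<times> ('a \<Rightarrow> 'a), 'f::euclidean_space) manifold" +
  assumes subset_pairs: "S \<subseteq> Gl (lie_algebra G M) \<times> Lie_Aut G M H"
    and smooth_into_Gl:
      "v \<in> lie_algebra G M \<Longrightarrow> smooth_map_on N euclidean_manifold S (\<lambda>s. fst s v)"
    and smooth_into_Aut:
      "smooth_map_on (prod_manifold N M) M (S \<times> H) (\<lambda>(s, h). snd s h)"
    and immersive:
      "\<lbrakk>s \<in> S; w \<in> tangent_space N s;
        \<And>v. v \<in> lie_algebra G M \<Longrightarrow> tangent_map N euclidean_manifold (\<lambda>s. fst s v) s w = 0;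
        \<And>h. h \<in> H \<Longrightarrow> tangent_map N M (\<lambda>s. snd s h) s w = 0\<rbrakk> \<Longrightarrow> w = 0"


section \<open>The automorphism group and the semidirect product\<close>

definition bundle_morphism ::
  "'a monoid \<Rightarrow> ('a, 'e::euclidean_space) manifold \<Rightarrow> 'a set \<Rightarrow> ('a \<Rightarrow> 'a) \<Rightarrow> ('a \<Rightarrow> 'a) \<Rightarrow> bool" where
  "bundle_morphism G M H j \<Phi> \<longleftrightarrow>
     smooth_map_on M M (carrier G) \<Phi> \<and>
     (\<forall>g\<in>carrier G. \<forall>h\<in>H. \<Phi> (g \<otimes>\<^bsub>G\<^esub> h) = \<Phi> g \<otimes>\<^bsub>G\<^esub> j h)"

definition S_automorphism_group ::
  "'a monoid \<Rightarrow> ('a, 'e::euclidean_space) manifold \<Rightarrow> 'a set \<Rightarrow>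
   (('e \<Rightarrow> 'e) \<times> ('a \<Rightarrow> 'a)) set \<Rightarrow> ('a \<Rightarrow> 'a) monoid" where
  "S_automorphism_group G M H S = BijGroup (carrier G)
     \<lparr>carrier := {\<Phi> \<in> Bij (carrier G). \<exists>(\<beta>, j)\<in>S. bundle_morphism G M H j \<Phi> \<and>
        (\<forall>x\<in>carrier G. \<forall>v\<in>tangent_space M x.
           pullback_form M \<Phi> (maurer_cartan G M) x v = \<beta> (maurer_cartan G M x v))}\<rparr>"

definition semidirect_product ::
  "'a monoid \<Rightarrow> 'b monoid \<Rightarrow> ('b \<Rightarrow> 'a \<Rightarrow> 'a) \<Rightarrow> ('a \<times> 'b) monoid" where
  "semidirect_product G K \<alpha> =
     \<lparr>carrier = carrier G \<times> carrier K,
      mult = (\<lambda>(g, k) (g', k'). (g \<otimes>\<^bsub>G\<^esub> \<alpha> k g', k \<otimes>\<^bsub>K\<^esub> k')),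
      one = (\<one>\<^bsub>G\<^esub>, \<one>\<^bsub>K\<^esub>)\<rparr>"

definition induces_pair ::
  "'a monoid \<Rightarrow> ('a, 'e::euclidean_space) manifold \<Rightarrow> 'a set \<Rightarrow> ('a \<Rightarrow> 'a) \<Rightarrow>
   ('e \<Rightarrow> 'e) \<times> ('a \<Rightarrow> 'a) \<Rightarrow> bool" where
  "induces_pair G M H \<sigma> k \<longleftrightarrow>
     \<sigma> \<in> Lie_Aut G M (carrier G) \<and> \<sigma> ` H \<subseteq> H \<and>
     k = (restricted_differential G M \<sigma>, restrict \<sigma> H)"

definition automorphism_pairs ::
  "'a monoid \<Rightarrow> ('a, 'e::euclidean_space) manifold \<Rightarrow> 'a set \<Rightarrow>
   (('e \<Rightarrow> 'e) \<times> ('a \<Rightarrow> 'a)) set" where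
  "automorphism_pairs G M H = {k. \<exists>\<sigma>. induces_pair G M H \<sigma> k}"

(* The action of a pair (d sigma, sigma|H) on G is by sigma. *)
definition pair_action ::
  "'a monoid \<Rightarrow> ('a, 'e::euclidean_space) manifold \<Rightarrow> 'a set \<Rightarrow>
   ('e \<Rightarrow> 'e) \<times> ('a \<Rightarrow> 'a) \<Rightarrow> 'a \<Rightarrow> 'a" where
  "pair_action G M H k = (THE \<sigma>. induces_pair G M H \<sigma> k)"

end

theory Submission
  imports Defs
begin

text \<open>Left translations by elements of \<open>G\<close> and automorphisms \<open>\<sigma>\<close> of \<open>G\<close> with \<open>(d\<sigma>, \<sigma>|H)\<close> in \<open>S\<close> are automorphisms of the
  geometry: the Maurer-Cartan form \<open>\<omega>\<close> is left invariant, and a homomorphism \<open>\<sigma>\<close> pulls it back to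
  \<open>d\<sigma> \<circ> \<omega>\<close> (lemmas \<open>pullback_left_mult\<close> and \<open>pullback_homomorphism\<close>). The content of the theorem is the converse.

  Its main ingredient is a rigidity statement (\<open>pullback_rigidity\<close>): two smooth maps \<open>f, f': G \<rightarrow> G\<close> that are
  equivariant over the same map of \<open>H\<close>, agree at the unit, and have the same pullback of \<open>\<omega>\<close>, are equal. Indeed the
  quotient \<open>f (f')\<^sup>-\<^sup>1\<close> has vanishing derivative, so it is locally constant; it is also constant on the cosets of \<open>H\<close>,
  and \<open>G/H\<close> is connected.

  Given an automorphism \<open>\<Phi>\<close> over \<open>j\<close> with \<open>\<Phi>\<^sup>*\<omega> = \<beta> \<circ> \<omega>\<close>, put \<open>\<sigma> = \<Phi>(1)\<^sup>-\<^sup>1 \<Phi>\<close>. For fixed \<open>g\<close> the maps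
  \<open>x \<mapsto> \<sigma>(g x)\<close> and \<open>x \<mapsto> \<sigma>(g) \<sigma>(x)\<close> satisfy the hypotheses of rigidity, so \<open>\<sigma>\<close> is a homomorphism, and
  \<open>(\<beta>, j) = (d\<sigma>, \<sigma>|H)\<close>. The inverse of \<open>\<sigma>\<close> is smooth by the inverse function theorem (\<open>smooth_map_inverse\<close>). Rigidity
  also shows that \<open>\<sigma>\<close> is determined by its pair, which makes the action of pairs on \<open>G\<close> well defined and multiplicative.

  Derivatives of maps between manifolds are handled through velocities of curves: a smooth map transforms
  velocities at a point by a linear map, which is its tangent map, and this gives the chain rule.\<close>

section \<open>Calculus of maps of class \<open>C\<^sup>k\<close>\<close>

lemma Ck_on_subset: "Ck_on k U f \<Longrightarrow> V \<subseteq> U \<Longrightarrow> Ck_on k V f"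
  by (induction k arbitrary: f) (auto intro: continuous_on_subset)

lemma Ck_on_cong:
  assumes "open U" "\<And>x. x \<in> U \<Longrightarrow> f x = g x" "Ck_on k U f"
  shows "Ck_on k U g"
  using assms(2,3)
proof (induction k arbitrary: f g)
  case 0
  then show ?case by (auto cong: continuous_on_cong)
next
  case (Suc k)
  have der: "(g has_derivative frechet_derivative f (at x)) (at x)" if "x \<in> U" for x
  proof -
    have "(f has_derivative frechet_derivative f (at x)) (at x)"
      using Suc.prems that by (auto simp: frechet_derivative_works)
    then show ?thesis
      using has_derivative_transform_within_open[OF _ assms(1) that] Suc.prems(1) by blast
  qed
  then have eq: "frechet_derivative f (at x) v = frechet_derivative g (at x) v" if "x \<in> U" for x v
    using frechet_derivative_at that by metis
  have "Ck_on k U (\<lambda>x. frechet_derivative g (at x) v)" for v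
    using Suc.prems(2) by (intro Suc.IH[OF eq]) simp_all
  with der show ?case by (auto simp: differentiable_def)
qed

text \<open>To verify \<open>C\<^sup>k\<^sup>+\<^sup>1\<close> it suffices to exhibit a derivative with \<open>C\<^sup>k\<close> directional derivatives; closure
  under addition, scaling and composition is proved by induction on \<open>k\<close> through this rule.\<close>
lemma Ck_on_SucI:
  assumes "open U" "\<And>x. x \<in> U \<Longrightarrow> (f has_derivative f' x) (at x)"
    and "\<And>v. Ck_on k U (\<lambda>x. f' x v)"
  shows "Ck_on (Suc k) U f"
proof -
  have "f' x = frechet_derivative f (at x)" if "x \<in> U" for x
    using assms(2)[OF that] by (rule frechet_derivative_at)
  then have "Ck_on k U (\<lambda>x. frechet_derivative f (at x) v)" for v
    using assms(3)[of v] by (intro Ck_on_cong[OF assms(1) _ assms(3)[of v]]) auto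
  then show ?thesis using assms(2) by (auto simp: differentiable_def)
qed

lemma Ck_on_has_derivative:
  "Ck_on (Suc k) U f \<Longrightarrow> x \<in> U \<Longrightarrow> (f has_derivative frechet_derivative f (at x)) (at x)"
  by (simp add: frechet_derivative_works)

lemma Ck_on_SucD: "Ck_on (Suc k) U f \<Longrightarrow> Ck_on k U f"
proof (induction k arbitrary: f)
  case 0
  then show ?case
    by (auto intro!: continuous_at_imp_continuous_on differentiable_imp_continuous_within)
next
  case (Suc k)
  have "Ck_on k U (\<lambda>x. frechet_derivative f (at x) v)" for v
    by (rule Suc.IH) (use Suc.prems in simp)
  with Suc.prems show ?case by (simp only: Ck_on.simps) blast
qed

lemma Ck_on_const: "open U \<Longrightarrow> Ck_on k U (\<lambda>x. c)"
proof (induction k arbitrary: c)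
  case (Suc k)
  show ?case
    by (rule Ck_on_SucI[where f' = "\<lambda>x v. 0"]) (simp_all add: Suc)
qed simp

lemma Ck_on_bounded_linear: "open U \<Longrightarrow> bounded_linear f \<Longrightarrow> Ck_on k U f"
proof (cases k)
  case (Suc k')
  assume "open U" "bounded_linear f"
  then show ?thesis unfolding Suc
    by (intro Ck_on_SucI[where f' = "\<lambda>x. f"] Ck_on_const bounded_linear_imp_has_derivative)
qed (simp add: linear_continuous_on)

lemma Ck_on_add:
  assumes "open U" "Ck_on k U f" "Ck_on k U g"
  shows "Ck_on k U (\<lambda>x. f x + g x)"
  using assms(2,3)
proof (induction k arbitrary: f g)
  case (Suc k)
  show ?case
  proof (rule Ck_on_SucI[OF assms(1)])
    show "((\<lambda>x. f x + g x) has_derivative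
        (\<lambda>v. frechet_derivative f (at x) v + frechet_derivative g (at x) v)) (at x)" if "x \<in> U" for x
      using Suc.prems that by (intro has_derivative_add Ck_on_has_derivative)
  qed (rule Suc.IH; use Suc.prems in simp)
qed (simp add: continuous_on_add)

lemma Ck_on_sum:
  assumes "open U" "\<And>i. i \<in> I \<Longrightarrow> Ck_on k U (f i)"
  shows "Ck_on k U (\<lambda>x. \<Sum>i\<in>I. f i x)"
  using assms(2)
proof (induction I rule: infinite_finite_induct)
  case (insert i I)
  have "Ck_on k U (\<lambda>x. f i x + (\<Sum>i\<in>I. f i x))"
    using insert by (intro Ck_on_add[OF assms(1)]) simp_all
  with insert(1,2) show ?case by simp
qed (simp_all add: Ck_on_const[OF assms(1)])

lemma Ck_on_scaleR:
  assumes "open U" "Ck_on k U f" "Ck_on k U g"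
  shows "Ck_on k U (\<lambda>x. f x *\<^sub>R g x)"
  using assms(2,3)
proof (induction k arbitrary: f g)
  case (Suc k)
  show ?case
  proof (rule Ck_on_SucI[OF assms(1)])
    show "((\<lambda>x. f x *\<^sub>R g x) has_derivative
        (\<lambda>v. f x *\<^sub>R frechet_derivative g (at x) v + frechet_derivative f (at x) v *\<^sub>R g x)) (at x)"
      if "x \<in> U" for x
      using Suc.prems that by (intro has_derivative_scaleR Ck_on_has_derivative)
    show "Ck_on k U (\<lambda>x. f x *\<^sub>R frechet_derivative g (at x) v + frechet_derivative f (at x) v *\<^sub>R g x)"
      for v using Suc.prems Ck_on_SucD[OF Suc.prems(1)] Ck_on_SucD[OF Suc.prems(2)]
      by (intro Ck_on_add[OF assms(1)] Suc.IH) simp_all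
  qed
qed (simp add: continuous_on_scaleR)

lemma Ck_on_compose_bounded_linear:
  assumes "open U" "bounded_linear L" "Ck_on k U f"
  shows "Ck_on k U (\<lambda>x. L (f x))"
  using assms(3)
proof (induction k arbitrary: f)
  case (Suc k)
  show ?case
  proof (rule Ck_on_SucI[OF assms(1)])
    show "((\<lambda>x. L (f x)) has_derivative (\<lambda>v. L (frechet_derivative f (at x) v))) (at x)"
      if "x \<in> U" for x
      using Suc.prems that by (intro bounded_linear.has_derivative[OF assms(2)] Ck_on_has_derivative)
  qed (rule Suc.IH; use Suc.prems in simp)
qed (simp add: bounded_linear.continuous_on[OF assms(2)])

lemma linear_basis_expansion:
  fixes L :: "'a::euclidean_space \<Rightarrow> 'b::real_vector"
  assumes "linear L"
  shows "L w = (\<Sum>b\<in>Basis. (w \<bullet> b) *\<^sub>R L b)"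
proof -
  have "L w = L (\<Sum>b\<in>Basis. (w \<bullet> b) *\<^sub>R b)" by (simp only: euclidean_representation)
  also have "\<dots> = (\<Sum>b\<in>Basis. (w \<bullet> b) *\<^sub>R L b)"
    by (simp only: linear_sum[OF assms] linear_scale[OF assms])
  finally show ?thesis .
qed

lemma Ck_on_compose:
  assumes "open U" "open V" "Ck_on k V g" "Ck_on k U f" "f ` U \<subseteq> V"
  shows "Ck_on k U (\<lambda>x. g (f x))"
  using assms(3,4)
proof (induction k arbitrary: g)
  case 0
  then show ?case
    using assms(5) continuous_on_compose2[of V g U f] by simp
next
  case (Suc k)
  let ?D = "\<lambda>x v. \<Sum>b\<in>Basis. (frechet_derivative f (at x) v \<bullet> b) *\<^sub>R frechet_derivative g (at (f x)) b"
  have f: "Ck_on k U f" using Suc.prems Ck_on_SucD by blast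
  show ?case
  proof (rule Ck_on_SucI[OF assms(1)])
    fix x assume x: "x \<in> U"
    then have df: "(f has_derivative frechet_derivative f (at x)) (at x)"
      using Suc.prems by (intro Ck_on_has_derivative)
    have dg: "(g has_derivative frechet_derivative g (at (f x))) (at (f x))"
      using Suc.prems assms(5) x by (intro Ck_on_has_derivative) auto
    then have "linear (frechet_derivative g (at (f x)))"
      by (rule has_derivative_linear)
    then have "frechet_derivative g (at (f x)) (frechet_derivative f (at x) v) = ?D x v" for v
      by (rule linear_basis_expansion)
    then show "((\<lambda>x. g (f x)) has_derivative ?D x) (at x)"
      using has_derivative_compose[OF df dg] by simp
  next
    show "Ck_on k U (\<lambda>x. ?D x v)" for v
    proof (intro Ck_on_sum Ck_on_scaleR assms(1))
      fix b :: 'b assume "b \<in> Basis"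
      show "Ck_on k U (\<lambda>x. frechet_derivative f (at x) v \<bullet> b)"
        using Suc.prems by (intro Ck_on_compose_bounded_linear[OF assms(1) bounded_linear_inner_left]) auto
      show "Ck_on k U (\<lambda>x. frechet_derivative g (at (f x)) b)"
        using Suc.prems f by (intro Suc.IH) auto
    qed
  qed
qed

section \<open>Smooth maps on arbitrary sets\<close>

lemma smooth_onE:
  assumes "smooth_on A f" "x \<in> A"
  obtains U F where "open U" "x \<in> U" "\<And>k. Ck_on k U F" "\<And>y. y \<in> A \<Longrightarrow> y \<in> U \<Longrightarrow> F y = f y"
  using assms unfolding smooth_on_def by (metis IntI)

lemma smooth_onI:
  assumes "\<And>x. x \<in> A \<Longrightarrow> \<exists>U F. open U \<and> x \<in> U \<and> (\<forall>k. Ck_on k U F) \<and> (\<forall>y\<in>A \<inter> U. F y = f y)"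
  shows "smooth_on A f"
  using assms by (simp add: smooth_on_def)

lemma smooth_on_cong:
  "smooth_on A f \<Longrightarrow> (\<And>x. x \<in> A \<Longrightarrow> f x = g x) \<Longrightarrow> smooth_on A g"
  unfolding smooth_on_def by (metis IntE)

lemma smooth_on_subset:
  assumes "smooth_on A f" "B \<subseteq> A"
  shows "smooth_on B f"
proof (rule smooth_onI)
  fix x assume "x \<in> B"
  then have "x \<in> A" using assms(2) by blast
  from smooth_onE[OF assms(1) this] obtain U F
    where "open U" "x \<in> U" "\<And>k. Ck_on k U F" "\<And>y. y \<in> A \<Longrightarrow> y \<in> U \<Longrightarrow> F y = f y"
    by blast
  with assms(2) show "\<exists>U F. open U \<and> x \<in> U \<and> (\<forall>k. Ck_on k U F) \<and> (\<forall>y\<in>B \<inter> U. F y = f y)"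
    by (intro exI[of _ U] exI[of _ F]) auto
qed

lemma smooth_on_id: "smooth_on A (\<lambda>x. x)"
  by (rule smooth_onI, rule exI[of _ UNIV], rule exI[of _ "\<lambda>x. x"])
    (simp add: Ck_on_bounded_linear)

lemma smooth_on_has_derivative:
  assumes "smooth_on A f" "x \<in> A"
  obtains D where "(f has_derivative D) (at x within A)"
proof -
  obtain U F where U: "open U" "x \<in> U" "\<And>k. Ck_on k U F" "\<And>y. y \<in> A \<Longrightarrow> y \<in> U \<Longrightarrow> F y = f y"
    using smooth_onE[OF assms] by blast
  have "(F has_derivative frechet_derivative F (at x)) (at x)"
    using U(2) U(3)[of "Suc 0"] by (intro Ck_on_has_derivative)
  then have "(F has_derivative frechet_derivative F (at x)) (at x within A)"
    by (rule has_derivative_at_withinI)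
  moreover obtain e where "e > 0" "ball x e \<subseteq> U" using U(1,2) openE by blast
  ultimately have "(f has_derivative frechet_derivative F (at x)) (at x within A)"
    using U(4) assms(2)
    by (elim has_derivative_transform_within[of _ _ _ _ e])
      (auto simp: subset_iff dist_commute)
  then show thesis ..
qed

lemma smooth_on_imp_continuous_on: "smooth_on A f \<Longrightarrow> continuous_on A f"
  by (metis continuous_on_eq_continuous_within has_derivative_continuous smooth_on_has_derivative)

lemma smooth_on_compose:
  assumes "smooth_on A f" "smooth_on B g" "f ` A \<subseteq> B"
  shows "smooth_on A (\<lambda>x. g (f x))"
  unfolding smooth_on_def
proof
  fix x assume x: "x \<in> A"
  obtain U F where U: "open U" "x \<in> U" "\<And>k. Ck_on k U F" "\<And>y. y \<in> A \<Longrightarrow> y \<in> U \<Longrightarrow> F y = f y"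
    using smooth_onE[OF assms(1) x] by blast
  obtain V G where V: "open V" "f x \<in> V" "\<And>k. Ck_on k V G" "\<And>y. y \<in> B \<Longrightarrow> y \<in> V \<Longrightarrow> G y = g y"
    using smooth_onE[OF assms(2), of "f x"] x assms(3) by blast
  have "continuous_on U F" using U(3)[of 0] by (simp only: Ck_on.simps)
  then have op: "open (U \<inter> F -` V)" by (rule continuous_open_preimage[OF _ U(1) V(1)])
  moreover have "Ck_on k (U \<inter> F -` V) (\<lambda>x. G (F x))" for k
    by (rule Ck_on_compose[OF op V(1) V(3)]) (auto intro: Ck_on_subset[OF U(3)])
  moreover have "x \<in> U \<inter> F -` V" using U V x by simp
  moreover have "\<forall>y\<in>A \<inter> (U \<inter> F -` V). G (F y) = g (f y)"
    using U(4) V(4) assms(3) by (auto simp: image_subset_iff)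
  ultimately show "\<exists>U F. open U \<and> x \<in> U \<and> (\<forall>k. Ck_on k U F) \<and> (\<forall>y\<in>A \<inter> U. F y = g (f y))"
    by blast
qed

section \<open>Smoothness of local inverses\<close>

text \<open>Differentiation of \<open>x \<mapsto> (A x)\<^sup>-\<^sup>1 v\<close>. It is enough that each \<open>x \<mapsto> A x w\<close> is differentiable at the point,
  since in finite dimension this controls the operator norm of \<open>A y - A x\<close>.\<close>
lemma has_derivative_linear_inverse:
  fixes A :: "'a::euclidean_space \<Rightarrow> 'b::euclidean_space \<Rightarrow> 'b"
  assumes "open U" "x \<in> U" and lin: "\<And>x. x \<in> U \<Longrightarrow> linear (A x)" and bij: "\<And>x. x \<in> U \<Longrightarrow> bij (A x)"
    and der: "\<And>w. ((\<lambda>x. A x w) has_derivative A' w) (at x)"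
  shows "((\<lambda>x. inv_into UNIV (A x) v) has_derivative (\<lambda>u. - inv_into UNIV (A x) (A' (inv_into UNIV (A x) v) u))) (at x)"
proof -
  define B where "B = (\<lambda>y. inv_into UNIV (A y))"
  have AB: "A y (B y w) = w" if "y \<in> U" for y w
    using surj_f_inv_f[OF bij_is_surj[OF bij[OF that]]] by (simp add: B_def)
  have BA: "B y (A y w) = w" if "y \<in> U" for y w
    using inv_f_f[OF bij_is_inj[OF bij[OF that]]] by (simp add: B_def)
  have linB: "linear (B y)" if "y \<in> U" for y
    using lin[OF that] bij[OF that] inj_linear_imp_inv_linear unfolding B_def bij_def by blast
  have contA: "((\<lambda>y. A y w) \<longlongrightarrow> A x w) (at x)" for w
    using has_derivative_continuous[OF der] by (simp add: continuous_within)
  obtain c where c: "c > 0" "\<And>w. c * norm w \<le> norm (A x w)"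
    using linear_inj_bounded_below_pos[of "A x"] lin bij assms(2) by (metis bij_is_inj)
  \<comment> \<open>Near \<open>x\<close> the operators \<open>A y\<close> are close to \<open>A x\<close> in norm, hence bounded below by \<open>c / 2\<close>.\<close>
  have evU: "\<forall>\<^sub>F y in at x. y \<in> U"
    using assms(1,2) eventually_at_in_open' by blast
  have "((\<lambda>y. \<Sum>b\<in>Basis. norm (A y b - A x b)) \<longlongrightarrow> (\<Sum>b\<in>(Basis::'b set). norm (A x b - A x b))) (at x)"
    by (intro tendsto_intros contA)
  then have "\<forall>\<^sub>F y in at x. (\<Sum>b\<in>Basis. norm (A y b - A x b)) < c / 2"
    using c(1) by (intro order_tendstoD) auto
  then have bnd: "\<forall>\<^sub>F y in at x. y \<in> U \<and> (\<forall>w. norm (B y w) \<le> 2 / c * norm w)"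
    using evU
  proof eventually_elim
    case (elim y)
    have "norm (B y w) \<le> 2 / c * norm w" for w
    proof -
      define z where "z = B y w"
      have "norm (A y z - A x z) = norm (\<Sum>b\<in>Basis. (z \<bullet> b) *\<^sub>R (A y b - A x b))"
        using linear_basis_expansion[OF lin, of y z] linear_basis_expansion[OF lin, of x z] elim assms(2)
        by (simp add: sum_subtractf scaleR_diff_right)
      also have "\<dots> \<le> (\<Sum>b\<in>Basis. norm z * norm (A y b - A x b))"
        by (rule sum_norm_le) (auto intro!: mult_right_mono Basis_le_norm)
      also have "\<dots> \<le> norm z * (c / 2)"
        unfolding sum_distrib_left[symmetric] by (rule mult_left_mono) (use elim(1) in auto)
      finally have "norm (A y z - A x z) \<le> norm z * (c / 2)" .
      moreover have "norm (A x z) \<le> norm (A y z) + norm (A y z - A x z)"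
        by (metis norm_minus_commute norm_triangle_sub)
      ultimately have "c * norm z \<le> norm w + norm z * (c / 2)"
        using c(2)[of z] AB[OF elim(2), of w] unfolding z_def by simp
      then show ?thesis using c(1) by (simp add: z_def field_simps)
    qed
    with elim show ?case by blast
  qed
  have contB: "((\<lambda>y. B y w) \<longlongrightarrow> B x w) (at x)" for w
  proof -
    have lim: "((\<lambda>y. 2 / c * norm (A x (B x w) - A y (B x w))) \<longlongrightarrow> 2 / c * norm (A x (B x w) - A x (B x w))) (at x)"
      by (intro tendsto_intros contA)
    have ev: "\<forall>\<^sub>F y in at x. norm (B y w - B x w) \<le> 2 / c * norm (A x (B x w) - A y (B x w))"
      using bnd
    proof eventually_elim
      case (elim y)
      then have "B y w - B x w = B y (A x (B x w) - A y (B x w))"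
        using linear_diff[OF linB] AB[OF assms(2)] BA by simp
      then show ?case using elim by simp
    qed
    have "((\<lambda>y. B y w - B x w) \<longlongrightarrow> 0) (at x)"
      by (rule Lim_null_comparison[OF ev]) (use lim in simp)
    then show ?thesis by (rule LIM_zero_cancel)
  qed
  define w where "w = B x v"
  have linA': "bounded_linear (A' w)" using der by (rule has_derivative_bounded_linear)
  show ?thesis
    unfolding has_derivative_def
  proof (intro conjI)
    show "bounded_linear (\<lambda>u. - inv_into UNIV (A x) (A' (inv_into UNIV (A x) v) u))"
      using bounded_linear_minus[OF bounded_linear_compose[OF linear_linear[THEN iffD2, OF linB[OF assms(2)]] linA']]
      by (simp add: B_def w_def)
    let ?r = "\<lambda>y. inverse (norm (y - x)) *\<^sub>R (A y w - A x w - A' w (y - x))"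
    let ?s = "\<lambda>y. \<Sum>b\<in>Basis. norm (B x b - B y b)"
    have r: "(?r \<longlongrightarrow> 0) (at x)"
      using der[of w] unfolding has_derivative_def by (simp add: divide_inverse_commute netlimit_at)
    obtain K where K: "\<And>u. norm (A' w u) \<le> norm u * K"
      using bounded_linear.bounded[OF linA'] by blast
    have s: "(?s \<longlongrightarrow> (\<Sum>b\<in>(Basis::'b set). norm (B x b - B x b))) (at x)"
      by (intro tendsto_intros contB)
    have lim: "((\<lambda>y. 2 / c * norm (?r y) + K * ?s y) \<longlongrightarrow> 2 / c * norm (0::'b) + K * (\<Sum>b\<in>(Basis::'b set). norm (B x b - B x b))) (at x)"
      by (intro tendsto_intros r s)
    have "\<forall>\<^sub>F y in at x. y \<noteq> x" by (simp add: eventually_at_filter)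
    with bnd have ev: "\<forall>\<^sub>F y in at x. norm (inverse (norm (y - x)) *\<^sub>R (B y v - B x v - - B x (A' w (y - x)))) \<le> 2 / c * norm (?r y) + K * ?s y"
    proof eventually_elim
      case (elim y)
      have K0: "norm (A' w (inverse (norm (y-x)) *\<^sub>R (y - x))) \<le> K"
        using K[of "inverse (norm (y-x)) *\<^sub>R (y - x)"] elim by simp
      note ly = linB[of y] and lx = linB[OF assms(2)] and la = bounded_linear.linear[OF linA']
      let ?u = "A' w (inverse (norm (y-x)) *\<^sub>R (y - x))"
      have e1: "inverse (norm (y - x)) *\<^sub>R (B y v - B x v - - B x (A' w (y - x)))
        = - B y (?r y) + (B x ?u - B y ?u)"
      proof -
        have "B y v - B x v = - B y (A y w - A x w)"
          using elim linear_diff[OF ly] BA AB[OF assms(2)] by (simp add: w_def)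
        then have "B y v - B x v + B x (A' w (y - x)) =
          - B y (A y w - A x w - A' w (y - x)) + (B x (A' w (y-x)) - B y (A' w (y - x)))"
          using elim by (simp add: linear_diff[OF ly])
        then have "inverse (norm (y - x)) *\<^sub>R (B y v - B x v - - B x (A' w (y - x))) =
          - (inverse (norm (y - x)) *\<^sub>R B y (A y w - A x w - A' w (y - x))) +
           (inverse (norm (y - x)) *\<^sub>R B x (A' w (y-x)) - inverse (norm (y - x)) *\<^sub>R B y (A' w (y - x)))"
          by (simp add: scaleR_add_right scaleR_diff_right del: scaleR_scaleR)
        then show ?thesis
          using elim by (simp only: linear_scale[OF ly] linear_scale[OF lx] linear_scale[OF la])
      qed
      have "norm (B x ?u - B y ?u) = norm (\<Sum>b\<in>Basis. (?u \<bullet> b) *\<^sub>R (B x b - B y b))"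
        using linear_basis_expansion[OF lx, of ?u] linear_basis_expansion[OF ly, of ?u] elim
        by (simp add: sum_subtractf scaleR_diff_right)
      also have "\<dots> \<le> (\<Sum>b\<in>Basis. K * norm (B x b - B y b))"
        by (rule sum_norm_le) (auto intro!: mult_right_mono order_trans[OF Basis_le_norm K0])
      finally have e2: "norm (B x ?u - B y ?u) \<le> K * ?s y" by (simp add: sum_distrib_left)
      have e3: "norm (B y (?r y)) \<le> 2 / c * norm (?r y)" using elim by blast
      show ?case unfolding e1
        by (rule order_trans[OF norm_triangle_ineq]) (use e2 e3 in simp)
    qed
    have "((\<lambda>y. inverse (norm (y - x)) *\<^sub>R (B y v - B x v - - B x (A' w (y - x)))) \<longlongrightarrow> 0) (at x)"
      by (rule Lim_null_comparison[OF ev]) (use lim in simp)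
    then show "((\<lambda>y. (inv_into UNIV (A y) v - inv_into UNIV (A (Lim (at x) (\<lambda>x. x))) v
          - - inv_into UNIV (A x) (A' (inv_into UNIV (A x) v) (y - Lim (at x) (\<lambda>x. x)))) /\<^sub>R norm (y - Lim (at x) (\<lambda>x. x))) \<longlongrightarrow> 0) (at x)"
      by (simp add: B_def w_def netlimit_at)
  qed
qed

text \<open>The derivative formula expresses the derivatives of \<open>(A x)\<^sup>-\<^sup>1 v\<close> through the vectors \<open>(A x)\<^sup>-\<^sup>1 c\<close> with \<open>c\<close>
  in the standard basis, so that smoothness propagates by induction on \<open>k\<close>.\<close>
lemma Ck_on_linear_inverse:
  fixes A :: "'a::euclidean_space \<Rightarrow> 'b::euclidean_space \<Rightarrow> 'b"
  assumes "open U" and lin: "\<And>x. x \<in> U \<Longrightarrow> linear (A x)" and bij: "\<And>x. x \<in> U \<Longrightarrow> bij (A x)"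
    and A: "\<And>k w. Ck_on k U (\<lambda>x. A x w)"
  shows "Ck_on k U (\<lambda>x. inv_into UNIV (A x) v)"
proof -
  let ?A' = "\<lambda>w x. frechet_derivative (\<lambda>x. A x w) (at x)"
  have dA: "((\<lambda>x. A x w) has_derivative ?A' w x) (at x)" if "x \<in> U" for x w
    using Ck_on_has_derivative[OF A that] .
  have linB: "linear (inv_into UNIV (A x))" if "x \<in> U" for x
    using lin[OF that] bij[OF that] inj_linear_imp_inv_linear unfolding bij_def by blast
  have der: "((\<lambda>x. inv_into UNIV (A x) v) has_derivative (\<lambda>u. - inv_into UNIV (A x) (?A' (inv_into UNIV (A x) v) x u))) (at x)"
    if "x \<in> U" for x v
    using has_derivative_linear_inverse[OF assms(1) that lin bij dA[OF that]] by blast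
  have A'lin: "?A' w x u = (\<Sum>b\<in>Basis. (w \<bullet> b) *\<^sub>R ?A' b x u)" if "x \<in> U" for x w u
  proof -
    have "((\<lambda>y. \<Sum>b\<in>Basis. (w \<bullet> b) *\<^sub>R A y b) has_derivative (\<lambda>u. \<Sum>b\<in>Basis. (w \<bullet> b) *\<^sub>R ?A' b x u)) (at x)"
      by (intro has_derivative_sum has_derivative_scaleR_right dA that)
    then have "((\<lambda>y. A y w) has_derivative (\<lambda>u. \<Sum>b\<in>Basis. (w \<bullet> b) *\<^sub>R ?A' b x u)) (at x)"
      by (rule has_derivative_transform_within_open[OF _ assms(1) that])
        (simp add: linear_basis_expansion[OF lin, symmetric])
    from has_derivative_unique[OF dA[OF that] this] show ?thesis by metis
  qed
  show ?thesis
  proof (induction k arbitrary: v)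
    case 0
    then show ?case
      using has_derivative_continuous[OF der] by (simp add: continuous_at_imp_continuous_on)
  next
    case (Suc k)
    let ?D = "\<lambda>x u. - (\<Sum>c\<in>Basis. ((\<Sum>b\<in>Basis. (inv_into UNIV (A x) v \<bullet> b) *\<^sub>R ?A' b x u) \<bullet> c) *\<^sub>R inv_into UNIV (A x) c)"
    show ?case
    proof (rule Ck_on_SucI[OF assms(1)])
      fix x assume x: "x \<in> U"
      have "- inv_into UNIV (A x) (?A' (inv_into UNIV (A x) v) x u) = ?D x u" for u
        using linear_basis_expansion[OF linB[OF x], of "?A' (inv_into UNIV (A x) v) x u"] A'lin[OF x, of "inv_into UNIV (A x) v" u] by simp
      then show "((\<lambda>x. inv_into UNIV (A x) v) has_derivative ?D x) (at x)" using der[OF x, of v] by presburger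
    next
      fix u
      have "Ck_on k U (\<lambda>x. ?A' b x u)" for b
        using A[of "Suc k" b] by simp
      then show "Ck_on k U (\<lambda>x. ?D x u)"
        by (intro Ck_on_compose_bounded_linear[OF assms(1) bounded_linear_minus[OF bounded_linear_ident]]
          Ck_on_sum assms(1) Ck_on_scaleR
          Ck_on_compose_bounded_linear[OF assms(1) bounded_linear_inner_left] Suc.IH)
    qed
  qed
qed

text \<open>The smooth version of the inverse function theorem: the local inverse \<open>g\<close> has derivative
  \<open>y \<mapsto> (F' (g y))\<^sup>-\<^sup>1\<close>, so it inherits one order of differentiability at a time.\<close>
lemma smooth_inverse_function:
  fixes F :: "'a::euclidean_space \<Rightarrow> 'a"
  assumes "open U" "x0 \<in> U" and F: "\<And>k. Ck_on k U F" and inj: "inj (frechet_derivative F (at x0))"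
  obtains U' V g where "open U'" "U' \<subseteq> U" "x0 \<in> U'" "open V" "F x0 \<in> V" "homeomorphism U' V F g"
    "\<And>k. Ck_on k V g"
proof -
  have dF: "(F has_derivative frechet_derivative F (at x)) (at x)" if "x \<in> U" for x
    using Ck_on_has_derivative[OF F that] .
  have blF: "bounded_linear (frechet_derivative F (at x))" if "x \<in> U" for x
    using dF[OF that] by (rule has_derivative_bounded_linear)
  define f' where "f' = (\<lambda>x. Blinfun (frechet_derivative F (at x)))"
  have f': "blinfun_apply (f' x) = frechet_derivative F (at x)" if "x \<in> U" for x
    using blF[OF that] by (simp add: f'_def bounded_linear_Blinfun_apply)
  have cont: "continuous_on U f'"
  proof (rule continuous_on_blinfun_componentwise)
    fix i :: 'a
    have "continuous_on U (\<lambda>x. frechet_derivative F (at x) i)"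
      using F[of "Suc 0"] by simp
    then show "continuous_on U (\<lambda>x. blinfun_apply (f' x) i)"
      by (simp add: f' cong: continuous_on_cong)
  qed
  obtain g0 where g0: "linear g0" "g0 \<circ> frechet_derivative F (at x0) = id"
    using linear_injective_left_inverse[OF bounded_linear.linear[OF blF[OF assms(2)]] inj] by blast
  have "Blinfun g0 o\<^sub>L f' x0 = id_blinfun"
    using g0 by (intro blinfun_eqI)
      (simp add: f'[OF assms(2)] bounded_linear_Blinfun_apply linear_conv_bounded_linear pointfree_idE)
  then obtain U' V g g' where *: "open U'" "U' \<subseteq> U" "x0 \<in> U'" "open V" "F x0 \<in> V" "homeomorphism U' V F g"
    "\<And>y. y \<in> V \<Longrightarrow> (g has_derivative (g' y)) (at y)"
    "\<And>y. y \<in> V \<Longrightarrow> g' y = inv_into UNIV (blinfun_apply (f' (g y)))"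
    "\<And>y. y \<in> V \<Longrightarrow> bij (blinfun_apply (f' (g y)))"
    using inverse_function_theorem[OF assms(1) _ cont assms(2), of F] dF f' by metis
  have gV: "g ` V = U'" and FU: "F ` U' = V" and gF: "\<And>x. x \<in> U' \<Longrightarrow> g (F x) = x"
    using *(6) by (auto simp: homeomorphism_def)
  let ?A = "\<lambda>x. frechet_derivative F (at x)"
  have bij: "bij (?A x)" if "x \<in> U'" for x
    using *(9)[of "F x"] that FU gF[OF that] f' *(2) by auto
  have h: "Ck_on k U' (\<lambda>x. inv_into UNIV (?A x) v)" for k v
  proof (rule Ck_on_linear_inverse[OF *(1) _ bij])
    show "linear (?A x)" if "x \<in> U'" for x using that *(2) blF bounded_linear.linear by blast
    show "Ck_on k U' (\<lambda>x. ?A x w)" for k w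
      using F[of "Suc k"] by (intro Ck_on_subset[OF _ *(2)]) simp
  qed
  have "Ck_on k V g" for k
  proof (induction k)
    case 0
    then show ?case using *(6) by (simp add: homeomorphism_def)
  next
    case (Suc k)
    show ?case
    proof (rule Ck_on_SucI[OF *(4)])
      fix y assume "y \<in> V"
      then have "g' y = inv_into UNIV (?A (g y))" using *(2,8) gV f' by auto
      then show "(g has_derivative inv_into UNIV (?A (g y))) (at y)" using *(7) \<open>y \<in> V\<close> by metis
    next
      show "Ck_on k V (\<lambda>y. inv_into UNIV (?A (g y)) v)" for v
        by (rule Ck_on_compose[OF *(4) *(1) h Suc.IH]) (simp add: gV)
    qed
  qed
  with * that show thesis by blast
qed

section \<open>Velocities of curves in charts\<close>

text \<open>The derivative of a smooth map along a curve in its domain \<open>A\<close> is a linear function of the velocity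
  of the curve, although \<open>A\<close> need not be open.\<close>
lemma smooth_on_vector_derivative:
  assumes "smooth_on A g" "x \<in> A"
  obtains D where "linear D"
    "\<And>c t v. \<lbrakk>c t = x; \<forall>\<^sub>F s in nhds t. c s \<in> A; (c has_vector_derivative v) (at t)\<rbrakk>
       \<Longrightarrow> ((\<lambda>s. g (c s)) has_vector_derivative D v) (at t)"
proof -
  obtain D where D: "(g has_derivative D) (at x within A)"
    using smooth_on_has_derivative[OF assms] .
  then have lin: "linear D" by (rule has_derivative_linear)
  have "((\<lambda>s. g (c s)) has_vector_derivative D v) (at t)"
    if c: "c t = x" "\<forall>\<^sub>F s in nhds t. c s \<in> A" "(c has_vector_derivative v) (at t)" for c t v
  proof -
    obtain S where S: "open S" "t \<in> S" "\<And>s. s \<in> S \<Longrightarrow> c s \<in> A"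
      using c(2) unfolding eventually_nhds by blast
    have "(g has_derivative D) (at (c t) within c ` S)"
      using D c(1) S(3) by (auto intro: has_derivative_subset)
    moreover have "(c has_derivative (\<lambda>h. h *\<^sub>R v)) (at t within S)"
      using c(3) unfolding has_vector_derivative_def by (rule has_derivative_at_withinI)
    ultimately have "((\<lambda>s. g (c s)) has_derivative (\<lambda>h. D (h *\<^sub>R v))) (at t within S)"
      by (rule has_derivative_in_compose[rotated])
    then show ?thesis
      unfolding has_vector_derivative_def
      by (simp add: at_within_open[OF S(2,1)] linear_scale[OF lin])
  qed
  with lin show thesis by (rule that)
qed

lemma linear_projection_exists:
  fixes V :: "'a::euclidean_space set"
  assumes "subspace V"
  obtains P where "linear P" "\<And>x. P x \<in> V" "\<And>x. x \<in> V \<Longrightarrow> P x = x"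
proof -
  have "\<exists>g. range g \<subseteq> V \<and> linear g \<and> (\<forall>v\<in>V. g (id v) = v)"
    by (rule linear_exists_left_inverse_on) (simp_all add: assms linear_ident id_def)
  then show thesis using that by fastforce
qed

lemma has_vector_derivative_eventually_eq:
  assumes "(f has_vector_derivative v) (at t)" "\<forall>\<^sub>F s in nhds t. f s = g s"
  shows "(g has_vector_derivative v) (at t)"
  using has_vector_derivative_cong_ev[of UNIV f g t, OF _ eventually_nhds_x_imp_x[OF assms(2)]] assms by simp

text \<open>The curve \<open>\<gamma>\<close> stays in the chart domain \<open>U\<close> near time \<open>t\<close> and has velocity \<open>v\<close> at \<open>t\<close> in the chart \<open>\<phi>\<close>.\<close>
definition chart_velocity ::
  "'a set \<Rightarrow> ('a \<Rightarrow> 'e::euclidean_space) \<Rightarrow> (real \<Rightarrow> 'a) \<Rightarrow> real \<Rightarrow> 'e \<Rightarrow> bool" where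
  "chart_velocity U \<phi> \<gamma> t v \<longleftrightarrow>
     (\<forall>\<^sub>F s in nhds t. \<gamma> s \<in> U) \<and> ((\<lambda>s. \<phi> (\<gamma> s)) has_vector_derivative v) (at t)"

text \<open>The tangent vector at \<open>t\<close> of the curve \<open>\<gamma>\<close>. Tangent vectors at a point are given in coordinates of the
  chosen chart at that point, so this is the velocity in the chosen chart at \<open>\<gamma> t\<close>.\<close>
definition has_velocity ::
  "('a, 'e::euclidean_space) manifold \<Rightarrow> (real \<Rightarrow> 'a) \<Rightarrow> real \<Rightarrow> 'e \<Rightarrow> bool" where
  "has_velocity M \<gamma> t v \<longleftrightarrow> (case chart_at M (\<gamma> t) of (U, \<phi>) \<Rightarrow> chart_velocity U \<phi> \<gamma> t v)"

lemma chart_velocity_unique: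
  "chart_velocity U \<phi> \<gamma> t v \<Longrightarrow> chart_velocity U \<phi> \<gamma> t w \<Longrightarrow> v = w"
  unfolding chart_velocity_def by (auto dest: vector_derivative_unique_at)

lemma chart_velocity_cong:
  assumes "chart_velocity U \<phi> \<gamma> t v" "\<forall>\<^sub>F s in nhds t. \<gamma> s = \<delta> s"
  shows "chart_velocity U \<phi> \<delta> t v"
proof -
  have 1: "\<forall>\<^sub>F s in nhds t. \<delta> s \<in> U"
    using assms(2) assms(1)[unfolded chart_velocity_def, THEN conjunct1] by eventually_elim simp
  have "\<forall>\<^sub>F s in nhds t. \<phi> (\<gamma> s) = \<phi> (\<delta> s)"
    using assms(2) by eventually_elim simp
  with assms(1)[unfolded chart_velocity_def, THEN conjunct2]
  have "((\<lambda>s. \<phi> (\<delta> s)) has_vector_derivative v) (at t)"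
    by (rule has_vector_derivative_eventually_eq)
  with 1 show ?thesis by (simp add: chart_velocity_def)
qed

lemma has_velocity_cong:
  assumes "has_velocity M \<gamma> t v" "\<forall>\<^sub>F s in nhds t. \<gamma> s = \<delta> s"
  shows "has_velocity M \<delta> t v"
proof -
  have "\<gamma> t = \<delta> t" using assms(2) by (rule eventually_nhds_x_imp_x)
  then show ?thesis
    using assms chart_velocity_cong[OF _ assms(2)] unfolding has_velocity_def by (auto split: prod.splits)
qed

lemma has_velocity_unique: "has_velocity M \<gamma> t v \<Longrightarrow> has_velocity M \<gamma> t w \<Longrightarrow> v = w"
  unfolding has_velocity_def chart_velocity_def
  by (auto split: prod.splits dest: vector_derivative_unique_at)

lemma smooth_map_onE:
  assumes "smooth_map_on M N A f" "p \<in> A"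
  obtains U \<phi> V \<psi> W where "(U, \<phi>) \<in> atlas M" "(V, \<psi>) \<in> atlas N" "openin (mtop M) W" "p \<in> W"
    "W \<subseteq> U" "f ` (A \<inter> W) \<subseteq> V" "smooth_on (\<phi> ` (A \<inter> W)) (\<psi> \<circ> f \<circ> inv_into U \<phi>)"
  using assms unfolding smooth_map_on_def by fast

lemma smooth_map_on_image: "smooth_map_on M N A f \<Longrightarrow> x \<in> A \<Longrightarrow> f x \<in> topspace (mtop N)"
  unfolding smooth_map_on_def by blast

context smooth_manifold
begin

lemma chart_open: "(U, \<phi>) \<in> atlas M \<Longrightarrow> openin (mtop M) U"
  using chart by blast

lemma chart_subset: "(U, \<phi>) \<in> atlas M \<Longrightarrow> U \<subseteq> topspace (mtop M)"
  using chart_open openin_subset by blast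

lemma chart_topspace: "(U, \<phi>) \<in> atlas M \<Longrightarrow> topspace (subtopology (mtop M) U) = U"
  using chart_subset by auto

lemma chart_inj: "(U, \<phi>) \<in> atlas M \<Longrightarrow> inj_on \<phi> U"
  using chart[of U \<phi>] chart_topspace[of U \<phi>] homeomorphic_imp_injective_map by metis

lemma chart_inv [simp]: "(U, \<phi>) \<in> atlas M \<Longrightarrow> x \<in> U \<Longrightarrow> inv_into U \<phi> (\<phi> x) = x"
  using chart_inj inv_into_f_f by metis

lemma chart_image_subset: "(U, \<phi>) \<in> atlas M \<Longrightarrow> x \<in> U \<Longrightarrow> \<phi> x \<in> model M"
  using chart[of U \<phi>] openin_subset[of "top_of_set (model M)"] by auto

lemma chart_image_openin:
  assumes "(U, \<phi>) \<in> atlas M" "openin (mtop M) W" "W \<subseteq> U"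
  obtains T where "open T" "\<phi> ` W = model M \<inter> T"
proof -
  have "openin (subtopology (mtop M) U) W"
    using assms openin_subset_topspace_eq by (metis openin_subtopology inf.absorb1)
  then have "openin (top_of_set (\<phi> ` U)) (\<phi> ` W)"
    using homeomorphic_map_openness[of "subtopology (mtop M) U" "top_of_set (\<phi> ` U)" \<phi> W]
      chart[OF assms(1)] assms(3) openin_subset[OF assms(2)] by simp
  then have "openin (top_of_set (model M)) (\<phi> ` W)"
    using chart[OF assms(1)] openin_trans by blast
  then show thesis using that unfolding openin_open by blast
qed

lemma chart_preimage_openin:
  assumes "(U, \<phi>) \<in> atlas M" "open T"
  shows "openin (mtop M) {x \<in> U. \<phi> x \<in> T}"
proof -
  have "continuous_map (subtopology (mtop M) U) (top_of_set (\<phi> ` U)) \<phi>"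
    using chart[OF assms(1)] homeomorphic_imp_continuous_map by blast
  then have "continuous_map (subtopology (mtop M) U) euclidean \<phi>"
    by (simp add: continuous_map_in_subtopology)
  then have "openin (subtopology (mtop M) U) {x \<in> U. \<phi> x \<in> T}"
    using assms(2) chart_topspace[OF assms(1)] openin_continuous_map_preimage by fastforce
  then show ?thesis using chart_open[OF assms(1)] openin_trans_full by blast
qed

lemma chart_at_atlas:
  assumes "p \<in> topspace (mtop M)"
  obtains U \<phi> where "chart_at M p = (U, \<phi>)" "(U, \<phi>) \<in> atlas M" "p \<in> U"
proof -
  obtain c where "c \<in> atlas M \<and> p \<in> fst c" using cover[OF assms] by force
  then have "chart_at M p \<in> atlas M \<and> p \<in> fst (chart_at M p)"
    unfolding chart_at_def by (rule someI)
  then show thesis using that by (metis prod.collapse)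
qed

lemma chart_velocity_eventually:
  assumes "(U, \<phi>) \<in> atlas M" "chart_velocity U \<phi> \<gamma> t v" "\<gamma> t \<in> W" "openin (mtop M) W"
  shows "\<forall>\<^sub>F s in nhds t. \<gamma> s \<in> U \<inter> W"
proof -
  have ev: "\<forall>\<^sub>F s in nhds t. \<gamma> s \<in> U" and d: "((\<lambda>s. \<phi> (\<gamma> s)) has_vector_derivative v) (at t)"
    using assms(2) unfolding chart_velocity_def by auto
  have t: "\<gamma> t \<in> U" using ev eventually_nhds_x_imp_x by fast
  have op: "openin (mtop M) (U \<inter> W)" using assms chart_open by blast
  obtain T where T: "open T" "\<phi> ` (U \<inter> W) = model M \<inter> T"
    using chart_image_openin[OF assms(1) op] by blast
  have "\<phi> (\<gamma> t) \<in> T" using T t assms(3) by blast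
  then have "\<forall>\<^sub>F s in at t. \<phi> (\<gamma> s) \<in> T"
    using has_vector_derivative_continuous[OF d] T(1) unfolding continuous_within
    by (rule topological_tendstoD[rotated 2])
  then have "\<forall>\<^sub>F s in nhds t. \<phi> (\<gamma> s) \<in> T"
    using \<open>\<phi> (\<gamma> t) \<in> T\<close> by (simp add: eventually_nhds_conv_at)
  with ev show ?thesis
  proof eventually_elim
    case (elim s)
    then have "\<phi> (\<gamma> s) \<in> \<phi> ` (U \<inter> W)" using T(2) chart_image_subset[OF assms(1)] by blast
    then show ?case using elim(1) chart_inj[OF assms(1)] by (auto simp: inj_on_def)
  qed
qed

text \<open>A projection onto the model space fixes the coordinates of the curve, hence also their derivative.\<close>
lemma chart_velocity_in_model:
  assumes "(U, \<phi>) \<in> atlas M" "chart_velocity U \<phi> \<gamma> t v"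
  shows "v \<in> model M"
proof -
  obtain P where P: "linear P" "\<And>x. P x \<in> model M" "\<And>x. x \<in> model M \<Longrightarrow> P x = x"
    using linear_projection_exists[OF subspace_model] by blast
  have d: "((\<lambda>s. \<phi> (\<gamma> s)) has_vector_derivative v) (at t)" and ev: "\<forall>\<^sub>F s in nhds t. \<gamma> s \<in> U"
    using assms(2) unfolding chart_velocity_def by auto
  have "((\<lambda>s. P (\<phi> (\<gamma> s))) has_vector_derivative P v) (at t)"
    using bounded_linear.has_vector_derivative[OF _ d] P(1) linear_linear by blast
  moreover have "\<forall>\<^sub>F s in nhds t. P (\<phi> (\<gamma> s)) = \<phi> (\<gamma> s)"
    using ev by eventually_elim (use P(3) chart_image_subset[OF assms(1)] in blast)
  ultimately have "((\<lambda>s. \<phi> (\<gamma> s)) has_vector_derivative P v) (at t)"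
    by (rule has_vector_derivative_eventually_eq)
  then have "P v = v" using d vector_derivative_unique_at by blast
  then show ?thesis using P(2) by metis
qed

text \<open>A map with a smooth coordinate expression transforms velocities at \<open>p\<close> by one linear map.\<close>
lemma chart_velocity_smooth:
  assumes N: "smooth_manifold N"
    and "(U, \<phi>) \<in> atlas M" "(V, \<psi>) \<in> atlas N" "openin (mtop M) W" "W \<subseteq> U" "f ` W \<subseteq> V"
    and sm: "smooth_on (\<phi> ` W) (\<psi> \<circ> f \<circ> inv_into U \<phi>)" and "p \<in> W"
  obtains L where "linear L" "\<And>\<gamma> t v. \<gamma> t = p \<Longrightarrow> chart_velocity U \<phi> \<gamma> t v \<Longrightarrow>
    chart_velocity V \<psi> (\<lambda>s. f (\<gamma> s)) t (L v)"
proof -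
  have "\<phi> p \<in> \<phi> ` W" using assms(8) by blast
  from smooth_on_vector_derivative[OF sm this] obtain D where D: "linear D"
    "\<And>c t v. \<lbrakk>c t = \<phi> p; \<forall>\<^sub>F s in nhds t. c s \<in> \<phi> ` W; (c has_vector_derivative v) (at t)\<rbrakk>
       \<Longrightarrow> ((\<lambda>s. (\<psi> \<circ> f \<circ> inv_into U \<phi>) (c s)) has_vector_derivative D v) (at t)"
    by metis
  have "chart_velocity V \<psi> (\<lambda>s. f (\<gamma> s)) t (D v)"
    if \<gamma>: "\<gamma> t = p" "chart_velocity U \<phi> \<gamma> t v" for \<gamma> t v
  proof -
    have ev: "\<forall>\<^sub>F s in nhds t. \<gamma> s \<in> U \<inter> W"
      using chart_velocity_eventually[OF assms(2) \<gamma>(2) _ assms(4)] \<gamma>(1) assms(8) by simp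
    then have "\<forall>\<^sub>F s in nhds t. \<phi> (\<gamma> s) \<in> \<phi> ` W" by eventually_elim blast
    then have "((\<lambda>s. (\<psi> \<circ> f \<circ> inv_into U \<phi>) (\<phi> (\<gamma> s))) has_vector_derivative D v) (at t)"
      using \<gamma> by (intro D(2)) (auto simp: chart_velocity_def)
    moreover have "\<forall>\<^sub>F s in nhds t. (\<psi> \<circ> f \<circ> inv_into U \<phi>) (\<phi> (\<gamma> s)) = \<psi> (f (\<gamma> s))"
      using ev by eventually_elim (simp add: assms(2))
    ultimately have "((\<lambda>s. \<psi> (f (\<gamma> s))) has_vector_derivative D v) (at t)"
      by (rule has_vector_derivative_eventually_eq)
    moreover have "\<forall>\<^sub>F s in nhds t. f (\<gamma> s) \<in> V"
      using ev by eventually_elim (use assms(6) in blast)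
    ultimately show ?thesis by (simp add: chart_velocity_def)
  qed
  with D(1) show thesis by (rule that)
qed

lemma chart_velocity_change:
  assumes "(U, \<phi>) \<in> atlas M" "(V, \<psi>) \<in> atlas M" "p \<in> U" "p \<in> V"
  obtains L where "linear L" "\<And>\<gamma> t v. \<gamma> t = p \<Longrightarrow> chart_velocity U \<phi> \<gamma> t v \<Longrightarrow>
    chart_velocity V \<psi> \<gamma> t (L v)"
proof -
  have "openin (mtop M) (U \<inter> V)" using assms chart_open by blast
  moreover have "smooth_on (\<phi> ` (U \<inter> V)) (\<psi> \<circ> (\<lambda>x. x) \<circ> inv_into U \<phi>)"
    using compatible[OF assms(1,2)] by (simp add: comp_def)
  ultimately show thesis
    using chart_velocity_smooth[OF smooth_manifold_axioms assms(1,2), of "U \<inter> V" "\<lambda>x. x" p thesis] that assms(3,4)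
    by auto
qed

lemma has_velocity_at_chart:
  "chart_at M p = (U, \<phi>) \<Longrightarrow> \<gamma> t = p \<Longrightarrow> has_velocity M \<gamma> t v \<longleftrightarrow> chart_velocity U \<phi> \<gamma> t v"
  by (simp add: has_velocity_def)

lemma chart_velocity_imp_has_velocity:
  assumes "(U, \<phi>) \<in> atlas M" "p \<in> U"
  obtains L where "linear L" "\<And>\<gamma> t v. \<gamma> t = p \<Longrightarrow> chart_velocity U \<phi> \<gamma> t v \<Longrightarrow>
    has_velocity M \<gamma> t (L v)"
proof -
  obtain V \<psi> where V: "chart_at M p = (V, \<psi>)" "(V, \<psi>) \<in> atlas M" "p \<in> V"
    using chart_at_atlas chart_subset assms by blast
  show thesis
    using chart_velocity_change[OF assms(1) V(2) assms(2) V(3)] that has_velocity_at_chart[OF V(1)]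
    by metis
qed

lemma has_velocity_imp_chart_velocity:
  assumes "(U, \<phi>) \<in> atlas M" "p \<in> U"
  obtains L where "linear L" "\<And>\<gamma> t v. \<gamma> t = p \<Longrightarrow> has_velocity M \<gamma> t v \<Longrightarrow>
    chart_velocity U \<phi> \<gamma> t (L v)"
proof -
  obtain V \<psi> where V: "chart_at M p = (V, \<psi>)" "(V, \<psi>) \<in> atlas M" "p \<in> V"
    using chart_at_atlas chart_subset assms by blast
  show thesis
    using chart_velocity_change[OF V(2) assms(1) V(3) assms(2)] that has_velocity_at_chart[OF V(1)]
    by metis
qed

lemma has_velocity_in_model:
  assumes "\<gamma> t \<in> topspace (mtop M)" "has_velocity M \<gamma> t v"
  shows "v \<in> model M"
proof -
  obtain V \<psi> where V: "chart_at M (\<gamma> t) = (V, \<psi>)" "(V, \<psi>) \<in> atlas M" "\<gamma> t \<in> V"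
    using chart_at_atlas assms(1) by blast
  then show ?thesis using chart_velocity_in_model[OF V(2)] assms(2) has_velocity_at_chart[OF V(1)] by blast
qed

lemma has_velocity_eventually:
  assumes "\<gamma> t \<in> topspace (mtop M)" "has_velocity M \<gamma> t v" "openin (mtop M) W" "\<gamma> t \<in> W"
  shows "\<forall>\<^sub>F s in nhds t. \<gamma> s \<in> W"
proof -
  obtain V \<psi> where V: "chart_at M (\<gamma> t) = (V, \<psi>)" "(V, \<psi>) \<in> atlas M" "\<gamma> t \<in> V"
    using chart_at_atlas assms(1) by blast
  have "\<forall>\<^sub>F s in nhds t. \<gamma> s \<in> V \<inter> W"
    using chart_velocity_eventually[OF V(2)] assms V(1) has_velocity_at_chart by blast
  then show ?thesis by eventually_elim blast
qed

lemma has_velocity_const: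
  assumes "p \<in> topspace (mtop M)"
  shows "has_velocity M (\<lambda>s. p) t 0"
proof -
  obtain V \<psi> where "chart_at M p = (V, \<psi>)" "p \<in> V"
    using chart_at_atlas assms by blast
  then show ?thesis by (simp add: has_velocity_def chart_velocity_def)
qed

lemma chart_line_velocity:
  assumes "(U, \<phi>) \<in> atlas M" "x \<in> model M" "v \<in> model M" "x + t *\<^sub>R v \<in> \<phi> ` U"
  shows "chart_velocity U \<phi> (\<lambda>s. inv_into U \<phi> (x + s *\<^sub>R v)) t v"
proof -
  obtain T where T: "open T" "\<phi> ` U = model M \<inter> T"
    using chart_image_openin[OF assms(1) chart_open[OF assms(1)]] by blast
  have m: "x + s *\<^sub>R v \<in> model M" for s
    using assms(2,3) subspace_model by (simp add: subspace_add subspace_scale)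
  have "open ((\<lambda>s. x + s *\<^sub>R v) -` T)"
    by (intro open_vimage T(1) continuous_intros)
  moreover have "t \<in> (\<lambda>s. x + s *\<^sub>R v) -` T" using assms(4) T by blast
  ultimately have "\<forall>\<^sub>F s in nhds t. s \<in> (\<lambda>s. x + s *\<^sub>R v) -` T" using eventually_nhds_in_open by blast
  then have ev: "\<forall>\<^sub>F s in nhds t. x + s *\<^sub>R v \<in> \<phi> ` U"
    by eventually_elim (use T(2) m in blast)
  have "((\<lambda>s. x + s *\<^sub>R v) has_vector_derivative v) (at t)"
    by (auto intro!: derivative_eq_intros)
  moreover have "\<forall>\<^sub>F s in nhds t. x + s *\<^sub>R v = \<phi> (inv_into U \<phi> (x + s *\<^sub>R v))"
    using ev by eventually_elim (simp add: f_inv_into_f)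
  ultimately have "((\<lambda>s. \<phi> (inv_into U \<phi> (x + s *\<^sub>R v))) has_vector_derivative v) (at t)"
    by (rule has_vector_derivative_eventually_eq)
  moreover have "\<forall>\<^sub>F s in nhds t. inv_into U \<phi> (x + s *\<^sub>R v) \<in> U"
    using ev by eventually_elim (rule inv_into_into)
  ultimately show ?thesis by (simp add: chart_velocity_def)
qed

lemma smooth_map_velocity:
  assumes N: "smooth_manifold N" and f: "smooth_map_on M N (topspace (mtop M)) f"
    and p: "p \<in> topspace (mtop M)"
  obtains L where "linear L" "\<And>\<gamma> t v. \<gamma> t = p \<Longrightarrow> has_velocity M \<gamma> t v \<Longrightarrow>
    has_velocity N (\<lambda>s. f (\<gamma> s)) t (L v)"
proof -
  interpret N: smooth_manifold N by (rule N)
  obtain U \<phi> V \<psi> W where *: "(U, \<phi>) \<in> atlas M" "(V, \<psi>) \<in> atlas N" "openin (mtop M) W" "p \<in> W"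
    "W \<subseteq> U" "f ` (topspace (mtop M) \<inter> W) \<subseteq> V"
    "smooth_on (\<phi> ` (topspace (mtop M) \<inter> W)) (\<psi> \<circ> f \<circ> inv_into U \<phi>)"
    by (rule smooth_map_onE[OF f p])
  have W: "topspace (mtop M) \<inter> W = W" using openin_subset[OF *(3)] by blast
  note * = *[unfolded W]
  obtain L1 where L1: "linear L1" "\<And>\<gamma> t v. \<gamma> t = p \<Longrightarrow> has_velocity M \<gamma> t v \<Longrightarrow>
    chart_velocity U \<phi> \<gamma> t (L1 v)"
    using has_velocity_imp_chart_velocity[OF *(1)] *(4,5) by blast
  obtain L2 where L2: "linear L2" "\<And>\<gamma> t v. \<gamma> t = p \<Longrightarrow> chart_velocity U \<phi> \<gamma> t v \<Longrightarrow>
    chart_velocity V \<psi> (\<lambda>s. f (\<gamma> s)) t (L2 v)"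
    using chart_velocity_smooth[OF N *(1,2,3,5,6,7,4)] by blast
  have "f p \<in> V" using *(4,6) by blast
  then obtain L3 where L3: "linear L3" "\<And>\<gamma> t v. \<gamma> t = f p \<Longrightarrow> chart_velocity V \<psi> \<gamma> t v \<Longrightarrow>
    has_velocity N \<gamma> t (L3 v)"
    using N.chart_velocity_imp_has_velocity[OF *(2)] by blast
  show thesis
  proof (rule that)
    show "linear (L3 \<circ> (L2 \<circ> L1))" by (intro linear_compose L1 L2 L3)
    show "has_velocity N (\<lambda>s. f (\<gamma> s)) t ((L3 \<circ> (L2 \<circ> L1)) v)"
      if "\<gamma> t = p" "has_velocity M \<gamma> t v" for \<gamma> t v
      unfolding comp_def by (rule L3(2)[OF _ L2(2)[OF that(1) L1(2)[OF that]]]) (simp add: that(1))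
  qed
qed

section \<open>Tangent maps\<close>

text \<open>The coordinate line through \<open>p\<close> in direction \<open>v\<close>, along which \<open>tangent_map\<close> is defined to differentiate.\<close>
lemma line_exists:
  assumes "p \<in> topspace (mtop M)" "v \<in> model M"
  obtains \<gamma> where "\<gamma> 0 = p" "has_velocity M \<gamma> 0 v"
    "tangent_map M N f p v = vector_derivative (\<lambda>t. snd (chart_at N (f p)) (f (\<gamma> t))) (at 0)"
proof -
  obtain U \<phi> where U: "chart_at M p = (U, \<phi>)" "(U, \<phi>) \<in> atlas M" "p \<in> U"
    using chart_at_atlas assms(1) by blast
  let ?\<gamma> = "\<lambda>t. inv_into U \<phi> (\<phi> p + t *\<^sub>R v)"
  show thesis
  proof (rule that)
    show 0: "?\<gamma> 0 = p" using U by simp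
    show "has_velocity M ?\<gamma> 0 v"
      unfolding has_velocity_at_chart[of p U \<phi> ?\<gamma> 0 v, OF U(1) 0]
      using U assms(2) chart_image_subset by (intro chart_line_velocity) auto
    show "tangent_map M N f p v = vector_derivative (\<lambda>t. snd (chart_at N (f p)) (f (?\<gamma> t))) (at 0)"
      by (simp add: tangent_map_def U(1) split: prod.splits)
  qed
qed

lemma tangent_map_eqI:
  assumes "p \<in> topspace (mtop M)" "v \<in> model M"
    and "\<And>\<gamma>. \<gamma> 0 = p \<Longrightarrow> has_velocity M \<gamma> 0 v \<Longrightarrow> has_velocity N (\<lambda>s. f (\<gamma> s)) 0 w"
  shows "tangent_map M N f p v = w"
proof -
  obtain \<gamma> where \<gamma>: "\<gamma> 0 = p" "has_velocity M \<gamma> 0 v"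
    "tangent_map M N f p v = vector_derivative (\<lambda>t. snd (chart_at N (f p)) (f (\<gamma> t))) (at 0)"
    using line_exists[OF assms(1,2), of N f] by blast
  have "has_velocity N (\<lambda>s. f (\<gamma> s)) 0 w" using \<gamma>(1,2) by (rule assms(3))
  then have "((\<lambda>t. snd (chart_at N (f p)) (f (\<gamma> t))) has_vector_derivative w) (at 0)"
    unfolding has_velocity_def chart_velocity_def using \<gamma>(1) by (auto split: prod.splits)
  then show ?thesis unfolding \<gamma>(3) by (rule vector_derivative_at)
qed

context
  fixes N :: "('b, 'f::euclidean_space) manifold" and f
  assumes N: "smooth_manifold N" and f: "smooth_map_on M N (topspace (mtop M)) f"
begin

lemma tangent_map_eq_linear:
  assumes p: "p \<in> topspace (mtop M)"
  obtains L where "linear L" "\<And>v. v \<in> model M \<Longrightarrow> tangent_map M N f p v = L v"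
    "\<And>\<gamma> t v. \<gamma> t = p \<Longrightarrow> has_velocity M \<gamma> t v \<Longrightarrow> has_velocity N (\<lambda>s. f (\<gamma> s)) t (L v)"
proof -
  obtain L where L: "linear L" "\<And>\<gamma> t v. \<gamma> t = p \<Longrightarrow> has_velocity M \<gamma> t v \<Longrightarrow>
    has_velocity N (\<lambda>s. f (\<gamma> s)) t (L v)"
    using smooth_map_velocity[OF N f p] by blast
  moreover have "tangent_map M N f p v = L v" if "v \<in> model M" for v
    using p that L(2) by (rule tangent_map_eqI)
  ultimately show thesis using that by blast
qed

lemma has_velocity_tangent_map:
  assumes "\<gamma> t \<in> topspace (mtop M)" "has_velocity M \<gamma> t v"
  shows "has_velocity N (\<lambda>s. f (\<gamma> s)) t (tangent_map M N f (\<gamma> t) v)"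
  using tangent_map_eq_linear[OF assms(1)] has_velocity_in_model[OF assms] assms(2) by metis

lemma tangent_map_in_model:
  assumes "p \<in> topspace (mtop M)" "v \<in> model M"
  shows "tangent_map M N f p v \<in> model N"
proof -
  obtain \<gamma> where "\<gamma> 0 = p" "has_velocity M \<gamma> 0 v"
    using line_exists[OF assms] by blast
  then have "has_velocity N (\<lambda>s. f (\<gamma> s)) 0 (tangent_map M N f p v)"
    using has_velocity_tangent_map assms(1) by metis
  then show ?thesis
    using smooth_manifold.has_velocity_in_model[OF N] \<open>\<gamma> 0 = p\<close> smooth_map_on_image[OF f assms(1)] by metis
qed

lemma tangent_map_cong:
  assumes "p \<in> topspace (mtop M)" "v \<in> model M" "\<And>x. x \<in> topspace (mtop M) \<Longrightarrow> g x = f x"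
  shows "tangent_map M N g p v = tangent_map M N f p v"
proof (rule tangent_map_eqI[OF assms(1,2)])
  fix \<gamma> :: "real \<Rightarrow> 'a" assume \<gamma>: "\<gamma> 0 = p" "has_velocity M \<gamma> 0 v"
  then have "\<forall>\<^sub>F s in nhds 0. \<gamma> s \<in> topspace (mtop M)"
    using has_velocity_eventually assms(1) openin_topspace by metis
  then have "\<forall>\<^sub>F s in nhds 0. f (\<gamma> s) = g (\<gamma> s)"
    by eventually_elim (simp add: assms(3))
  with has_velocity_tangent_map[of \<gamma> 0 v] \<gamma> assms(1)
  show "has_velocity N (\<lambda>s. g (\<gamma> s)) 0 (tangent_map M N f p v)"
    by (auto intro: has_velocity_cong)
qed

lemma tangent_map_compose:
  assumes P: "smooth_manifold P" and g: "smooth_map_on N P (topspace (mtop N)) g"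
    and p: "p \<in> topspace (mtop M)" "v \<in> model M"
  shows "tangent_map M P (\<lambda>x. g (f x)) p v = tangent_map N P g (f p) (tangent_map M N f p v)"
proof (rule tangent_map_eqI[OF p])
  fix \<gamma> :: "real \<Rightarrow> 'a" assume \<gamma>: "\<gamma> 0 = p" "has_velocity M \<gamma> 0 v"
  have "has_velocity N (\<lambda>s. f (\<gamma> s)) 0 (tangent_map M N f p v)"
    using has_velocity_tangent_map[of \<gamma> 0 v] \<gamma> p(1) by simp
  then show "has_velocity P (\<lambda>s. g (f (\<gamma> s))) 0 (tangent_map N P g (f p) (tangent_map M N f p v))"
    using smooth_manifold.has_velocity_tangent_map[OF N P g, of "\<lambda>s. f (\<gamma> s)" 0] \<gamma>(1)
      smooth_map_on_image[OF f p(1)] by simp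
qed

end

lemma tangent_map_ident:
  assumes "p \<in> topspace (mtop M)" "v \<in> model M"
  shows "tangent_map M M (\<lambda>x. x) p v = v"
  using assms by (rule tangent_map_eqI)

text \<open>The chart in which the velocity is measured varies with the point of the curve. Vanishing of a velocity
  does not depend on the chart, so locally one chart serves for all times.\<close>
lemma has_velocity_zero_imp_constant:
  assumes "open T" "connected T" "a \<in> T" "b \<in> T"
    and \<gamma>: "\<And>s. s \<in> T \<Longrightarrow> \<gamma> s \<in> topspace (mtop M)" "\<And>s. s \<in> T \<Longrightarrow> has_velocity M \<gamma> s 0"
  shows "\<gamma> a = \<gamma> b"
proof (rule connected_local_const[OF assms(2-4)], rule ballI)
  fix s assume s: "s \<in> T"
  obtain V \<psi> where V: "(V, \<psi>) \<in> atlas M" "\<gamma> s \<in> V"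
    using chart_at_atlas[OF \<gamma>(1)[OF s]] by metis
  have "\<forall>\<^sub>F r in nhds s. \<gamma> r \<in> V \<and> r \<in> T"
    using has_velocity_eventually[OF \<gamma>(1)[OF s] \<gamma>(2)[OF s] chart_open[OF V(1)] V(2)]
      eventually_nhds_in_open[OF assms(1) s] by (rule eventually_conj)
  then obtain e where e: "e > 0" "\<And>r. dist r s < e \<Longrightarrow> \<gamma> r \<in> V \<and> r \<in> T"
    unfolding eventually_nhds_metric by blast
  have d: "((\<lambda>r. \<psi> (\<gamma> r)) has_derivative (\<lambda>h. 0)) (at r within ball s e)" if "r \<in> ball s e" for r
  proof -
    have r: "\<gamma> r \<in> V" "r \<in> T" using e(2)[of r] that by (auto simp: dist_commute)
    obtain L where L: "linear L" "\<And>\<gamma>' t v. \<gamma>' t = \<gamma> r \<Longrightarrow> has_velocity M \<gamma>' t v \<Longrightarrow>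
      chart_velocity V \<psi> \<gamma>' t (L v)"
      using has_velocity_imp_chart_velocity[OF V(1) r(1)] by blast
    have "chart_velocity V \<psi> \<gamma> r (L 0)"
      using \<gamma>(2)[OF r(2)] by (intro L(2)) auto
    then have "((\<lambda>r. \<psi> (\<gamma> r)) has_vector_derivative 0) (at r)"
      using linear_0[OF L(1)] by (simp add: chart_velocity_def)
    then show ?thesis
      unfolding has_vector_derivative_def by (simp add: has_derivative_at_withinI)
  qed
  obtain c where c: "\<And>r. r \<in> ball s e \<Longrightarrow> \<psi> (\<gamma> r) = c"
    using has_derivative_zero_constant[OF convex_ball d] by blast
  have "\<gamma> s = \<gamma> r" if "r \<in> ball s e" for r
    using c[OF that] c[of s] e that chart_inj[OF V(1)] by (auto simp: inj_on_def dist_commute)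
  then show "\<forall>\<^sub>F r in at s within T. \<gamma> s = \<gamma> r"
    using e(1) by (auto simp: eventually_at dist_commute intro!: exI[of _ e])
qed

section \<open>Smooth maps between manifolds\<close>

lemma smooth_map_onI:
  assumes "f ` topspace (mtop M) \<subseteq> topspace (mtop N)"
    and "\<And>p. p \<in> topspace (mtop M) \<Longrightarrow> \<exists>U \<phi> V \<psi> W. (U, \<phi>) \<in> atlas M \<and> (V, \<psi>) \<in> atlas N \<and> openin (mtop M) W \<and>
      p \<in> W \<and> W \<subseteq> U \<and> f ` W \<subseteq> V \<and> smooth_on (\<phi> ` W) (\<psi> \<circ> f \<circ> inv_into U \<phi>)"
  shows "smooth_map_on M N (topspace (mtop M)) f"
  unfolding smooth_map_on_def
proof (intro conjI ballI)
  fix p assume "p \<in> topspace (mtop M)"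
  from assms(2)[OF this] obtain U \<phi> V \<psi> W where *: "(U, \<phi>) \<in> atlas M" "(V, \<psi>) \<in> atlas N" "openin (mtop M) W"
      "p \<in> W" "W \<subseteq> U" "f ` W \<subseteq> V" "smooth_on (\<phi> ` W) (\<psi> \<circ> f \<circ> inv_into U \<phi>)" by blast
  have "topspace (mtop M) \<inter> W = W" using openin_subset[OF *(3)] by blast
  with *(3-7) show "\<exists>(U, \<phi>)\<in>atlas M. \<exists>(V, \<psi>)\<in>atlas N. \<exists>W. openin (mtop M) W \<and> p \<in> W \<and> W \<subseteq> U \<and>
      f ` (topspace (mtop M) \<inter> W) \<subseteq> V \<and>
      smooth_on (\<phi> ` (topspace (mtop M) \<inter> W)) (\<psi> \<circ> f \<circ> inv_into U \<phi>)"
    by (intro rev_bexI[OF *(1)] case_prodI rev_bexI[OF *(2)] exI[of _ W]) simp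
qed (use assms(1) in auto)

lemma smooth_map_topspaceE:
  assumes "smooth_map_on M N (topspace (mtop M)) f" "p \<in> topspace (mtop M)"
  obtains U \<phi> V \<psi> W where "(U, \<phi>) \<in> atlas M" "(V, \<psi>) \<in> atlas N" "openin (mtop M) W" "p \<in> W"
    "W \<subseteq> U" "f ` W \<subseteq> V" "smooth_on (\<phi> ` W) (\<psi> \<circ> f \<circ> inv_into U \<phi>)"
proof -
  obtain U \<phi> V \<psi> W where *: "(U, \<phi>) \<in> atlas M" "(V, \<psi>) \<in> atlas N" "openin (mtop M) W" "p \<in> W"
    "W \<subseteq> U" "f ` (topspace (mtop M) \<inter> W) \<subseteq> V"
    "smooth_on (\<phi> ` (topspace (mtop M) \<inter> W)) (\<psi> \<circ> f \<circ> inv_into U \<phi>)"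
    by (rule smooth_map_onE[OF assms])
  have "topspace (mtop M) \<inter> W = W" using openin_subset[OF *(3)] by blast
  with * show thesis by (intro that) auto
qed

lemma smooth_map_cong:
  assumes "smooth_map_on M N (topspace (mtop M)) f" "\<And>x. x \<in> topspace (mtop M) \<Longrightarrow> f x = g x"
  shows "smooth_map_on M N (topspace (mtop M)) g"
proof (rule smooth_map_onI)
  show "g ` topspace (mtop M) \<subseteq> topspace (mtop N)"
    using smooth_map_on_image[OF assms(1)] assms(2) by auto
  fix p assume p: "p \<in> topspace (mtop M)"
  obtain U \<phi> V \<psi> W where *: "(U, \<phi>) \<in> atlas M" "(V, \<psi>) \<in> atlas N" "openin (mtop M) W" "p \<in> W"
    "W \<subseteq> U" "f ` W \<subseteq> V" "smooth_on (\<phi> ` W) (\<psi> \<circ> f \<circ> inv_into U \<phi>)"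
    by (rule smooth_map_topspaceE[OF assms(1) p])
  have eq: "f x = g x" if "x \<in> W" for x using that assms(2) openin_subset[OF *(3)] by blast
  then have 1: "g ` W \<subseteq> V" using *(6) by force
  have 2: "smooth_on (\<phi> ` W) (\<psi> \<circ> g \<circ> inv_into U \<phi>)"
    by (rule smooth_on_cong[OF *(7)]) (use eq *(1,5) in \<open>auto simp: subset_iff\<close>)
  from * 1 2 show "\<exists>U \<phi> V \<psi> W. (U, \<phi>) \<in> atlas M \<and> (V, \<psi>) \<in> atlas N \<and> openin (mtop M) W \<and>
      p \<in> W \<and> W \<subseteq> U \<and> g ` W \<subseteq> V \<and> smooth_on (\<phi> ` W) (\<psi> \<circ> g \<circ> inv_into U \<phi>)"
    by blast
qed

lemma smooth_map_ident: "smooth_map_on M M (topspace (mtop M)) (\<lambda>x. x)"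
proof (rule smooth_map_onI)
  fix p assume p: "p \<in> topspace (mtop M)"
  obtain U \<phi> where U: "(U, \<phi>) \<in> atlas M" "p \<in> U"
    using chart_at_atlas[OF p] by metis
  have "smooth_on (\<phi> ` U) (\<phi> \<circ> (\<lambda>x. x) \<circ> inv_into U \<phi>)"
    by (rule smooth_on_cong[OF smooth_on_id]) (use U(1) in auto)
  with U chart_open[OF U(1)] show "\<exists>U \<phi> V \<psi> W. (U, \<phi>) \<in> atlas M \<and> (V, \<psi>) \<in> atlas M \<and> openin (mtop M) W \<and>
      p \<in> W \<and> W \<subseteq> U \<and> (\<lambda>x. x) ` W \<subseteq> V \<and> smooth_on (\<phi> ` W) (\<psi> \<circ> (\<lambda>x. x) \<circ> inv_into U \<phi>)"
    by (intro exI[of _ U] exI[of _ \<phi>]) auto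
qed auto

lemma smooth_map_preimage_openin:
  assumes N: "smooth_manifold N" and U: "(U, \<phi>) \<in> atlas M" and V: "(V, \<psi>) \<in> atlas N"
    and W: "openin (mtop M) W" "W \<subseteq> U" "f ` W \<subseteq> V"
    and sm: "smooth_on (\<phi> ` W) (\<psi> \<circ> f \<circ> inv_into U \<phi>)" and Q: "openin (mtop N) Q"
  shows "openin (mtop M) {x \<in> W. f x \<in> Q}"
proof -
  interpret N: smooth_manifold N by (rule N)
  have "openin (mtop N) (Q \<inter> V)" using Q N.chart_open[OF V] by blast
  then obtain T where T: "open T" "\<psi> ` (Q \<inter> V) = model N \<inter> T"
    using N.chart_image_openin[OF V] by blast
  obtain S where S: "open S" "\<phi> ` W = model M \<inter> S"
    using chart_image_openin[OF U W(1,2)] by blast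
  have "openin (top_of_set (\<phi> ` W)) (\<phi> ` W \<inter> (\<psi> \<circ> f \<circ> inv_into U \<phi>) -` T)"
    using smooth_on_imp_continuous_on[OF sm] T(1) by (rule continuous_openin_preimage_gen)
  then obtain R where R: "open R" "\<phi> ` W \<inter> (\<psi> \<circ> f \<circ> inv_into U \<phi>) -` T = \<phi> ` W \<inter> R"
    unfolding openin_open by blast
  have "f x \<in> Q \<longleftrightarrow> \<phi> x \<in> R" if x: "x \<in> W" for x
  proof -
    have xV: "f x \<in> V" and xU: "x \<in> U" using x W by auto
    have "f x \<in> Q \<longleftrightarrow> \<psi> (f x) \<in> \<psi> ` (Q \<inter> V)"
      using xV N.chart_inj[OF V] by (auto simp: inj_on_def)
    also have "\<dots> \<longleftrightarrow> \<psi> (f x) \<in> T" using T(2) N.chart_image_subset[OF V xV] by blast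
    also have "\<dots> \<longleftrightarrow> \<phi> x \<in> \<phi> ` W \<inter> (\<psi> \<circ> f \<circ> inv_into U \<phi>) -` T" using x xU U by simp
    also have "\<dots> \<longleftrightarrow> \<phi> x \<in> R" using R(2) x by blast
    finally show ?thesis .
  qed
  then have "{x \<in> W. f x \<in> Q} = W \<inter> {x \<in> U. \<phi> x \<in> R}" using W(2) by blast
  then show ?thesis using W(1) chart_preimage_openin[OF U R(1)] by auto
qed

lemma smooth_map_compose:
  assumes N: "smooth_manifold N" and f: "smooth_map_on M N (topspace (mtop M)) f"
    and g: "smooth_map_on N P (topspace (mtop N)) g"
  shows "smooth_map_on M P (topspace (mtop M)) (\<lambda>x. g (f x))"
proof (rule smooth_map_onI)
  interpret N: smooth_manifold N by (rule N)
  show "(\<lambda>x. g (f x)) ` topspace (mtop M) \<subseteq> topspace (mtop P)"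
    using smooth_map_on_image[OF f] smooth_map_on_image[OF g] by auto
  fix p assume p: "p \<in> topspace (mtop M)"
  obtain U \<phi> V \<psi> W where a: "(U, \<phi>) \<in> atlas M" "(V, \<psi>) \<in> atlas N" "openin (mtop M) W" "p \<in> W"
    "W \<subseteq> U" "f ` W \<subseteq> V" "smooth_on (\<phi> ` W) (\<psi> \<circ> f \<circ> inv_into U \<phi>)"
    by (rule smooth_map_topspaceE[OF f p])
  obtain V' \<psi>' X \<xi> W' where b: "(V', \<psi>') \<in> atlas N" "(X, \<xi>) \<in> atlas P" "openin (mtop N) W'" "f p \<in> W'"
    "W' \<subseteq> V'" "g ` W' \<subseteq> X" "smooth_on (\<psi>' ` W') (\<xi> \<circ> g \<circ> inv_into V' \<psi>')"
    by (rule N.smooth_map_topspaceE[OF g smooth_map_on_image[OF f p]])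
  let ?W = "{x \<in> W. f x \<in> W'}"
  have W: "openin (mtop M) ?W"
    by (rule smooth_map_preimage_openin[OF N a(1,2,3,5,6,7) b(3)])
  have s1: "smooth_on (\<phi> ` ?W) (\<psi> \<circ> f \<circ> inv_into U \<phi>)"
    by (rule smooth_on_subset[OF a(7)]) blast
  have s2: "smooth_on (\<psi> ` (V \<inter> W')) (\<psi>' \<circ> inv_into V \<psi>)"
    by (rule smooth_on_subset[OF N.compatible[OF a(2) b(1)]]) (use b(5) in blast)
  have i1: "(\<psi> \<circ> f \<circ> inv_into U \<phi>) ` \<phi> ` ?W \<subseteq> \<psi> ` (V \<inter> W')"
    using a(1,5,6) by (auto simp: subset_iff image_subset_iff)
  have s3: "smooth_on (\<phi> ` ?W) (\<lambda>x. (\<psi>' \<circ> inv_into V \<psi>) ((\<psi> \<circ> f \<circ> inv_into U \<phi>) x))"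
    by (rule smooth_on_compose[OF s1 s2 i1])
  have i2: "(\<lambda>x. (\<psi>' \<circ> inv_into V \<psi>) ((\<psi> \<circ> f \<circ> inv_into U \<phi>) x)) ` \<phi> ` ?W \<subseteq> \<psi>' ` W'"
    using a(1,2,5,6) b(5) by (auto simp: subset_iff image_subset_iff)
  have s4: "smooth_on (\<phi> ` ?W) (\<lambda>x. (\<xi> \<circ> g \<circ> inv_into V' \<psi>') ((\<psi>' \<circ> inv_into V \<psi>) ((\<psi> \<circ> f \<circ> inv_into U \<phi>) x)))"
    by (rule smooth_on_compose[OF s3 b(7) i2])
  have s5: "smooth_on (\<phi> ` ?W) (\<xi> \<circ> (\<lambda>x. g (f x)) \<circ> inv_into U \<phi>)"
    by (rule smooth_on_cong[OF s4]) (use a(1,2,5,6) b(1,5) in \<open>auto simp: subset_iff image_subset_iff\<close>)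
  show "\<exists>U \<phi> V \<psi> W. (U, \<phi>) \<in> atlas M \<and> (V, \<psi>) \<in> atlas P \<and> openin (mtop M) W \<and>
      p \<in> W \<and> W \<subseteq> U \<and> (\<lambda>x. g (f x)) ` W \<subseteq> V \<and> smooth_on (\<phi> ` W) (\<psi> \<circ> (\<lambda>x. g (f x)) \<circ> inv_into U \<phi>)"
    using a b W s5 by (intro exI[of _ U] exI[of _ \<phi>] exI[of _ X] exI[of _ \<xi>] exI[of _ ?W]) auto
qed

end

section \<open>Smoothness of inverse maps\<close>

context smooth_manifold
begin

text \<open>A smooth bijection with injective tangent maps has a smooth inverse. In charts the map is only defined on
  an open part of the model space, a subspace of the ambient Euclidean space. With a projection \<open>P\<close> onto the
  model space, a local extension \<open>F\<close> of the coordinate expression gives \<open>E x = F (P x) + (x - P x)\<close>, whose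
  derivative at the point is invertible on the whole ambient space, and the inverse function theorem applies to \<open>E\<close>. The
  inverse of \<open>E\<close> maps points of the model space back into it. Continuity of the inverse map is not needed.\<close>
lemma smooth_map_inverse:
  assumes f: "smooth_map_on M M (topspace (mtop M)) f"
    and bij: "bij_betw f (topspace (mtop M)) (topspace (mtop M))"
    and inj: "\<And>p v. \<lbrakk>p \<in> topspace (mtop M); v \<in> model M; tangent_map M M f p v = 0\<rbrakk> \<Longrightarrow> v = 0"
  shows "smooth_map_on M M (topspace (mtop M)) (inv_into (topspace (mtop M)) f)"
proof (rule smooth_map_onI)
  let ?X = "topspace (mtop M)"
  let ?h = "inv_into ?X f"
  note M = smooth_manifold_axioms
  show "?h ` ?X \<subseteq> ?X"
    using bij_betw_inv_into[OF bij] by (simp add: bij_betw_def)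
  fix p assume p: "p \<in> ?X"
  define q where "q = ?h p"
  have q: "q \<in> ?X" "f q = p"
    using p bij unfolding q_def by (auto simp: bij_betw_def f_inv_into_f inv_into_into)
  obtain U \<phi> V \<psi> W where a: "(U, \<phi>) \<in> atlas M" "(V, \<psi>) \<in> atlas M" "openin (mtop M) W" "q \<in> W"
    "W \<subseteq> U" "f ` W \<subseteq> V" "smooth_on (\<phi> ` W) (\<psi> \<circ> f \<circ> inv_into U \<phi>)"
    by (rule smooth_map_topspaceE[OF f q(1)])
  obtain Q F where F: "open Q" "\<phi> q \<in> Q" "\<And>k. Ck_on k Q F"
    "\<And>y. y \<in> \<phi> ` W \<Longrightarrow> y \<in> Q \<Longrightarrow> F y = (\<psi> \<circ> f \<circ> inv_into U \<phi>) y"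
    using smooth_onE[OF a(7), of "\<phi> q"] a(4) by blast
  have Fw: "F (\<phi> w) = \<psi> (f w)" if "w \<in> W" "\<phi> w \<in> Q" for w
    using F(4)[of "\<phi> w"] that a(1,5) by auto
  obtain T where T: "open T" "\<phi> ` W = model M \<inter> T"
    using chart_image_openin[OF a(1,3,5)] by blast
  obtain P where P: "linear P" "\<And>x. P x \<in> model M" "\<And>x. x \<in> model M \<Longrightarrow> P x = x"
    using linear_projection_exists[OF subspace_model] by blast
  have blP: "bounded_linear P" using P(1) linear_linear by blast
  have qU: "q \<in> U" and pV: "p \<in> V" using a q by auto
  have \<phi>q: "\<phi> q \<in> model M" using chart_image_subset[OF a(1) qU] .
  define Q' where "Q' = P -` (Q \<inter> T)"
  have Q': "open Q'"
    unfolding Q'_def by (intro open_vimage open_Int F(1) T(1) linear_continuous_on blP)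
  have qQ': "\<phi> q \<in> Q'"
    unfolding Q'_def using P(3)[OF \<phi>q] F(2) T(2) a(4) by auto
  define E where "E = (\<lambda>x. F (P x) + (x - P x))"
  have E: "Ck_on k Q' E" for k
    unfolding E_def
  proof (rule Ck_on_add[OF Q'])
    show "Ck_on k Q' (\<lambda>x. F (P x))"
      by (rule Ck_on_compose[OF Q' F(1,3) Ck_on_bounded_linear[OF Q' blP]]) (auto simp: Q'_def)
    show "Ck_on k Q' (\<lambda>x. x - P x)"
      by (intro Ck_on_bounded_linear[OF Q'] bounded_linear_sub bounded_linear_ident blP)
  qed
  define D where "D = frechet_derivative F (at (\<phi> q))"
  have D: "(F has_derivative D) (at (\<phi> q))"
    unfolding D_def by (rule Ck_on_has_derivative[OF F(3,2)])
  have linD: "linear D" using D by (rule has_derivative_linear)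
  \<comment> \<open>The derivative \<open>D\<close> of \<open>F\<close> acts on the model space as the tangent map of \<open>f\<close> in the charts \<open>\<phi>\<close> and \<open>\<psi>\<close>.\<close>
  have Dline: "\<exists>\<gamma>. \<gamma> 0 = q \<and> chart_velocity U \<phi> \<gamma> 0 v \<and> chart_velocity V \<psi> (\<lambda>s. f (\<gamma> s)) 0 (D v)"
    if v: "v \<in> model M" for v
  proof -
    let ?\<gamma> = "\<lambda>s. inv_into U \<phi> (\<phi> q + s *\<^sub>R v)"
    have 0: "?\<gamma> 0 = q" using a(1) qU by simp
    have cv: "chart_velocity U \<phi> ?\<gamma> 0 v"
      using chart_line_velocity[OF a(1) \<phi>q v, of 0] qU by simp
    then have d: "((\<lambda>s. \<phi> (?\<gamma> s)) has_vector_derivative v) (at 0)"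
      by (simp add: chart_velocity_def)
    have "openin (mtop M) {x \<in> U. \<phi> x \<in> Q}" by (rule chart_preimage_openin[OF a(1) F(1)])
    then have "\<forall>\<^sub>F s in nhds 0. ?\<gamma> s \<in> U \<inter> (W \<inter> {x \<in> U. \<phi> x \<in> Q})"
      using a(3,4) 0 F(2) qU by (intro chart_velocity_eventually[OF a(1) cv]) auto
    then have ev: "\<forall>\<^sub>F s in nhds 0. ?\<gamma> s \<in> W \<and> \<phi> (?\<gamma> s) \<in> Q"
      by eventually_elim blast
    have "(F has_derivative D) (at (\<phi> (?\<gamma> 0)))" using D 0 by simp
    from has_derivative_compose[OF d[unfolded has_vector_derivative_def] this]
    have "((\<lambda>s. F (\<phi> (?\<gamma> s))) has_vector_derivative D v) (at 0)"
      by (simp add: has_vector_derivative_def linear_scale[OF linD])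
    moreover have "\<forall>\<^sub>F s in nhds 0. F (\<phi> (?\<gamma> s)) = \<psi> (f (?\<gamma> s))"
      using ev by eventually_elim (simp add: Fw)
    ultimately have "((\<lambda>s. \<psi> (f (?\<gamma> s))) has_vector_derivative D v) (at 0)"
      by (rule has_vector_derivative_eventually_eq)
    moreover have "\<forall>\<^sub>F s in nhds 0. f (?\<gamma> s) \<in> V"
      using ev by eventually_elim (use a(6) in blast)
    ultimately have "chart_velocity V \<psi> (\<lambda>s. f (?\<gamma> s)) 0 (D v)"
      by (simp add: chart_velocity_def)
    with 0 cv show ?thesis by (intro exI[of _ ?\<gamma>]) simp
  qed
  have D_model: "D v \<in> model M" if "v \<in> model M" for v
    using Dline[OF that] chart_velocity_in_model[OF a(2)] by blast
  have D_zero: "v = 0" if v: "v \<in> model M" "D v = 0" for v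
  proof -
    obtain \<gamma> where \<gamma>: "\<gamma> 0 = q" "chart_velocity U \<phi> \<gamma> 0 v" "chart_velocity V \<psi> (\<lambda>s. f (\<gamma> s)) 0 0"
      using Dline[OF v(1)] v(2) by auto
    obtain L where L: "linear L" "\<And>\<gamma> t v. \<gamma> t = p \<Longrightarrow> chart_velocity V \<psi> \<gamma> t v \<Longrightarrow> has_velocity M \<gamma> t (L v)"
      using chart_velocity_imp_has_velocity[OF a(2) pV] by blast
    have "has_velocity M (\<lambda>s. f (\<gamma> s)) 0 (L 0)"
      by (rule L(2)) (use \<gamma> q in auto)
    then have z: "has_velocity M (\<lambda>s. f (\<gamma> s)) 0 0" using linear_0[OF L(1)] by simp
    obtain w where w: "has_velocity M \<gamma> 0 w"
      using chart_velocity_imp_has_velocity[OF a(1) qU] \<gamma>(1,2) by metis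
    have g0: "\<gamma> 0 \<in> ?X" using \<gamma>(1) q(1) by simp
    have "tangent_map M M f (\<gamma> 0) w = 0"
      using has_velocity_unique[OF has_velocity_tangent_map[OF M f g0 w] z] .
    then have "w = 0" using inj g0 has_velocity_in_model[of \<gamma> 0, OF g0 w] by blast
    obtain L' where L': "linear L'" "\<And>\<gamma> t v. \<gamma> t = q \<Longrightarrow> has_velocity M \<gamma> t v \<Longrightarrow> chart_velocity U \<phi> \<gamma> t (L' v)"
      using has_velocity_imp_chart_velocity[OF a(1) qU] by blast
    have "chart_velocity U \<phi> \<gamma> 0 (L' 0)"
      by (rule L'(2)) (use \<gamma> w \<open>w = 0\<close> in auto)
    then show "v = 0" using chart_velocity_unique[OF \<gamma>(2)] linear_0[OF L'(1)] by simp
  qed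
  have E': "(E has_derivative (\<lambda>h. D (P h) + (h - P h))) (at (\<phi> q))"
    unfolding E_def
  proof (intro has_derivative_add has_derivative_diff has_derivative_ident bounded_linear_imp_has_derivative blP)
    have "(F has_derivative D) (at (P (\<phi> q)))" using D P(3)[OF \<phi>q] by simp
    from has_derivative_compose[OF bounded_linear_imp_has_derivative[OF blP] this]
    show "((\<lambda>x. F (P x)) has_derivative (\<lambda>h. D (P h))) (at (\<phi> q))" .
  qed
  have "inj (\<lambda>h. D (P h) + (h - P h))"
  proof -
    have "h = 0" if h: "D (P h) + (h - P h) = 0" for h
    proof -
      have "h = P h - D (P h)" using h by (simp add: algebra_simps add_eq_0_iff)
      then have "h \<in> model M" using subspace_diff[OF subspace_model P(2) D_model[OF P(2)]] by metis
      then show "h = 0" using h P(3) D_zero by simp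
    qed
    then show ?thesis
      using linear_injective_0[OF has_derivative_linear[OF E']] by blast
  qed
  then have "inj (frechet_derivative E (at (\<phi> q)))"
    using frechet_derivative_at[OF E'] by simp
  then obtain U' V' g where g: "open U'" "U' \<subseteq> Q'" "\<phi> q \<in> U'" "open V'" "E (\<phi> q) \<in> V'" "homeomorphism U' V' E g"
    "\<And>k. Ck_on k V' g"
    using smooth_inverse_function[OF Q' qQ' E] by blast
  have "E (\<phi> q) = \<psi> p"
    unfolding E_def using P(3)[OF \<phi>q] Fw[OF a(4) F(2)] q by simp
  then have pV': "\<psi> p \<in> V'" using g(5) by simp
  define W' where "W' = {x \<in> V. \<psi> x \<in> V'}"
  have W': "openin (mtop M) W'"
    unfolding W'_def by (rule chart_preimage_openin[OF a(2) g(4)])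
  have key: "?h p' \<in> U \<and> g (\<psi> p') = \<phi> (?h p')" if p': "p' \<in> W'" for p'
  proof -
    have V: "p' \<in> V" "\<psi> p' \<in> V'" using p' by (auto simp: W'_def)
    define x where "x = g (\<psi> p')"
    have x: "x \<in> U'" "E x = \<psi> p'"
      using g(6) V(2) unfolding x_def homeomorphism_def by auto
    have Px: "P x \<in> \<phi> ` W" "P x \<in> Q"
      using x(1) g(2) P(2) T(2) by (auto simp: Q'_def)
    then obtain w where w: "w \<in> W" "P x = \<phi> w" by blast
    have FP: "F (P x) = \<psi> (f w)" using Fw w Px(2) by simp
    have fw: "f w \<in> V" using a(6) w(1) by blast
    have "x = \<psi> p' - \<psi> (f w) + P x"
      using x(2) FP unfolding E_def by (simp add: algebra_simps)
    then have "x \<in> model M"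
      using subspace_add[OF subspace_model subspace_diff[OF subspace_model
            chart_image_subset[OF a(2) V(1)] chart_image_subset[OF a(2) fw]] P(2)] by metis
    then have "P x = x" by (rule P(3))
    then have "\<psi> p' = \<psi> (f w)" using x(2) FP unfolding E_def by simp
    then have "f w = p'"
      using chart_inj[OF a(2)] V(1) fw by (simp add: inj_on_def)
    moreover have "w \<in> ?X" using w(1) openin_subset[OF a(3)] by blast
    ultimately have "?h p' = w" using bij by (auto simp: bij_betw_def)
    then show ?thesis using w a(5) \<open>P x = x\<close> by (auto simp: x_def)
  qed
  have "smooth_on (\<psi> ` W') (\<phi> \<circ> ?h \<circ> inv_into V \<psi>)"
  proof (rule smooth_onI)
    fix y assume "y \<in> \<psi> ` W'"
    then have "y \<in> V'" by (auto simp: W'_def)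
    moreover have "\<forall>y\<in>\<psi> ` W' \<inter> V'. g y = (\<phi> \<circ> ?h \<circ> inv_into V \<psi>) y"
      using key a(2) by (auto simp: W'_def)
    ultimately show "\<exists>U F. open U \<and> y \<in> U \<and> (\<forall>k. Ck_on k U F) \<and>
        (\<forall>y\<in>\<psi> ` W' \<inter> U. F y = (\<phi> \<circ> ?h \<circ> inv_into V \<psi>) y)"
      using g(4,7) by blast
  qed
  moreover have "p \<in> W'" "W' \<subseteq> V" using pV pV' by (auto simp: W'_def)
  moreover have "?h ` W' \<subseteq> U" using key by blast
  ultimately show "\<exists>U \<phi> V \<psi> W. (U, \<phi>) \<in> atlas M \<and> (V, \<psi>) \<in> atlas M \<and> openin (mtop M) W \<and>
      p \<in> W \<and> W \<subseteq> U \<and> ?h ` W \<subseteq> V \<and> smooth_on (\<phi> ` W) (\<psi> \<circ> ?h \<circ> inv_into U \<phi>)"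
    using a(1,2) W' by blast
qed

end

section \<open>Multiplication and left translations of a Lie group\<close>

context lie_group
begin

lemmas manifold = smooth_manifold_axioms

lemma smooth_mult_chartE:
  assumes "a \<in> carrier G" "b \<in> carrier G"
  obtains U \<phi> U' \<phi>' V \<psi> A B where "(U, \<phi>) \<in> atlas M" "(U', \<phi>') \<in> atlas M" "(V, \<psi>) \<in> atlas M"
    "openin (mtop M) A" "openin (mtop M) B" "a \<in> A" "b \<in> B" "A \<subseteq> U" "B \<subseteq> U'"
    "\<And>x y. x \<in> A \<Longrightarrow> y \<in> B \<Longrightarrow> x \<otimes> y \<in> V"
    "smooth_on (\<phi> ` A \<times> \<phi>' ` B) (\<lambda>(x, y). \<psi> (inv_into U \<phi> x \<otimes> inv_into U' \<phi>' y))"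
proof -
  have ab: "(a, b) \<in> carrier G \<times> carrier G" using assms by simp
  obtain C \<xi> V \<psi> W where *: "(C, \<xi>) \<in> atlas (prod_manifold M M)" "(V, \<psi>) \<in> atlas M"
    "openin (mtop (prod_manifold M M)) W" "(a, b) \<in> W" "W \<subseteq> C"
    "(\<lambda>(x, y). x \<otimes> y) ` (carrier G \<times> carrier G \<inter> W) \<subseteq> V"
    "smooth_on (\<xi> ` (carrier G \<times> carrier G \<inter> W)) (\<psi> \<circ> (\<lambda>(x, y). x \<otimes> y) \<circ> inv_into C \<xi>)"
    by (rule smooth_map_onE[OF smooth_mult ab])
  obtain U \<phi> U' \<phi>' where U: "(U, \<phi>) \<in> atlas M" "(U', \<phi>') \<in> atlas M" "C = U \<times> U'" "\<xi> = map_prod \<phi> \<phi>'"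
    using *(1) by (auto simp: prod_manifold_def)
  obtain A B where AB: "openin (mtop M) A" "openin (mtop M) B" "a \<in> A" "b \<in> B" "A \<times> B \<subseteq> W"
    using *(3)[unfolded prod_manifold_def, simplified, unfolded openin_prod_topology_alt] *(4) by meson
  have sub: "A \<subseteq> U" "B \<subseteq> U'" using AB(3-5) *(5) U(3) by auto
  have ABc: "A \<times> B \<subseteq> carrier G \<times> carrier G \<inter> W"
    using AB openin_subset carrier_eq by fastforce
  have "\<phi> ` A \<times> \<phi>' ` B = \<xi> ` (A \<times> B)" using U(4) by auto
  then have "\<phi> ` A \<times> \<phi>' ` B \<subseteq> \<xi> ` (carrier G \<times> carrier G \<inter> W)" using ABc by blast
  then have sm: "smooth_on (\<phi> ` A \<times> \<phi>' ` B) (\<psi> \<circ> (\<lambda>(x, y). x \<otimes> y) \<circ> inv_into C \<xi>)"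
    by (rule smooth_on_subset[OF *(7)])
  have inj: "inj_on \<xi> C"
    unfolding U(3,4) using chart_inj[OF U(1)] chart_inj[OF U(2)] by (rule map_prod_inj_on)
  have inv: "inv_into C \<xi> (\<phi> x, \<phi>' y) = (x, y)" if "x \<in> A" "y \<in> B" for x y
  proof -
    have "(x, y) \<in> C" using that sub U(3) by auto
    then show ?thesis using inv_into_f_f[OF inj, of "(x, y)"] U(4) by simp
  qed
  have "smooth_on (\<phi> ` A \<times> \<phi>' ` B) (\<lambda>(x, y). \<psi> (inv_into U \<phi> x \<otimes> inv_into U' \<phi>' y))"
    by (rule smooth_on_cong[OF sm]) (use inv sub U(1,2) in \<open>auto simp: subset_iff\<close>)
  moreover have "x \<otimes> y \<in> V" if "x \<in> A" "y \<in> B" for x y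
    using *(6) ABc that by blast
  ultimately show thesis using that U(1,2) *(2) AB(1-4) sub by blast
qed

text \<open>The velocity of a product of two curves is a function of the velocities of the factors at the given points.
  Linearity of this function is not needed below.\<close>
lemma mult_velocity:
  assumes "a \<in> carrier G" "b \<in> carrier G"
  obtains L where "\<And>c d t v w. \<lbrakk>c t = a; d t = b; has_velocity M c t v; has_velocity M d t w\<rbrakk>
    \<Longrightarrow> has_velocity M (\<lambda>s. c s \<otimes> d s) t (L v w)"
proof -
  obtain U \<phi> U' \<phi>' V \<psi> A B where *: "(U, \<phi>) \<in> atlas M" "(U', \<phi>') \<in> atlas M" "(V, \<psi>) \<in> atlas M"
    "openin (mtop M) A" "openin (mtop M) B" "a \<in> A" "b \<in> B" "A \<subseteq> U" "B \<subseteq> U'"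
    "\<And>x y. x \<in> A \<Longrightarrow> y \<in> B \<Longrightarrow> x \<otimes> y \<in> V"
    "smooth_on (\<phi> ` A \<times> \<phi>' ` B) (\<lambda>(x, y). \<psi> (inv_into U \<phi> x \<otimes> inv_into U' \<phi>' y))"
    using smooth_mult_chartE[OF assms] by blast
  have aU: "a \<in> U" and bU: "b \<in> U'" using * by auto
  obtain L1 where L1: "\<And>\<gamma> t v. \<gamma> t = a \<Longrightarrow> has_velocity M \<gamma> t v \<Longrightarrow> chart_velocity U \<phi> \<gamma> t (L1 v)"
    using has_velocity_imp_chart_velocity[OF *(1) aU] by metis
  obtain L2 where L2: "\<And>\<gamma> t v. \<gamma> t = b \<Longrightarrow> has_velocity M \<gamma> t v \<Longrightarrow> chart_velocity U' \<phi>' \<gamma> t (L2 v)"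
    using has_velocity_imp_chart_velocity[OF *(2) bU] by metis
  have "a \<otimes> b \<in> V" using * by blast
  then obtain L3 where L3: "\<And>\<gamma> t v. \<gamma> t = a \<otimes> b \<Longrightarrow> chart_velocity V \<psi> \<gamma> t v \<Longrightarrow> has_velocity M \<gamma> t (L3 v)"
    using chart_velocity_imp_has_velocity[OF *(3)] by metis
  have pt: "(\<phi> a, \<phi>' b) \<in> \<phi> ` A \<times> \<phi>' ` B" using * by blast
  obtain D where "linear D" and
    D: "\<And>c t v. \<lbrakk>c t = (\<phi> a, \<phi>' b); \<forall>\<^sub>F s in nhds t. c s \<in> \<phi> ` A \<times> \<phi>' ` B; (c has_vector_derivative v) (at t)\<rbrakk>
       \<Longrightarrow> ((\<lambda>s. (\<lambda>(x, y). \<psi> (inv_into U \<phi> x \<otimes> inv_into U' \<phi>' y)) (c s)) has_vector_derivative D v) (at t)"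
    by (rule smooth_on_vector_derivative[OF *(11) pt], erule that, blast)
  have "has_velocity M (\<lambda>s. c s \<otimes> d s) t (L3 (D (L1 v, L2 w)))"
    if c: "c t = a" "has_velocity M c t v" and d: "d t = b" "has_velocity M d t w" for c d t v w
  proof -
    note cv = L1[OF c] and dv = L2[OF d]
    have ev: "\<forall>\<^sub>F s in nhds t. c s \<in> U \<inter> A \<and> d s \<in> U' \<inter> B"
      by (intro eventually_conj chart_velocity_eventually[OF *(1) cv _ *(4)]
          chart_velocity_eventually[OF *(2) dv _ *(5)]) (use c(1) d(1) *(6,7) in simp_all)
    have "((\<lambda>s. (\<phi> (c s), \<phi>' (d s))) has_vector_derivative (L1 v, L2 w)) (at t)"
      using cv dv by (intro has_vector_derivative_Pair) (simp_all add: chart_velocity_def)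
    moreover have "\<forall>\<^sub>F s in nhds t. (\<phi> (c s), \<phi>' (d s)) \<in> \<phi> ` A \<times> \<phi>' ` B"
      using ev by eventually_elim blast
    ultimately have "((\<lambda>s. (\<lambda>(x, y). \<psi> (inv_into U \<phi> x \<otimes> inv_into U' \<phi>' y)) (\<phi> (c s), \<phi>' (d s)))
        has_vector_derivative D (L1 v, L2 w)) (at t)"
      using c(1) d(1) by (intro D) simp_all
    moreover have "\<forall>\<^sub>F s in nhds t. (\<lambda>(x, y). \<psi> (inv_into U \<phi> x \<otimes> inv_into U' \<phi>' y)) (\<phi> (c s), \<phi>' (d s)) = \<psi> (c s \<otimes> d s)"
      using ev by eventually_elim (simp add: *(1,2))
    ultimately have "((\<lambda>s. \<psi> (c s \<otimes> d s)) has_vector_derivative D (L1 v, L2 w)) (at t)"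
      by (rule has_vector_derivative_eventually_eq)
    moreover have "\<forall>\<^sub>F s in nhds t. c s \<otimes> d s \<in> V"
      using ev by eventually_elim (use *(10) in blast)
    ultimately have "chart_velocity V \<psi> (\<lambda>s. c s \<otimes> d s) t (D (L1 v, L2 w))"
      by (simp add: chart_velocity_def)
    then show ?thesis using c(1) d(1) by (intro L3) auto
  qed
  then show thesis using that[of "\<lambda>v w. L3 (D (L1 v, L2 w))"] by blast
qed

lemma smooth_left_mult:
  assumes g: "g \<in> carrier G"
  shows "smooth_map_on M M (topspace (mtop M)) (\<lambda>x. g \<otimes> x)"
proof (rule smooth_map_onI)
  show "(\<lambda>x. g \<otimes> x) ` topspace (mtop M) \<subseteq> topspace (mtop M)"
    using g by (auto simp: carrier_eq[symmetric])
  fix p assume "p \<in> topspace (mtop M)"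
  then have p: "p \<in> carrier G" by (simp add: carrier_eq)
  obtain U \<phi> U' \<phi>' V \<psi> A B where *: "(U, \<phi>) \<in> atlas M" "(U', \<phi>') \<in> atlas M" "(V, \<psi>) \<in> atlas M"
    "openin (mtop M) A" "openin (mtop M) B" "g \<in> A" "p \<in> B" "A \<subseteq> U" "B \<subseteq> U'"
    "\<And>x y. x \<in> A \<Longrightarrow> y \<in> B \<Longrightarrow> x \<otimes> y \<in> V"
    "smooth_on (\<phi> ` A \<times> \<phi>' ` B) (\<lambda>(x, y). \<psi> (inv_into U \<phi> x \<otimes> inv_into U' \<phi>' y))"
    using smooth_mult_chartE[OF g p] by blast
  have "Ck_on k UNIV (\<lambda>y :: 'e. (\<phi> g, 0) + (0, y))" for k
    by (rule Ck_on_add[OF open_UNIV Ck_on_const[OF open_UNIV]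
        Ck_on_bounded_linear[OF open_UNIV bounded_linear_Pair[OF bounded_linear_zero bounded_linear_ident]]])
  then have "smooth_on (\<phi>' ` B) (\<lambda>y. (\<phi> g, y))"
    by (intro smooth_onI exI[of _ UNIV] exI[of _ "\<lambda>y. (\<phi> g, 0) + (0, y)"]) simp
  from smooth_on_compose[OF this *(11)] *(6)
  have sm: "smooth_on (\<phi>' ` B) (\<lambda>y. \<psi> (inv_into U \<phi> (\<phi> g) \<otimes> inv_into U' \<phi>' y))"
    by auto
  have sm': "smooth_on (\<phi>' ` B) (\<psi> \<circ> (\<lambda>x. g \<otimes> x) \<circ> inv_into U' \<phi>')"
    by (rule smooth_on_cong[OF sm]) (use *(1,6,8) in auto)
  have "(\<lambda>x. g \<otimes> x) ` B \<subseteq> V" using *(6,10) by blast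
  with *(2,3,5,7,9) sm' show "\<exists>U \<phi> V \<psi> W. (U, \<phi>) \<in> atlas M \<and> (V, \<psi>) \<in> atlas M \<and> openin (mtop M) W \<and>
      p \<in> W \<and> W \<subseteq> U \<and> (\<lambda>x. g \<otimes> x) ` W \<subseteq> V \<and> smooth_on (\<phi> ` W) (\<psi> \<circ> (\<lambda>x. g \<otimes> x) \<circ> inv_into U \<phi>)"
    by blast
qed

section \<open>The Maurer-Cartan form\<close>

lemma maurer_cartan_in_model:
  assumes "x \<in> carrier G" "v \<in> model M"
  shows "maurer_cartan G M x v \<in> model M"
  unfolding maurer_cartan_def using assms
  by (intro tangent_map_in_model[OF manifold smooth_left_mult]) (simp_all add: carrier_eq[symmetric])

lemma tangent_map_left_mult_compose:
  assumes "g \<in> carrier G" "h \<in> carrier G" "x \<in> carrier G" "v \<in> model M"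
  shows "tangent_map M M (\<lambda>y. g \<otimes> y) (h \<otimes> x) (tangent_map M M (\<lambda>y. h \<otimes> y) x v) =
    tangent_map M M (\<lambda>y. g \<otimes> h \<otimes> y) x v"
proof -
  have x: "x \<in> topspace (mtop M)" using assms by (simp add: carrier_eq)
  have "tangent_map M M (\<lambda>y. g \<otimes> (h \<otimes> y)) x v = tangent_map M M (\<lambda>y. g \<otimes> h \<otimes> y) x v"
    by (rule tangent_map_cong[OF manifold smooth_left_mult x assms(4)])
      (use assms m_assoc in \<open>auto simp: carrier_eq[symmetric]\<close>)
  then show ?thesis
    using tangent_map_compose[OF manifold smooth_left_mult[OF assms(2)] manifold smooth_left_mult[OF assms(1)] x assms(4)]
    by simp
qed

lemma tangent_map_left_mult_one:
  assumes "x \<in> carrier G" "v \<in> model M"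
  shows "tangent_map M M (\<lambda>y. \<one> \<otimes> y) x v = v"
  using tangent_map_cong[OF manifold smooth_map_ident, of x v "\<lambda>y. \<one> \<otimes> y"] tangent_map_ident assms
  by (simp add: carrier_eq[symmetric])

lemma maurer_cartan_one: "v \<in> model M \<Longrightarrow> maurer_cartan G M \<one> v = v"
  unfolding maurer_cartan_def using tangent_map_left_mult_one[of \<one> v] by simp

lemma maurer_cartan_left_invariant:
  assumes "g \<in> carrier G" "x \<in> carrier G" "v \<in> model M"
  shows "maurer_cartan G M (g \<otimes> x) (tangent_map M M (\<lambda>y. g \<otimes> y) x v) = maurer_cartan G M x v"
proof -
  have "inv (g \<otimes> x) \<otimes> g = inv x"
    using assms by (simp add: inv_mult_group m_assoc)
  then show ?thesis
    using tangent_map_left_mult_compose[of "inv (g \<otimes> x)" g x v] assms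
    by (simp add: maurer_cartan_def)
qed

lemma maurer_cartan_inject:
  assumes "x \<in> carrier G" "v \<in> model M" "w \<in> model M" "maurer_cartan G M x v = maurer_cartan G M x w"
  shows "v = w"
proof -
  have "tangent_map M M (\<lambda>y. x \<otimes> y) (inv x \<otimes> x) (maurer_cartan G M x u) = u" if "u \<in> model M" for u
    using tangent_map_left_mult_compose[of x "inv x" x u] tangent_map_left_mult_one[of x u] assms(1) that
    by (simp add: maurer_cartan_def)
  then show ?thesis using assms(2-4) by metis
qed

lemma maurer_cartan_zero: "x \<in> carrier G \<Longrightarrow> maurer_cartan G M x 0 = 0"
  unfolding maurer_cartan_def
  by (rule tangent_map_eq_linear[OF manifold smooth_left_mult, of "inv x" x])
    (auto simp: carrier_eq[symmetric] linear_0 subspace_0[OF subspace_model])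

section \<open>Rigidity of maps with the same pullback of the Maurer-Cartan form\<close>

text \<open>If \<open>a\<close> and \<open>b\<close> have the same logarithmic derivative at \<open>t\<close>, then \<open>a b\<^sup>-\<^sup>1\<close> has velocity zero there. With
  \<open>g = a t (b t)\<^sup>-\<^sup>1\<close> the curves \<open>a\<close> and \<open>g b\<close> have the same value and the same velocity at \<open>t\<close>; hence
  \<open>a b\<^sup>-\<^sup>1\<close> and \<open>g b b\<^sup>-\<^sup>1 = g\<close> have the same velocity there, and the latter is constant.\<close>
lemma quotient_velocity_zero:
  assumes ab: "a t \<in> carrier G" "b t \<in> carrier G" "has_velocity M a t v" "has_velocity M b t w"
    and eq: "maurer_cartan G M (a t) v = maurer_cartan G M (b t) w"
  shows "has_velocity M (\<lambda>s. a s \<otimes> inv (b s)) t 0"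
proof -
  have top: "a t \<in> topspace (mtop M)" "b t \<in> topspace (mtop M)" using ab carrier_eq by auto
  have vw: "v \<in> model M" "w \<in> model M"
    using has_velocity_in_model[OF top(1) ab(3)] has_velocity_in_model[OF top(2) ab(4)] by auto
  have si: "smooth_map_on M M (topspace (mtop M)) (\<lambda>x. inv x)" using smooth_inv carrier_eq by simp
  define u where "u = tangent_map M M (\<lambda>x. inv x) (b t) w"
  have iv: "has_velocity M (\<lambda>s. inv (b s)) t u"
    unfolding u_def by (rule has_velocity_tangent_map[OF manifold si top(2) ab(4)])
  define g where "g = a t \<otimes> inv (b t)"
  have g: "g \<in> carrier G" "g \<otimes> b t = a t" using ab by (auto simp: g_def m_assoc)
  define v' where "v' = tangent_map M M (\<lambda>x. g \<otimes> x) (b t) w"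
  have cv: "has_velocity M (\<lambda>s. g \<otimes> b s) t v'"
    unfolding v'_def by (rule has_velocity_tangent_map[OF manifold smooth_left_mult[OF g(1)] top(2) ab(4)])
  have v'm: "v' \<in> model M"
    unfolding v'_def by (rule tangent_map_in_model[OF manifold smooth_left_mult[OF g(1)] top(2) vw(2)])
  have "maurer_cartan G M (a t) v' = maurer_cartan G M (b t) w"
    using maurer_cartan_left_invariant[OF g(1) ab(2) vw(2)] g(2) by (simp add: v'_def)
  then have "v' = v" using maurer_cartan_inject[OF ab(1) v'm vw(1)] eq by simp
  obtain L where L: "\<And>c d s v w. \<lbrakk>c s = a t; d s = inv (b t); has_velocity M c s v; has_velocity M d s w\<rbrakk>
    \<Longrightarrow> has_velocity M (\<lambda>r. c r \<otimes> d r) s (L v w)"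
    using mult_velocity[of "a t" "inv (b t)"] ab by auto
  have 1: "has_velocity M (\<lambda>s. a s \<otimes> inv (b s)) t (L v u)"
    by (rule L[OF _ _ ab(3) iv]) auto
  have 2: "has_velocity M (\<lambda>s. g \<otimes> b s \<otimes> inv (b s)) t (L v u)"
    using L[of "\<lambda>s. g \<otimes> b s" t, OF g(2) _ cv iv] \<open>v' = v\<close> by simp
  have "\<forall>\<^sub>F s in nhds t. b s \<in> carrier G"
    using has_velocity_eventually[OF top(2) ab(4) openin_topspace top(2)] by (simp add: carrier_eq)
  then have "\<forall>\<^sub>F s in nhds t. g \<otimes> b s \<otimes> inv (b s) = g"
    by eventually_elim (use g(1) in \<open>simp add: m_assoc\<close>)
  from has_velocity_cong[OF 2 this] have "has_velocity M (\<lambda>s. g) t (L v u)" .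
  moreover have "has_velocity M (\<lambda>s. g) t 0"
    using g(1) carrier_eq by (intro has_velocity_const) simp
  ultimately have "L v u = 0" by (rule has_velocity_unique)
  with 1 show ?thesis by simp
qed

lemma quotient_locally_constant:
  assumes f: "smooth_map_on M M (carrier G) f" and f': "smooth_map_on M M (carrier G) f'"
    and eq: "\<And>x v. x \<in> carrier G \<Longrightarrow> v \<in> model M \<Longrightarrow>
      pullback_form M f (maurer_cartan G M) x v = pullback_form M f' (maurer_cartan G M) x v"
    and p: "p \<in> carrier G"
  obtains W where "openin (mtop M) W" "p \<in> W" "\<And>x. x \<in> W \<Longrightarrow> f x \<otimes> inv (f' x) = f p \<otimes> inv (f' p)"
proof -
  note f = f[unfolded carrier_eq] and f' = f'[unfolded carrier_eq]
  have pt: "p \<in> topspace (mtop M)" using p carrier_eq by simp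
  obtain U \<phi> where U: "(U, \<phi>) \<in> atlas M" "p \<in> U"
    using chart_at_atlas[OF pt] by metis
  obtain T where T: "open T" "\<phi> ` U = model M \<inter> T"
    using chart_image_openin[OF U(1) chart_open[OF U(1)]] by blast
  have "\<phi> p \<in> T" using T U by blast
  then obtain r where r: "r > 0" "ball (\<phi> p) r \<subseteq> T" using T(1) openE by blast
  let ?W = "{x \<in> U. \<phi> x \<in> ball (\<phi> p) r}"
  have "f x \<otimes> inv (f' x) = f p \<otimes> inv (f' p)" if x: "x \<in> ?W" for x
  proof -
    have xU: "x \<in> U" and xr: "dist (\<phi> p) (\<phi> x) < r" using x by auto
    define v where "v = \<phi> x - \<phi> p"
    have pm: "\<phi> p \<in> model M" and v: "v \<in> model M"
      using chart_image_subset[OF U] chart_image_subset[OF U(1) xU] subspace_diff[OF subspace_model]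
      by (auto simp: v_def)
    define \<gamma> where "\<gamma> = (\<lambda>s. inv_into U \<phi> (\<phi> p + s *\<^sub>R v))"
    define S where "S = (\<lambda>s. \<phi> p + s *\<^sub>R v) -` ball (\<phi> p) r"
    have S: "open S" unfolding S_def by (intro open_vimage open_ball continuous_intros)
    have "S = (\<lambda>s. s *\<^sub>R v) -` ball 0 r" by (auto simp: S_def dist_norm)
    then have "convex S"
      by (simp add: convex_linear_vimage linear_iff scaleR_left_distrib)
    then have "connected S" by (rule convex_connected)
    have S01: "0 \<in> S" "1 \<in> S" using r(1) xr by (auto simp: S_def v_def dist_commute)
    have in_chart: "\<phi> p + s *\<^sub>R v \<in> \<phi> ` U" if "s \<in> S" for s
      using that r(2) T(2) subspace_add[OF subspace_model pm subspace_scale[OF subspace_model v]]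
      by (auto simp: S_def)
    have \<gamma>U: "\<gamma> s \<in> U" if "s \<in> S" for s
      unfolding \<gamma>_def by (rule inv_into_into[OF in_chart[OF that]])
    have fc: "f y \<in> carrier G" "f' y \<in> carrier G" if "y \<in> U" for y
      using that smooth_map_on_image[OF f] smooth_map_on_image[OF f'] chart_subset[OF U(1)] by (auto simp: carrier_eq)
    have vel: "has_velocity M (\<lambda>s. f (\<gamma> s) \<otimes> inv (f' (\<gamma> s))) s 0" if s: "s \<in> S" for s
    proof -
      have gs: "\<gamma> s \<in> topspace (mtop M)" using \<gamma>U[OF s] chart_subset[OF U(1)] by blast
      have "chart_velocity U \<phi> \<gamma> s v"
        unfolding \<gamma>_def by (rule chart_line_velocity[OF U(1) pm v in_chart[OF s]])
      then obtain w where w: "has_velocity M \<gamma> s w"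
        using chart_velocity_imp_has_velocity[OF U(1) \<gamma>U[OF s]] by metis
      have wm: "w \<in> model M" by (rule has_velocity_in_model[OF gs w])
      show ?thesis
      proof (rule quotient_velocity_zero)
        show "f (\<gamma> s) \<in> carrier G" "f' (\<gamma> s) \<in> carrier G" using fc \<gamma>U[OF s] by auto
        show "has_velocity M (\<lambda>s. f (\<gamma> s)) s (tangent_map M M f (\<gamma> s) w)"
          by (rule has_velocity_tangent_map[OF manifold f gs w])
        show "has_velocity M (\<lambda>s. f' (\<gamma> s)) s (tangent_map M M f' (\<gamma> s) w)"
          by (rule has_velocity_tangent_map[OF manifold f' gs w])
        show "maurer_cartan G M (f (\<gamma> s)) (tangent_map M M f (\<gamma> s) w) =
            maurer_cartan G M (f' (\<gamma> s)) (tangent_map M M f' (\<gamma> s) w)"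
          using eq[of "\<gamma> s" w] gs wm by (simp add: pullback_form_def carrier_eq)
      qed
    qed
    have "f (\<gamma> 1) \<otimes> inv (f' (\<gamma> 1)) = f (\<gamma> 0) \<otimes> inv (f' (\<gamma> 0))"
      by (rule has_velocity_zero_imp_constant[OF S \<open>connected S\<close> S01(2,1) _ vel])
        (use fc \<gamma>U in \<open>auto simp: carrier_eq[symmetric]\<close>)
    moreover have "\<gamma> 1 = x" "\<gamma> 0 = p" using U xU by (auto simp: \<gamma>_def v_def)
    ultimately show ?thesis by simp
  qed
  moreover have "openin (mtop M) ?W" by (rule chart_preimage_openin[OF U(1) open_ball])
  moreover have "p \<in> ?W" using U r(1) by simp
  ultimately show thesis using that by blast
qed

end

context klein_geometry
begin

text \<open>A nonempty set that is open and closed and saturated for \<open>G \<rightarrow> G/H\<close> is everything when \<open>G/H\<close> is connected.\<close>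
lemma right_invariant_clopen_trivial:
  assumes conn: "connected_space (coset_topology G (mtop M) H)"
    and E: "openin (mtop M) E" "openin (mtop M) (carrier G - E)" "\<one> \<in> E"
    and inv: "\<And>x h. x \<in> carrier G \<Longrightarrow> h \<in> H \<Longrightarrow> x \<otimes> h \<in> E \<longleftrightarrow> x \<in> E"
  shows "carrier G \<subseteq> E"
proof -
  let ?q = "\<lambda>x. x <# H"
  have Ec: "E \<subseteq> carrier G" using openin_subset[OF E(1)] carrier_eq by simp
  have coset: "y \<in> E" if "x \<in> E" "y \<in> carrier G" "?q x = ?q y" for x y
  proof -
    have "y \<in> ?q x" using that(3) lcos_self[OF that(2) subgroup_H] by simp
    then obtain h where "h \<in> H" "y = x \<otimes> h" by (auto simp: l_coset_def)
    then show ?thesis using inv that(1) Ec by blast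
  qed
  have pre: "{x \<in> carrier G. ?q x \<in> ?q ` E} = E"
    using coset Ec by (fastforce simp: image_iff)
  have pre': "{x \<in> carrier G. ?q x \<in> ?q ` (carrier G - E)} = carrier G - E"
    using coset by (fastforce simp: image_iff)
  have lc: "?q ` carrier G = lcosets\<^bsub>G\<^esub> H" by (auto simp: LCOSETS_def)
  let ?T = "coset_topology G (mtop M) H"
  have op: "openin ?T (?q ` E)" "openin ?T (?q ` (carrier G - E))"
    unfolding openin_coset_topology[OF carrier_eq] pre pre' using E(1,2) Ec lc by auto
  have "topspace ?T \<subseteq> lcosets\<^bsub>G\<^esub> H"
    using openin_topspace[of ?T] unfolding openin_coset_topology[OF carrier_eq] by blast
  then have cov: "topspace ?T \<subseteq> ?q ` E \<union> ?q ` (carrier G - E)"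
    using lc by blast
  have disj: "?q ` E \<inter> ?q ` (carrier G - E) = {}" using coset by fastforce
  have "?q ` E \<noteq> {}" using E(3) by blast
  then have "?q ` (carrier G - E) = {}"
    using conn op cov disj unfolding connected_space_def by blast
  then show ?thesis by blast
qed

text \<open>The quotient \<open>f (f')\<^sup>-\<^sup>1\<close> is locally constant, and it is constant on the cosets of \<open>H\<close> because \<open>f\<close> and \<open>f'\<close> have
  the same equivariance. Thus connectedness of \<open>G/H\<close> suffices, without any connectedness of \<open>G\<close>.\<close>
theorem pullback_rigidity:
  assumes conn: "connected_space (coset_topology G (mtop M) H)"
    and f: "smooth_map_on M M (carrier G) f" and f': "smooth_map_on M M (carrier G) f'"
    and eq: "\<And>x v. x \<in> carrier G \<Longrightarrow> v \<in> model M \<Longrightarrow>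
      pullback_form M f (maurer_cartan G M) x v = pullback_form M f' (maurer_cartan G M) x v"
    and one: "f \<one> = f' \<one>"
    and j: "\<And>h. h \<in> H \<Longrightarrow> j h \<in> carrier G"
      "\<And>x h. x \<in> carrier G \<Longrightarrow> h \<in> H \<Longrightarrow> f (x \<otimes> h) = f x \<otimes> j h"
      "\<And>x h. x \<in> carrier G \<Longrightarrow> h \<in> H \<Longrightarrow> f' (x \<otimes> h) = f' x \<otimes> j h"
    and x: "x \<in> carrier G"
  shows "f x = f' x"
proof -
  define u where "u = (\<lambda>x. f x \<otimes> inv (f' x))"
  have fc: "f x \<in> carrier G" "f' x \<in> carrier G" if "x \<in> carrier G" for x
    using that smooth_map_on_image[OF f] smooth_map_on_image[OF f'] by (auto simp: carrier_eq)
  have u_iff: "u x = \<one> \<longleftrightarrow> f x = f' x" if "x \<in> carrier G" for x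
    unfolding u_def using fc[OF that] by (metis inv_closed inv_equality inv_inv r_inv)
  have loc: "openin (mtop M) {x \<in> carrier G. u x \<in> Z}" for Z
  proof (subst openin_subopen, rule ballI)
    fix p assume "p \<in> {x \<in> carrier G. u x \<in> Z}"
    then have p: "p \<in> carrier G" "u p \<in> Z" by auto
    obtain W where W: "openin (mtop M) W" "p \<in> W" "\<And>x. x \<in> W \<Longrightarrow> u x = u p"
      unfolding u_def using quotient_locally_constant[OF f f' eq p(1)] by blast
    have "x \<in> {x \<in> carrier G. u x \<in> Z}" if "x \<in> W" for x
      using W(3)[OF that] p(2) openin_subset[OF W(1)] carrier_eq that by auto
    with W(1,2) show "\<exists>T. openin (mtop M) T \<and> p \<in> T \<and> T \<subseteq> {x \<in> carrier G. u x \<in> Z}"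
      by blast
  qed
  have inv_u: "u (x \<otimes> h) = u x" if "x \<in> carrier G" "h \<in> H" for x h
  proof -
    have "j h \<otimes> (inv (j h) \<otimes> inv (f' x)) = inv (f' x)"
      using fc[OF that(1)] j(1)[OF that(2)] m_assoc[of "j h" "inv (j h)" "inv (f' x)"] by simp
    then have "f x \<otimes> j h \<otimes> (inv (j h) \<otimes> inv (f' x)) = f x \<otimes> inv (f' x)"
      using fc[OF that(1)] j(1)[OF that(2)] by (simp add: m_assoc)
    then show ?thesis
      using fc[OF that(1)] j(1)[OF that(2)] j(2,3)[OF that] by (simp add: u_def inv_mult_group)
  qed
  have "carrier G \<subseteq> {x \<in> carrier G. u x = \<one>}"
  proof (rule right_invariant_clopen_trivial[OF conn])
    show "openin (mtop M) {x \<in> carrier G. u x = \<one>}" using loc[of "{\<one>}"] by simp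
    have "carrier G - {x \<in> carrier G. u x = \<one>} = {x \<in> carrier G. u x \<in> - {\<one>}}" by auto
    then show "openin (mtop M) (carrier G - {x \<in> carrier G. u x = \<one>})" using loc by metis
    show "\<one> \<in> {x \<in> carrier G. u x = \<one>}" using u_iff one by simp
    show "x \<otimes> h \<in> {x \<in> carrier G. u x = \<one>} \<longleftrightarrow> x \<in> {x \<in> carrier G. u x = \<one>}"
      if "x \<in> carrier G" "h \<in> H" for x h
      using inv_u[OF that] that subgroup.mem_carrier[OF subgroup_H] by simp
  qed
  then show ?thesis using u_iff x by blast
qed

end

section \<open>Groups of bijections and semidirect products\<close>

lemma BijGroup_mult [simp]:
  "f \<in> Bij S \<Longrightarrow> g \<in> Bij S \<Longrightarrow> f \<otimes>\<^bsub>BijGroup S\<^esub> g = compose S f g"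
  by (simp add: BijGroup_def)

lemma BijGroup_carrier [simp]: "carrier (BijGroup S) = Bij S"
  and BijGroup_one [simp]: "\<one>\<^bsub>BijGroup S\<^esub> = (\<lambda>x\<in>S. x)"
  by (simp_all add: BijGroup_def)

lemma GlD:
  assumes "\<beta> \<in> Gl E"
  shows "\<beta> \<in> Bij E" "0 \<in> E \<Longrightarrow> \<beta> 0 = 0"
proof -
  show "\<beta> \<in> Bij E" using assms by (simp add: Gl_def)
  show "\<beta> 0 = 0" if "0 \<in> E"
  proof -
    have "\<beta> (0 *\<^sub>R 0) = 0 *\<^sub>R \<beta> 0" using assms that unfolding Gl_def by blast
    then show ?thesis by simp
  qed
qed

lemma (in group) left_mult_Bij: "g \<in> carrier G \<Longrightarrow> (\<lambda>x\<in>carrier G. g \<otimes> x) \<in> Bij (carrier G)"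
  unfolding Bij_def
  by (auto intro!: bij_betw_byWitness[where f' = "\<lambda>x. inv g \<otimes> x"] simp: m_assoc[symmetric])

theorem semidirect_product_group:
  assumes "group G" "group K" and \<alpha>: "\<alpha> \<in> hom K (AutoGroup G)"
  shows "group (semidirect_product G K \<alpha>)"
proof -
  interpret G: group G by (rule assms(1))
  interpret K: group K by (rule assms(2))
  have au: "\<alpha> k \<in> auto G" if "k \<in> carrier K" for k
    using \<alpha> that by (auto simp: hom_def AutoGroup_def)
  have cl: "\<alpha> k x \<in> carrier G" if "k \<in> carrier K" "x \<in> carrier G" for k x
    using au[OF that(1)] that(2) by (auto simp: auto_def hom_def)
  have mul: "\<alpha> k (x \<otimes>\<^bsub>G\<^esub> y) = \<alpha> k x \<otimes>\<^bsub>G\<^esub> \<alpha> k y" if "k \<in> carrier K" "x \<in> carrier G" "y \<in> carrier G" for k x y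
    using au[OF that(1)] that(2,3) by (auto simp: auto_def hom_def)
  have act: "\<alpha> (k \<otimes>\<^bsub>K\<^esub> l) x = \<alpha> k (\<alpha> l x)" if "k \<in> carrier K" "l \<in> carrier K" "x \<in> carrier G" for k l x
  proof -
    have "\<alpha> (k \<otimes>\<^bsub>K\<^esub> l) = \<alpha> k \<otimes>\<^bsub>AutoGroup G\<^esub> \<alpha> l" using \<alpha> that by (simp add: hom_mult)
    also have "\<dots> = compose (carrier G) (\<alpha> k) (\<alpha> l)"
      using au that by (simp add: AutoGroup_def auto_def)
    finally show ?thesis using that by (simp add: compose_def)
  qed
  have one: "\<alpha> \<one>\<^bsub>K\<^esub> x = x" if "x \<in> carrier G" for x
  proof -
    have "\<alpha> \<one>\<^bsub>K\<^esub> = \<one>\<^bsub>AutoGroup G\<^esub>"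
      using hom_one[OF \<alpha> assms(2) G.AutoGroup] .
    then show ?thesis using that by (simp add: AutoGroup_def)
  qed
  show ?thesis
  proof (rule groupI)
    fix x assume "x \<in> carrier (semidirect_product G K \<alpha>)"
    then obtain g k where x: "x = (g, k)" "g \<in> carrier G" "k \<in> carrier K"
      by (auto simp: semidirect_product_def)
    let ?k = "inv\<^bsub>K\<^esub> k"
    have "\<alpha> ?k (inv\<^bsub>G\<^esub> g) \<otimes>\<^bsub>G\<^esub> \<alpha> ?k g = \<one>\<^bsub>G\<^esub>"
    proof -
      have "\<alpha> ?k (inv\<^bsub>G\<^esub> g) \<otimes>\<^bsub>G\<^esub> \<alpha> ?k g = \<alpha> ?k \<one>\<^bsub>G\<^esub>"
        using x mul[of ?k "inv\<^bsub>G\<^esub> g" g] by simp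
      also have "\<dots> = \<one>\<^bsub>G\<^esub>"
        using hom_one[of "\<alpha> ?k" G G] au[of ?k] x assms(1) by (simp add: auto_def)
      finally show ?thesis .
    qed
    then show "\<exists>y\<in>carrier (semidirect_product G K \<alpha>). y \<otimes>\<^bsub>semidirect_product G K \<alpha>\<^esub> x = \<one>\<^bsub>semidirect_product G K \<alpha>\<^esub>"
      using x cl by (intro bexI[of _ "(\<alpha> ?k (inv\<^bsub>G\<^esub> g), ?k)"]) (auto simp: semidirect_product_def)
  qed (auto simp: semidirect_product_def cl mul act one G.m_assoc K.m_assoc)
qed

section \<open>Automorphisms of the geometry and automorphisms of the group\<close>

context klein_geometry
begin

lemma lie_algebra_eq [simp]: "lie_algebra G M = model M"
  by (simp add: lie_algebra_def tangent_space_def)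

lemma subset_H: "H \<subseteq> carrier G"
  using subgroup_H subgroup.subset by blast

text \<open>The general facts on smooth and tangent maps, restated for self-maps of the Lie group with \<open>carrier G\<close> in
  place of the underlying topological space.\<close>
lemma smooth_compose:
  assumes "smooth_map_on M M (carrier G) f" "smooth_map_on M M (carrier G) g"
  shows "smooth_map_on M M (carrier G) (\<lambda>x. g (f x))"
  using smooth_map_compose[OF manifold, of f M g] assms by (simp add: carrier_eq)

lemma smooth_cong:
  assumes "smooth_map_on M M (carrier G) f" "\<And>x. x \<in> carrier G \<Longrightarrow> f x = g x"
  shows "smooth_map_on M M (carrier G) g"
  using smooth_map_cong[of M f g] assms by (simp add: carrier_eq)

lemma smooth_closed: "smooth_map_on M M (carrier G) f \<Longrightarrow> x \<in> carrier G \<Longrightarrow> f x \<in> carrier G"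
  by (simp add: smooth_map_on_image carrier_eq)

lemma left_mult_smooth: "g \<in> carrier G \<Longrightarrow> smooth_map_on M M (carrier G) (\<lambda>x. g \<otimes> x)"
  using smooth_left_mult by (simp add: carrier_eq)

lemma tangent_chain:
  assumes "smooth_map_on M M (carrier G) f" "smooth_map_on M M (carrier G) g" "x \<in> carrier G" "v \<in> model M"
  shows "tangent_map M M (\<lambda>x. g (f x)) x v = tangent_map M M g (f x) (tangent_map M M f x v)"
  using tangent_map_compose[OF manifold, of f M g] manifold assms by (simp add: carrier_eq)

lemma tangent_cong:
  assumes "smooth_map_on M M (carrier G) f" "x \<in> carrier G" "v \<in> model M"
    "\<And>x. x \<in> carrier G \<Longrightarrow> g x = f x"
  shows "tangent_map M M g x v = tangent_map M M f x v"
  using tangent_map_cong[OF manifold, of f x v g] assms by (simp add: carrier_eq)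

lemma tangent_in_model:
  assumes "smooth_map_on M M (carrier G) f" "x \<in> carrier G" "v \<in> model M"
  shows "tangent_map M M f x v \<in> model M"
  using tangent_map_in_model[OF manifold, of f x v] assms by (simp add: carrier_eq)

lemma pullback_form_cong:
  assumes "smooth_map_on M M (carrier G) f" "x \<in> carrier G" "v \<in> model M"
    "\<And>x. x \<in> carrier G \<Longrightarrow> g x = f x"
  shows "pullback_form M g \<omega> x v = pullback_form M f \<omega> x v"
  unfolding pullback_form_def using tangent_cong[OF assms] assms(2,4) by simp

lemma pullback_left_mult:
  assumes "smooth_map_on M M (carrier G) f" "g \<in> carrier G" "x \<in> carrier G" "v \<in> model M"
  shows "pullback_form M (\<lambda>x. g \<otimes> f x) (maurer_cartan G M) x v = pullback_form M f (maurer_cartan G M) x v"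
  unfolding pullback_form_def
    tangent_chain[OF assms(1) left_mult_smooth[OF assms(2)] assms(3,4)]
  by (rule maurer_cartan_left_invariant[OF assms(2) smooth_closed[OF assms(1,3)] tangent_in_model[OF assms(1,3,4)]])

text \<open>For a homomorphism \<open>\<sigma>\<close> the pullback of the Maurer-Cartan form is its composition with \<open>d\<sigma>\<close> at the unit.\<close>
lemma pullback_homomorphism:
  assumes \<sigma>: "smooth_map_on M M (carrier G) \<sigma>" "\<sigma> \<in> hom G G" and x: "x \<in> carrier G" "v \<in> model M"
  shows "pullback_form M \<sigma> (maurer_cartan G M) x v = tangent_map M M \<sigma> \<one> (maurer_cartan G M x v)"
proof -
  have \<sigma>x: "\<sigma> x \<in> carrier G" by (rule smooth_closed[OF \<sigma>(1) x(1)])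
  have eq: "inv (\<sigma> x) \<otimes> \<sigma> y = \<sigma> (inv x \<otimes> y)" if "y \<in> carrier G" for y
  proof -
    interpret group_hom G G \<sigma> using \<sigma>(2) by unfold_locales
    show ?thesis using x(1) that by simp
  qed
  have sm: "smooth_map_on M M (carrier G) (\<lambda>y. \<sigma> (inv x \<otimes> y))"
    by (rule smooth_compose[OF left_mult_smooth \<sigma>(1)]) (use x in simp)
  have "pullback_form M \<sigma> (maurer_cartan G M) x v = tangent_map M M (\<lambda>y. inv (\<sigma> x) \<otimes> \<sigma> y) x v"
    using tangent_chain[OF \<sigma>(1) left_mult_smooth x, of "inv (\<sigma> x)"] \<sigma>x
    by (simp add: pullback_form_def maurer_cartan_def)
  also have "\<dots> = tangent_map M M (\<lambda>y. \<sigma> (inv x \<otimes> y)) x v"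
    by (rule tangent_cong[OF sm x eq])
  also have "\<dots> = tangent_map M M \<sigma> \<one> (maurer_cartan G M x v)"
    using tangent_chain[OF left_mult_smooth \<sigma>(1) x, of "inv x"] x(1) by (simp add: maurer_cartan_def)
  finally show ?thesis .
qed

lemma Lie_Aut_carrier_iff:
  "\<sigma> \<in> Lie_Aut G M (carrier G) \<longleftrightarrow> \<sigma> \<in> hom G G \<and> \<sigma> \<in> Bij (carrier G) \<and>
     smooth_map_on M M (carrier G) \<sigma> \<and> smooth_map_on M M (carrier G) (inv_into (carrier G) \<sigma>)"
  by (auto simp: Lie_Aut_def auto_def)

lemma induces_pairD:
  assumes "induces_pair G M H \<sigma> k"
  shows "\<sigma> \<in> hom G G" "\<sigma> \<in> Bij (carrier G)" "smooth_map_on M M (carrier G) \<sigma>"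
    "smooth_map_on M M (carrier G) (inv_into (carrier G) \<sigma>)" "\<sigma> ` H \<subseteq> H"
    "k = (restricted_differential G M \<sigma>, restrict \<sigma> H)"
  using assms by (auto simp: induces_pair_def Lie_Aut_carrier_iff)

lemma hom_mult_one:
  "\<sigma> \<in> hom G G \<Longrightarrow> \<sigma> \<one> = \<one>"
  by (rule hom_one) (simp_all add: group_axioms)

lemma induces_pair_unique:
  assumes conn: "connected_space (coset_topology G (mtop M) H)"
    and "induces_pair G M H \<sigma> k" "induces_pair G M H \<sigma>' k"
  shows "\<sigma> = \<sigma>'"
proof (rule extensionalityI)
  note s = induces_pairD[OF assms(2)] and s' = induces_pairD[OF assms(3)]
  show "\<sigma> \<in> extensional (carrier G)" "\<sigma>' \<in> extensional (carrier G)"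
    using s s' Bij_imp_extensional by auto
  have j: "\<sigma> h = \<sigma>' h" if "h \<in> H" for h
    using s(6) s'(6) that by (metis Pair_inject restrict_apply')
  have d: "tangent_map M M \<sigma> \<one> v = tangent_map M M \<sigma>' \<one> v" if "v \<in> model M" for v
    using s(6) s'(6) that unfolding restricted_differential_def lie_algebra_eq
    by (metis Pair_inject restrict_apply')
  fix x assume x: "x \<in> carrier G"
  show "\<sigma> x = \<sigma>' x"
  proof (rule pullback_rigidity[OF conn s(3) s'(3), where j = \<sigma>])
    show "pullback_form M \<sigma> (maurer_cartan G M) x v = pullback_form M \<sigma>' (maurer_cartan G M) x v"
      if "x \<in> carrier G" "v \<in> model M" for x v
      using that pullback_homomorphism[OF s(3,1)] pullback_homomorphism[OF s'(3,1)] d maurer_cartan_in_model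
      by simp
    show "\<sigma> (x \<otimes> h) = \<sigma> x \<otimes> \<sigma> h" "\<sigma>' (x \<otimes> h) = \<sigma>' x \<otimes> \<sigma> h" if "x \<in> carrier G" "h \<in> H" for x h
      using that subset_H s(1) s'(1) j by (auto simp: hom_mult)
    show "\<sigma> \<one> = \<sigma>' \<one>" using hom_mult_one[OF s(1)] hom_mult_one[OF s'(1)] by simp
  qed (use s(5) subset_H x in auto)
qed

lemma pair_action_eq:
  assumes "connected_space (coset_topology G (mtop M) H)" "induces_pair G M H \<sigma> k"
  shows "pair_action G M H k = \<sigma>"
  unfolding pair_action_def using assms induces_pair_unique by (intro the_equality) blast+

lemma induces_pair_automorphism:
  assumes \<sigma>: "induces_pair G M H \<sigma> (\<beta>, j)" and g: "g \<in> carrier G"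
  defines "\<Phi> \<equiv> \<lambda>x\<in>carrier G. g \<otimes> \<sigma> x"
  shows "\<Phi> \<in> Bij (carrier G)" "bundle_morphism G M H j \<Phi>"
    "\<And>x v. x \<in> carrier G \<Longrightarrow> v \<in> model M \<Longrightarrow>
      pullback_form M \<Phi> (maurer_cartan G M) x v = \<beta> (maurer_cartan G M x v)"
proof -
  note s = induces_pairD[OF \<sigma>]
  have \<sigma>c: "\<sigma> x \<in> carrier G" if "x \<in> carrier G" for x using smooth_closed[OF s(3) that] .
  have "\<Phi> = compose (carrier G) (\<lambda>x\<in>carrier G. g \<otimes> x) \<sigma>"
    using \<sigma>c by (auto simp: \<Phi>_def compose_def fun_eq_iff)
  then show "\<Phi> \<in> Bij (carrier G)" using compose_Bij[OF left_mult_Bij[OF g] s(2)] by simp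
  have sm: "smooth_map_on M M (carrier G) (\<lambda>x. g \<otimes> \<sigma> x)"
    by (rule smooth_compose[OF s(3) left_mult_smooth[OF g]])
  then have "smooth_map_on M M (carrier G) \<Phi>" by (rule smooth_cong) (simp add: \<Phi>_def)
  moreover have "\<Phi> (x \<otimes> h) = \<Phi> x \<otimes> j h" if "x \<in> carrier G" "h \<in> H" for x h
  proof -
    have h: "h \<in> carrier G" using that subset_H by blast
    have "j h = \<sigma> h" using s(6) that by simp
    then show ?thesis using h that g s(1) \<sigma>c by (simp add: \<Phi>_def hom_mult m_assoc)
  qed
  ultimately show "bundle_morphism G M H j \<Phi>" by (simp add: bundle_morphism_def)
  fix x v assume x: "x \<in> carrier G" "v \<in> model M"
  have "pullback_form M \<Phi> (maurer_cartan G M) x v = pullback_form M (\<lambda>x. g \<otimes> \<sigma> x) (maurer_cartan G M) x v"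
    by (rule pullback_form_cong[OF sm x]) (simp add: \<Phi>_def)
  also have "\<dots> = tangent_map M M \<sigma> \<one> (maurer_cartan G M x v)"
    using pullback_left_mult[OF s(3) g x] pullback_homomorphism[OF s(3,1) x] by simp
  also have "\<dots> = \<beta> (maurer_cartan G M x v)"
    using s(6) maurer_cartan_in_model[OF x] by (simp add: restricted_differential_def)
  finally show "pullback_form M \<Phi> (maurer_cartan G M) x v = \<beta> (maurer_cartan G M x v)" .
qed

text \<open>Every automorphism \<open>\<Phi>\<close> is a left translation after a group automorphism \<open>\<sigma> = \<Phi>(1)\<^sup>-\<^sup>1 \<Phi>\<close>. That \<open>\<sigma>\<close> is a
  homomorphism is rigidity applied to \<open>x \<mapsto> \<sigma>(g x)\<close> and \<open>x \<mapsto> \<sigma>(g) \<sigma>(x)\<close>, both of which pull the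
  Maurer-Cartan form \<open>\<omega>\<close> back to \<open>\<beta> \<circ> \<omega>\<close>; its inverse is smooth because \<open>\<beta>\<close> is injective.\<close>
lemma automorphism_induces_pair:
  assumes conn: "connected_space (coset_topology G (mtop M) H)"
    and \<beta>: "\<beta> \<in> Gl (model M)" and j: "j \<in> Bij H"
    and \<Phi>: "\<Phi> \<in> Bij (carrier G)" "bundle_morphism G M H j \<Phi>"
    and pb: "\<And>x v. x \<in> carrier G \<Longrightarrow> v \<in> model M \<Longrightarrow>
      pullback_form M \<Phi> (maurer_cartan G M) x v = \<beta> (maurer_cartan G M x v)"
  obtains \<sigma> where "induces_pair G M H \<sigma> (\<beta>, j)" "\<Phi> = (\<lambda>x\<in>carrier G. \<Phi> \<one> \<otimes> \<sigma> x)"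
proof -
  have sm\<Phi>: "smooth_map_on M M (carrier G) \<Phi>"
    and \<Phi>mult: "\<And>x h. x \<in> carrier G \<Longrightarrow> h \<in> H \<Longrightarrow> \<Phi> (x \<otimes> h) = \<Phi> x \<otimes> j h"
    using \<Phi>(2) by (auto simp: bundle_morphism_def)
  have \<Phi>c: "\<Phi> x \<in> carrier G" if "x \<in> carrier G" for x using smooth_closed[OF sm\<Phi> that] .
  have jH: "j h \<in> H" if "h \<in> H" for h using Bij_imp_funcset[OF j] that by blast
  have jc: "j h \<in> carrier G" if "h \<in> H" for h using jH[OF that] subset_H by blast
  define a where "a = inv (\<Phi> \<one>)"
  have a: "a \<in> carrier G" using \<Phi>c by (simp add: a_def)
  define \<sigma> where "\<sigma> = (\<lambda>x\<in>carrier G. a \<otimes> \<Phi> x)"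
  have \<sigma>c: "\<sigma> x \<in> carrier G" if "x \<in> carrier G" for x using that a \<Phi>c by (simp add: \<sigma>_def)
  have sm0: "smooth_map_on M M (carrier G) (\<lambda>x. a \<otimes> \<Phi> x)"
    by (rule smooth_compose[OF sm\<Phi> left_mult_smooth[OF a]])
  then have sm: "smooth_map_on M M (carrier G) \<sigma>" by (rule smooth_cong) (simp add: \<sigma>_def)
  have pb\<sigma>: "pullback_form M \<sigma> (maurer_cartan G M) x v = \<beta> (maurer_cartan G M x v)"
    if x: "x \<in> carrier G" "v \<in> model M" for x v
  proof -
    have "pullback_form M \<sigma> (maurer_cartan G M) x v = pullback_form M (\<lambda>x. a \<otimes> \<Phi> x) (maurer_cartan G M) x v"
      by (rule pullback_form_cong[OF sm0 x]) (simp add: \<sigma>_def)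
    then show ?thesis using pullback_left_mult[OF sm\<Phi> a x] pb[OF x] by simp
  qed
  have \<sigma>1: "\<sigma> \<one> = \<one>" using \<Phi>c by (simp add: \<sigma>_def a_def)
  have \<sigma>mult: "\<sigma> (x \<otimes> h) = \<sigma> x \<otimes> j h" if "x \<in> carrier G" "h \<in> H" for x h
    using that \<Phi>mult[OF that] subset_H a \<Phi>c jc by (auto simp: \<sigma>_def m_assoc subset_iff)
  have \<sigma>j: "\<sigma> h = j h" if "h \<in> H" for h
    using \<sigma>mult[of \<one> h] \<sigma>1 that subset_H jc by auto
  have hom: "\<sigma> (g \<otimes> x) = \<sigma> g \<otimes> \<sigma> x" if g: "g \<in> carrier G" and x: "x \<in> carrier G" for g x
  proof (rule pullback_rigidity[OF conn, where j = j and f = "\<lambda>x. \<sigma> (g \<otimes> x)" and f' = "\<lambda>x. \<sigma> g \<otimes> \<sigma> x"])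
    show "smooth_map_on M M (carrier G) (\<lambda>x. \<sigma> (g \<otimes> x))"
      by (rule smooth_compose[OF left_mult_smooth[OF g] sm])
    show "smooth_map_on M M (carrier G) (\<lambda>x. \<sigma> g \<otimes> \<sigma> x)"
      by (rule smooth_compose[OF sm left_mult_smooth[OF \<sigma>c[OF g]]])
    show "pullback_form M (\<lambda>x. \<sigma> (g \<otimes> x)) (maurer_cartan G M) x v =
        pullback_form M (\<lambda>x. \<sigma> g \<otimes> \<sigma> x) (maurer_cartan G M) x v"
      if x: "x \<in> carrier G" "v \<in> model M" for x v
    proof -
      let ?w = "tangent_map M M (\<lambda>x. g \<otimes> x) x v"
      have w: "?w \<in> model M" by (rule tangent_in_model[OF left_mult_smooth[OF g] x])
      have "pullback_form M (\<lambda>x. \<sigma> (g \<otimes> x)) (maurer_cartan G M) x v =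
          pullback_form M \<sigma> (maurer_cartan G M) (g \<otimes> x) ?w"
        by (simp add: pullback_form_def tangent_chain[OF left_mult_smooth[OF g] sm x])
      also have "\<dots> = \<beta> (maurer_cartan G M x v)"
        using pb\<sigma>[OF _ w, of "g \<otimes> x"] g x maurer_cartan_left_invariant[OF g x] by simp
      finally show ?thesis using pullback_left_mult[OF sm \<sigma>c[OF g] x] pb\<sigma>[OF x] by simp
    qed
    show "\<sigma> (g \<otimes> \<one>) = \<sigma> g \<otimes> \<sigma> \<one>" using g \<sigma>c \<sigma>1 by simp
    show "\<sigma> (g \<otimes> (x \<otimes> h)) = \<sigma> (g \<otimes> x) \<otimes> j h" if "x \<in> carrier G" "h \<in> H" for x h
      using \<sigma>mult[of "g \<otimes> x" h] that g subset_H by (auto simp: m_assoc subset_iff)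
    show "\<sigma> g \<otimes> \<sigma> (x \<otimes> h) = \<sigma> g \<otimes> \<sigma> x \<otimes> j h" if "x \<in> carrier G" "h \<in> H" for x h
      using \<sigma>mult[OF that] that g \<sigma>c jc by (simp add: m_assoc)
  qed (use jc x in auto)
  have "\<sigma> = compose (carrier G) (\<lambda>x\<in>carrier G. a \<otimes> x) \<Phi>"
    using \<Phi>c by (auto simp: \<sigma>_def compose_def fun_eq_iff)
  then have bij: "\<sigma> \<in> Bij (carrier G)" using compose_Bij[OF left_mult_Bij[OF a] \<Phi>(1)] by simp
  have zero: "0 \<in> model M" by (rule subspace_0[OF subspace_model])
  have "smooth_map_on M M (topspace (mtop M)) (inv_into (topspace (mtop M)) \<sigma>)"
  proof (rule smooth_map_inverse)
    show "smooth_map_on M M (topspace (mtop M)) \<sigma>" using sm by (simp add: carrier_eq)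
    show "bij_betw \<sigma> (topspace (mtop M)) (topspace (mtop M))"
      using bij by (simp add: Bij_def carrier_eq)
    fix p v assume p: "p \<in> topspace (mtop M)" and v: "v \<in> model M" "tangent_map M M \<sigma> p v = 0"
    then have pc: "p \<in> carrier G" by (simp add: carrier_eq)
    have "\<beta> (maurer_cartan G M p v) = \<beta> 0"
      using pb\<sigma>[OF pc v(1)] v(2) maurer_cartan_zero[OF \<sigma>c[OF pc]] GlD(2)[OF \<beta> zero]
      by (simp add: pullback_form_def)
    moreover have "inj_on \<beta> (model M)" using GlD(1)[OF \<beta>] by (simp add: Bij_def bij_betw_def)
    ultimately have "maurer_cartan G M p v = 0"
      using maurer_cartan_in_model[OF pc v(1)] zero by (simp add: inj_on_def)
    then show "v = 0"
      using maurer_cartan_inject[OF pc v(1) zero] maurer_cartan_zero[OF pc] by simp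
  qed
  then have sminv: "smooth_map_on M M (carrier G) (inv_into (carrier G) \<sigma>)" by (simp add: carrier_eq)
  have "\<sigma> \<in> Lie_Aut G M (carrier G)"
    using hom \<sigma>c bij sm sminv by (auto simp: Lie_Aut_carrier_iff hom_def)
  moreover have "\<sigma> ` H \<subseteq> H" using \<sigma>j jH by auto
  moreover have "j = restrict \<sigma> H"
    using Bij_imp_extensional[OF j] \<sigma>j by (intro extensionalityI[of _ H]) auto
  moreover have "\<beta> = restricted_differential G M \<sigma>"
  proof (rule extensionalityI[of _ "model M"])
    show "\<beta> \<in> extensional (model M)" by (rule Bij_imp_extensional[OF GlD(1)[OF \<beta>]])
    show "restricted_differential G M \<sigma> \<in> extensional (model M)"
      by (simp add: restricted_differential_def)
    fix v assume v: "v \<in> model M"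
    show "\<beta> v = restricted_differential G M \<sigma> v"
      using pb\<sigma>[OF one_closed v] maurer_cartan_one v tangent_in_model[OF sm one_closed v]
      by (simp add: pullback_form_def \<sigma>1 restricted_differential_def)
  qed
  ultimately have "induces_pair G M H \<sigma> (\<beta>, j)" by (simp add: induces_pair_def)
  moreover have "\<Phi> = (\<lambda>x\<in>carrier G. \<Phi> \<one> \<otimes> \<sigma> x)"
    using Bij_imp_extensional[OF \<Phi>(1)] \<Phi>c
    by (intro extensionalityI[of _ "carrier G"]) (auto simp: \<sigma>_def a_def m_assoc[symmetric])
  ultimately show thesis by (rule that)
qed

section \<open>Pairs induced by automorphisms\<close>

lemma induces_pair_compose:
  assumes "induces_pair G M H \<sigma> k" "induces_pair G M H \<sigma>' k'"
    and k: "k \<in> carrier (pair_group G M H)" "k' \<in> carrier (pair_group G M H)"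
  shows "induces_pair G M H (compose (carrier G) \<sigma> \<sigma>') (k \<otimes>\<^bsub>pair_group G M H\<^esub> k')"
proof -
  note s = induces_pairD[OF assms(1)] and s' = induces_pairD[OF assms(2)]
  let ?\<tau> = "compose (carrier G) \<sigma> \<sigma>'"
  let ?i = "\<lambda>\<sigma>. inv_into (carrier G) \<sigma>"
  have c: "\<sigma> x \<in> carrier G" "\<sigma>' x \<in> carrier G" if "x \<in> carrier G" for x
    using smooth_closed[OF s(3) that] smooth_closed[OF s'(3) that] by auto
  have hom: "?\<tau> \<in> hom G G" using s(1) s'(1) by (simp add: hom_compose)
  have bij: "?\<tau> \<in> Bij (carrier G)" by (rule compose_Bij[OF s(2) s'(2)])
  have sm: "smooth_map_on M M (carrier G) ?\<tau>"
    by (rule smooth_cong[OF smooth_compose[OF s'(3) s(3)]]) (simp add: compose_def)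
  have "?i \<sigma>' (?i \<sigma> x) = ?i ?\<tau> x" if "x \<in> carrier G" for x
  proof -
    have y: "?i \<sigma> x \<in> carrier G" "\<sigma> (?i \<sigma> x) = x"
      using s(2) that by (auto simp: Bij_def bij_betw_def f_inv_into_f inv_into_into)
    have z: "?i \<sigma>' (?i \<sigma> x) \<in> carrier G" "\<sigma>' (?i \<sigma>' (?i \<sigma> x)) = ?i \<sigma> x"
      using s'(2) y(1) by (auto simp: Bij_def bij_betw_def f_inv_into_f inv_into_into)
    have "inj_on ?\<tau> (carrier G)" using bij by (simp add: Bij_def bij_betw_def)
    then show ?thesis
      using inv_into_f_eq[of ?\<tau> "carrier G" "?i \<sigma>' (?i \<sigma> x)" x] y z by (simp add: compose_def)
  qed
  then have sminv: "smooth_map_on M M (carrier G) (?i ?\<tau>)"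
    by (rule smooth_cong[OF smooth_compose[OF s(4) s'(4)]])
  have H: "?\<tau> ` H \<subseteq> H" using s(5) s'(5) subset_H by (auto simp: compose_def)
  have "restricted_differential G M ?\<tau> =
      compose (model M) (restricted_differential G M \<sigma>) (restricted_differential G M \<sigma>')"
  proof (rule extensionalityI[of _ "model M"])
    fix v assume v: "v \<in> model M"
    have "tangent_map M M ?\<tau> \<one> v = tangent_map M M (\<lambda>x. \<sigma> (\<sigma>' x)) \<one> v"
      by (rule tangent_cong[OF smooth_compose[OF s'(3) s(3)] one_closed v]) (simp add: compose_def)
    also have "\<dots> = tangent_map M M \<sigma> \<one> (tangent_map M M \<sigma>' \<one> v)"
      using tangent_chain[OF s'(3) s(3) one_closed v] hom_mult_one[OF s'(1)] by simp
    finally show "restricted_differential G M ?\<tau> v =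
      compose (model M) (restricted_differential G M \<sigma>) (restricted_differential G M \<sigma>') v"
      using v tangent_in_model[OF s'(3) one_closed v] by (simp add: restricted_differential_def compose_def)
  qed (simp_all add: restricted_differential_def)
  moreover have "restrict ?\<tau> H = compose H (restrict \<sigma> H) (restrict \<sigma>' H)"
    using s'(5) subset_H by (auto simp: compose_def fun_eq_iff)
  ultimately have "k \<otimes>\<^bsub>pair_group G M H\<^esub> k' = (restricted_differential G M ?\<tau>, restrict ?\<tau> H)"
    using k unfolding s(6) s'(6) by simp
  then show ?thesis
    using hom bij sm sminv H by (simp add: induces_pair_def Lie_Aut_carrier_iff)
qed

lemma induces_pair_one: "induces_pair G M H (\<lambda>x\<in>carrier G. x) \<one>\<^bsub>pair_group G M H\<^esub>"
proof -
  let ?i = "\<lambda>x\<in>carrier G. x"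
  have sm: "smooth_map_on M M (carrier G) (\<lambda>x. x)" using smooth_map_ident by (simp add: carrier_eq)
  have 1: "smooth_map_on M M (carrier G) ?i" by (rule smooth_cong[OF sm]) simp
  have "x = inv_into (carrier G) ?i x" if "x \<in> carrier G" for x
    using inv_into_f_f[of ?i "carrier G" x] that by (simp add: inj_on_def)
  then have 2: "smooth_map_on M M (carrier G) (inv_into (carrier G) ?i)" by (rule smooth_cong[OF sm])
  have "tangent_map M M ?i \<one> v = v" if "v \<in> model M" for v
    using tangent_cong[OF sm one_closed that, of ?i] tangent_map_ident[of \<one> v] that
    by (simp add: carrier_eq[symmetric])
  then have "restricted_differential G M ?i = (\<lambda>v\<in>model M. v)"
    by (auto simp: restricted_differential_def fun_eq_iff)
  moreover have "restrict ?i H = (\<lambda>x\<in>H. x)" using subset_H by (auto simp: fun_eq_iff)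
  ultimately show ?thesis
    using 1 2 id_in_auto subset_H
    by (auto simp: induces_pair_def Lie_Aut_carrier_iff auto_def)
qed

text \<open>No condition \<open>\<sigma> H = H\<close> is imposed: the inverse preserves \<open>H\<close> because the second component of \<open>k'\<close> is a
  bijection of \<open>H\<close>.\<close>
lemma induces_pair_inverse:
  assumes "induces_pair G M H \<sigma> k"
    and k: "k \<in> carrier (pair_group G M H)" "k' \<in> carrier (pair_group G M H)"
    and inv: "k \<otimes>\<^bsub>pair_group G M H\<^esub> k' = \<one>\<^bsub>pair_group G M H\<^esub>"
  shows "induces_pair G M H (restrict (inv_into (carrier G) \<sigma>) (carrier G)) k'"
proof -
  note s = induces_pairD[OF assms(1)]
  let ?\<tau> = "restrict (inv_into (carrier G) \<sigma>) (carrier G)"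
  obtain \<beta>' j' where k': "k' = (\<beta>', j')" by (cases k')
  have bj: "\<beta>' \<in> Bij (model M)" "j' \<in> Bij H" using k(2) k' by auto
  have bijs: "restricted_differential G M \<sigma> \<in> Bij (model M)" "restrict \<sigma> H \<in> Bij H" using k(1) s(6) by auto
  have eqs: "compose (model M) (restricted_differential G M \<sigma>) \<beta>' = (\<lambda>v\<in>model M. v)"
    "compose H (restrict \<sigma> H) j' = (\<lambda>x\<in>H. x)"
    using inv bj bijs unfolding s(6) k' by auto
  have \<tau>\<sigma>: "?\<tau> (\<sigma> x) = x" if "x \<in> carrier G" for x
    using s(2) that smooth_closed[OF s(3) that] by (simp add: Bij_def bij_betw_def)
  have hom: "?\<tau> \<in> hom G G" by (rule restrict_inv_into_hom[OF s(1,2)])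
  have bij: "?\<tau> \<in> Bij (carrier G)" by (rule restrict_inv_into_Bij[OF s(2)])
  have sm: "smooth_map_on M M (carrier G) ?\<tau>" by (rule smooth_cong[OF s(4)]) simp
  have "\<sigma> x = inv_into (carrier G) ?\<tau> x" if "x \<in> carrier G" for x
    using inv_into_f_eq[of ?\<tau> "carrier G" "\<sigma> x" x] bij \<tau>\<sigma>[OF that] smooth_closed[OF s(3) that]
    by (simp add: Bij_def bij_betw_def)
  then have sminv: "smooth_map_on M M (carrier G) (inv_into (carrier G) ?\<tau>)"
    by (rule smooth_cong[OF s(3)])
  have \<tau>j: "?\<tau> h = j' h" if "h \<in> H" for h
  proof -
    have j'h: "j' h \<in> H" using Bij_imp_funcset[OF bj(2)] that by blast
    have "compose H (restrict \<sigma> H) j' h = h" using eqs(2) that by simp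
    then have "\<sigma> (j' h) = h" using that j'h by (simp add: compose_def)
    then show ?thesis using \<tau>\<sigma>[of "j' h"] j'h subset_H by auto
  qed
  have d: "tangent_map M M ?\<tau> \<one> v = \<beta>' v" if v: "v \<in> model M" for v
  proof -
    have \<beta>'v: "\<beta>' v \<in> model M" using Bij_imp_funcset[OF bj(1)] v by blast
    have "compose (model M) (restricted_differential G M \<sigma>) \<beta>' v = v" using eqs(1) v by simp
    then have "tangent_map M M \<sigma> \<one> (\<beta>' v) = v"
      using v \<beta>'v by (simp add: compose_def restricted_differential_def)
    then have "tangent_map M M ?\<tau> \<one> v = tangent_map M M (\<lambda>x. ?\<tau> (\<sigma> x)) \<one> (\<beta>' v)"
      using tangent_chain[OF s(3) sm one_closed \<beta>'v] hom_mult_one[OF s(1)] by simp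
    also have "\<dots> = tangent_map M M (\<lambda>x. x) \<one> (\<beta>' v)"
      by (rule tangent_cong[OF _ one_closed \<beta>'v \<tau>\<sigma>]) (use smooth_map_ident in \<open>simp_all add: carrier_eq\<close>)
    also have "\<dots> = \<beta>' v" using tangent_map_ident[of \<one>] \<beta>'v by (simp add: carrier_eq[symmetric])
    finally show ?thesis .
  qed
  have "\<beta>' = restricted_differential G M ?\<tau>"
    using Bij_imp_extensional[OF bj(1)] d
    by (intro extensionalityI[of _ "model M"]) (auto simp: restricted_differential_def)
  moreover have "j' = restrict ?\<tau> H"
    using Bij_imp_extensional[OF bj(2)] \<tau>j by (intro extensionalityI[of _ H]) auto
  moreover have "?\<tau> ` H \<subseteq> H" using \<tau>j Bij_imp_funcset[OF bj(2)] by (auto simp del: restrict_apply)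
  ultimately show ?thesis
    using hom bij sm sminv k' by (simp add: induces_pair_def Lie_Aut_carrier_iff)
qed

end

section \<open>The automorphism group as a semidirect product\<close>

theorem corollary3p5:
  fixes G :: "'a monoid"
    and M :: "('a, 'e::euclidean_space) manifold"
    and H :: "'a set"
    and S :: "(('e \<Rightarrow> 'e) \<times> ('a \<Rightarrow> 'a)) set"
    and N :: "(('e \<Rightarrow> 'e) \<times> ('a \<Rightarrow> 'a), 'f::euclidean_space) manifold"
  assumes "klein_geometry G M H"
    and "connected_space (coset_topology G (mtop M) H)"
    and "subgroup S (Ext G M H)"
    and "lie_subgroup_of_pairs G M H S N"
  shows
    "let K = (Ext G M H)\<lparr>carrier := S \<inter> automorphism_pairs G M H\<rparr>;
         \<alpha> = pair_action G M H;
         A = S_automorphism_group G M H S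
     in group A \<and>
        subgroup (S \<inter> automorphism_pairs G M H) (Ext G M H) \<and>
        (\<forall>k\<in>carrier K. \<exists>!\<sigma>. induces_pair G M H \<sigma> k) \<and>
        \<alpha> \<in> hom K (AutoGroup G) \<and>
        group (semidirect_product G K \<alpha>) \<and>
        (\<lambda>(g, k). \<lambda>x\<in>carrier G. g \<otimes>\<^bsub>G\<^esub> \<alpha> k x) \<in> iso (semidirect_product G K \<alpha>) A"
proof -
  interpret klein_geometry G M H by (rule assms(1))
  note conn = assms(2)
  let ?P = "pair_group G M H"
  let ?Q = "S \<inter> automorphism_pairs G M H"
  let ?E = "Ext G M H"
  let ?B = "BijGroup (carrier G)"
  define K where "K = ?E\<lparr>carrier := ?Q\<rparr>"
  define \<alpha> where "\<alpha> = pair_action G M H"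
  define A where "A = S_automorphism_group G M H S"
  define \<theta> where "\<theta> = (\<lambda>(g, k). \<lambda>x\<in>carrier G. g \<otimes>\<^bsub>G\<^esub> \<alpha> k x)"
  interpret P: group ?P by (intro DirProd_group group_BijGroup)
  interpret B: group ?B by (rule group_BijGroup)
  have S_pairs: "S \<subseteq> Gl (model M) \<times> Lie_Aut G M H"
    using lie_subgroup_of_pairs.subset_pairs[OF assms(4)] by simp
  then have S_P: "S \<subseteq> carrier ?P"
    using GlD(1) by (auto simp: Lie_Aut_def auto_def)
  have "group (?P\<lparr>carrier := S\<rparr>)"
    using assms(4) unfolding lie_subgroup_of_pairs_def lie_group_def by blast
  then have S_sub: "subgroup S ?P" using S_P by (intro P.group_incl_imp_subgroup)
  have E_mult: "x \<otimes>\<^bsub>?E\<^esub> y = x \<otimes>\<^bsub>?P\<^esub> y" "\<one>\<^bsub>?E\<^esub> = \<one>\<^bsub>?P\<^esub>" for x y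
    by (simp_all add: Ext_def)
  have S_E: "S \<subseteq> carrier ?E" using assms(3) subgroup.subset by blast
  have E_P: "carrier ?E \<subseteq> carrier ?P"
    using GlD(1) by (auto simp: Ext_def Lie_Aut_def auto_def)
  \<comment> \<open>The inverse in \<open>Ext\<close> of an element of \<open>S\<close> is its inverse in the group of all pairs of bijections, because the
    latter lies in \<open>S\<close>.\<close>
  have E_inv: "inv\<^bsub>?E\<^esub> k = inv\<^bsub>?P\<^esub> k" if k: "k \<in> S" for k
  proof -
    have i: "inv\<^bsub>?P\<^esub> k \<in> S" using subgroup.m_inv_closed[OF S_sub k] .
    have kP: "k \<in> carrier ?P" using S_P k by blast
    show ?thesis
      unfolding m_inv_def[of ?E]
    proof (rule the_equality)
      show "inv\<^bsub>?P\<^esub> k \<in> carrier ?E \<and> k \<otimes>\<^bsub>?E\<^esub> inv\<^bsub>?P\<^esub> k = \<one>\<^bsub>?E\<^esub> \<and> inv\<^bsub>?P\<^esub> k \<otimes>\<^bsub>?E\<^esub> k = \<one>\<^bsub>?E\<^esub>"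
        unfolding E_mult using i S_E P.r_inv[OF kP] P.l_inv[OF kP] by blast
      fix y assume "y \<in> carrier ?E \<and> k \<otimes>\<^bsub>?E\<^esub> y = \<one>\<^bsub>?E\<^esub> \<and> y \<otimes>\<^bsub>?E\<^esub> k = \<one>\<^bsub>?E\<^esub>"
      then show "y = inv\<^bsub>?P\<^esub> k"
        unfolding E_mult using P.inv_equality[of y k] kP E_P by auto
    qed
  qed
  have ex1: "\<exists>!\<sigma>. induces_pair G M H \<sigma> k" if "k \<in> ?Q" for k
    using that induces_pair_unique[OF conn] unfolding automorphism_pairs_def by blast
  have \<alpha>: "induces_pair G M H (\<alpha> k) k" if "k \<in> ?Q" for k
    unfolding \<alpha>_def pair_action_def using theI'[OF ex1[OF that]] .
  have \<alpha>_eq: "\<alpha> k = \<sigma>" if "induces_pair G M H \<sigma> k" for k \<sigma>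
    unfolding \<alpha>_def by (rule pair_action_eq[OF conn that])
  have Q_P: "k \<in> carrier ?P" if "k \<in> ?Q" for k using that S_P by blast
  have Q_sub: "subgroup ?Q ?P"
  proof (rule P.subgroupI)
    show "?Q \<subseteq> carrier ?P" using S_P by blast
    show "?Q \<noteq> {}"
      using subgroup.one_closed[OF S_sub] induces_pair_one unfolding automorphism_pairs_def by blast
    fix k assume k: "k \<in> ?Q"
    show "inv\<^bsub>?P\<^esub> k \<in> ?Q"
      using induces_pair_inverse[OF \<alpha>[OF k] Q_P[OF k] P.inv_closed[OF Q_P[OF k]] P.r_inv[OF Q_P[OF k]]]
        subgroup.m_inv_closed[OF S_sub] k
      unfolding automorphism_pairs_def by blast
    fix k' assume k': "k' \<in> ?Q"
    show "k \<otimes>\<^bsub>?P\<^esub> k' \<in> ?Q"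
      using induces_pair_compose[OF \<alpha>[OF k] \<alpha>[OF k'] Q_P[OF k] Q_P[OF k']]
        subgroup.m_closed[OF S_sub] k k'
      unfolding automorphism_pairs_def by blast
  qed
  have K_P: "K = ?P\<lparr>carrier := ?Q\<rparr>" by (simp add: K_def Ext_def)
  have K: "group K"
    unfolding K_P by (rule subgroup.subgroup_is_group[OF Q_sub P.group_axioms])
  have QE: "subgroup ?Q ?E"
  proof (rule subgroup.intro)
    show "?Q \<subseteq> carrier ?E" using S_E by blast
    show "\<one>\<^bsub>?E\<^esub> \<in> ?Q" unfolding E_mult by (rule subgroup.one_closed[OF Q_sub])
    show "x \<otimes>\<^bsub>?E\<^esub> y \<in> ?Q" if "x \<in> ?Q" "y \<in> ?Q" for x y
      unfolding E_mult by (rule subgroup.m_closed[OF Q_sub that])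
    show "inv\<^bsub>?E\<^esub> x \<in> ?Q" if "x \<in> ?Q" for x
      using E_inv[of x] subgroup.m_inv_closed[OF Q_sub that] that by simp
  qed
  have K_car: "carrier K = ?Q" by (simp add: K_def)
  have \<alpha>_auto: "\<alpha> k \<in> auto G" if "k \<in> ?Q" for k
    using induces_pairD(1,2)[OF \<alpha>[OF that]] by (simp add: auto_def)
  have \<alpha>_mult: "\<alpha> (k \<otimes>\<^bsub>K\<^esub> k') = compose (carrier G) (\<alpha> k) (\<alpha> k')" if "k \<in> ?Q" "k' \<in> ?Q" for k k'
    using \<alpha>_eq[OF induces_pair_compose[OF \<alpha>[OF that(1)] \<alpha>[OF that(2)] Q_P[OF that(1)] Q_P[OF that(2)]]]
    by (simp add: K_P)
  have \<alpha>_hom: "\<alpha> \<in> hom K (AutoGroup G)"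
    using \<alpha>_auto \<alpha>_mult by (auto simp: hom_def K_car AutoGroup_def auto_def)
  have semi: "group (semidirect_product G K \<alpha>)"
    by (rule semidirect_product_group[OF group_axioms K \<alpha>_hom])
  have carD: "carrier (semidirect_product G K \<alpha>) = carrier G \<times> ?Q"
    by (simp add: semidirect_product_def K_car)
  have \<alpha>c: "\<alpha> k x \<in> carrier G" if "k \<in> ?Q" "x \<in> carrier G" for k x
    using smooth_closed[OF induces_pairD(3)[OF \<alpha>[OF that(1)]] that(2)] .
  have \<theta>_Bij: "\<theta> (g, k) \<in> Bij (carrier G)" if "g \<in> carrier G" "k \<in> ?Q" for g k
    using induces_pair_automorphism(1)[of "\<alpha> k" "fst k" "snd k" g] \<alpha>[OF that(2)] that(1)
    by (simp add: \<theta>_def)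
  have \<theta>_hom: "\<theta> \<in> hom (semidirect_product G K \<alpha>) ?B"
  proof (rule homI)
    fix x y assume "x \<in> carrier (semidirect_product G K \<alpha>)" "y \<in> carrier (semidirect_product G K \<alpha>)"
    then obtain g k g' k' where x: "x = (g, k)" "g \<in> carrier G" "k \<in> ?Q"
      and y: "y = (g', k')" "g' \<in> carrier G" "k' \<in> ?Q"
      unfolding carD by blast
    show "\<theta> x \<in> carrier ?B" using \<theta>_Bij x by simp
    have "\<theta> x \<otimes>\<^bsub>?B\<^esub> \<theta> y = compose (carrier G) (\<theta> x) (\<theta> y)"
      using \<theta>_Bij x y by simp
    also have "\<dots> = \<theta> (x \<otimes>\<^bsub>semidirect_product G K \<alpha>\<^esub> y)"
    proof (rule extensionalityI[of _ "carrier G"])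
      fix z assume z: "z \<in> carrier G"
      have "\<alpha> k (g' \<otimes>\<^bsub>G\<^esub> \<alpha> k' z) = \<alpha> k g' \<otimes>\<^bsub>G\<^esub> \<alpha> k (\<alpha> k' z)"
        using induces_pairD(1)[OF \<alpha>[OF x(3)]] y z \<alpha>c by (simp add: hom_mult)
      then show "compose (carrier G) (\<theta> x) (\<theta> y) z = \<theta> (x \<otimes>\<^bsub>semidirect_product G K \<alpha>\<^esub> y) z"
        using x y z \<alpha>c by (simp add: \<theta>_def semidirect_product_def compose_def \<alpha>_mult m_assoc)
    qed (simp_all add: \<theta>_def split: prod.splits)
    finally show "\<theta> (x \<otimes>\<^bsub>semidirect_product G K \<alpha>\<^esub> y) = \<theta> x \<otimes>\<^bsub>?B\<^esub> \<theta> y" by simp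
  qed
  have inj: "inj_on \<theta> (carrier (semidirect_product G K \<alpha>))"
  proof (rule inj_onI)
    fix x y assume "x \<in> carrier (semidirect_product G K \<alpha>)" "y \<in> carrier (semidirect_product G K \<alpha>)"
      and eq: "\<theta> x = \<theta> y"
    then obtain g k g' k' where x: "x = (g, k)" "g \<in> carrier G" "k \<in> ?Q"
      and y: "y = (g', k')" "g' \<in> carrier G" "k' \<in> ?Q"
      unfolding carD by blast
    have val: "g \<otimes>\<^bsub>G\<^esub> \<alpha> k z = g' \<otimes>\<^bsub>G\<^esub> \<alpha> k' z" if "z \<in> carrier G" for z
      using fun_cong[OF eq, of z] x(1) y(1) that by (simp add: \<theta>_def)
    have "g = g'"
      using val[OF one_closed] hom_mult_one[OF induces_pairD(1)[OF \<alpha>[OF x(3)]]]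
        hom_mult_one[OF induces_pairD(1)[OF \<alpha>[OF y(3)]]] x(2) y(2) by simp
    then have "\<alpha> k z = \<alpha> k' z" if "z \<in> carrier G" for z
      using val[OF that] x y \<alpha>c that by simp
    then have "\<alpha> k = \<alpha> k'"
      using Bij_imp_extensional induces_pairD(2)[OF \<alpha>[OF x(3)]] induces_pairD(2)[OF \<alpha>[OF y(3)]]
      by (intro extensionalityI[of _ "carrier G"]) auto
    then have "k = k'"
      using induces_pairD(6)[OF \<alpha>[OF x(3)]] induces_pairD(6)[OF \<alpha>[OF y(3)]] by simp
    with \<open>g = g'\<close> show "x = y" using x(1) y(1) by simp
  qed
  have carA: "carrier A = {\<Phi> \<in> Bij (carrier G). \<exists>(\<beta>, j)\<in>S. bundle_morphism G M H j \<Phi> \<and>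
        (\<forall>x\<in>carrier G. \<forall>v\<in>model M.
           pullback_form M \<Phi> (maurer_cartan G M) x v = \<beta> (maurer_cartan G M x v))}"
    by (simp add: A_def S_automorphism_group_def tangent_space_def)
  have img: "\<theta> ` carrier (semidirect_product G K \<alpha>) = carrier A"
  proof
    show "\<theta> ` carrier (semidirect_product G K \<alpha>) \<subseteq> carrier A"
    proof
      fix \<Phi> assume "\<Phi> \<in> \<theta> ` carrier (semidirect_product G K \<alpha>)"
      then obtain g \<beta> j where *: "g \<in> carrier G" "(\<beta>, j) \<in> ?Q" "\<Phi> = \<theta> (g, (\<beta>, j))"
        unfolding carD by auto
      then have "\<Phi> = (\<lambda>x\<in>carrier G. g \<otimes>\<^bsub>G\<^esub> \<alpha> (\<beta>, j) x)" by (simp add: \<theta>_def)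
      with induces_pair_automorphism[OF \<alpha>[OF *(2)] *(1)] *(2) show "\<Phi> \<in> carrier A"
        unfolding carA by blast
    qed
    show "carrier A \<subseteq> \<theta> ` carrier (semidirect_product G K \<alpha>)"
    proof
      fix \<Phi> assume "\<Phi> \<in> carrier A"
      then obtain \<beta> j where *: "\<Phi> \<in> Bij (carrier G)" "(\<beta>, j) \<in> S" "bundle_morphism G M H j \<Phi>"
        "\<And>x v. x \<in> carrier G \<Longrightarrow> v \<in> model M \<Longrightarrow>
           pullback_form M \<Phi> (maurer_cartan G M) x v = \<beta> (maurer_cartan G M x v)"
        unfolding carA by blast
      have bj: "\<beta> \<in> Gl (model M)" "j \<in> Bij H"
        using S_pairs *(2) by (auto simp: Lie_Aut_def auto_def)
      obtain \<sigma> where \<sigma>: "induces_pair G M H \<sigma> (\<beta>, j)" "\<Phi> = (\<lambda>x\<in>carrier G. \<Phi> \<one>\<^bsub>G\<^esub> \<otimes>\<^bsub>G\<^esub> \<sigma> x)"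
        by (rule automorphism_induces_pair[OF conn bj *(1,3,4)])
      have "(\<beta>, j) \<in> ?Q" using *(2) \<sigma>(1) unfolding automorphism_pairs_def by blast
      moreover have "\<Phi> \<one>\<^bsub>G\<^esub> \<in> carrier G" using Bij_imp_funcset[OF *(1)] by blast
      moreover have "\<Phi> = \<theta> (\<Phi> \<one>\<^bsub>G\<^esub>, (\<beta>, j))"
        using \<sigma>(2) \<alpha>_eq[OF \<sigma>(1)] by (simp add: \<theta>_def)
      ultimately show "\<Phi> \<in> \<theta> ` carrier (semidirect_product G K \<alpha>)"
        unfolding carD by blast
    qed
  qed
  have A_B: "A = ?B\<lparr>carrier := carrier A\<rparr>" by (simp add: A_def S_automorphism_group_def)
  interpret \<theta>: group_hom "semidirect_product G K \<alpha>" ?B \<theta>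
    using semi \<theta>_hom B.group_axioms by (simp add: group_hom_def group_hom_axioms_def)
  \<comment> \<open>The automorphisms form a group as the image of a homomorphism into the group of bijections of \<open>G\<close>.\<close>
  have A_sub: "subgroup (carrier A) ?B" using \<theta>.img_is_subgroup img by simp
  have A: "group A"
    by (subst A_B) (rule subgroup.subgroup_is_group[OF A_sub B.group_axioms])
  have "\<theta> \<in> hom (semidirect_product G K \<alpha>) A"
  proof (rule homI)
    show "\<theta> x \<in> carrier A" if "x \<in> carrier (semidirect_product G K \<alpha>)" for x using img that by blast
    have "x \<otimes>\<^bsub>A\<^esub> y = x \<otimes>\<^bsub>?B\<^esub> y" for x y by (subst A_B) simp
    then show "\<theta> (x \<otimes>\<^bsub>semidirect_product G K \<alpha>\<^esub> y) = \<theta> x \<otimes>\<^bsub>A\<^esub> \<theta> y"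
      if "x \<in> carrier (semidirect_product G K \<alpha>)" "y \<in> carrier (semidirect_product G K \<alpha>)" for x y
      using \<theta>.hom_mult that by simp
  qed
  then have "\<theta> \<in> iso (semidirect_product G K \<alpha>) A"
    using inj img by (simp add: iso_def bij_betw_def)
  then have "group A \<and> subgroup ?Q ?E \<and> (\<forall>k\<in>carrier K. \<exists>!\<sigma>. induces_pair G M H \<sigma> k) \<and>
      \<alpha> \<in> hom K (AutoGroup G) \<and> group (semidirect_product G K \<alpha>) \<and>
      \<theta> \<in> iso (semidirect_product G K \<alpha>) A"
    using A QE ex1 \<alpha>_hom semi by (simp only: K_car) blast
  then show ?thesis
    unfolding Let_def \<theta>_def K_def \<alpha>_def A_def .
qed

end
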